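(* For each $N\in\mathbb{N}$, $N\ge1$, there exists a finite sequence $\sigma_N\in\mathbb{D}_*^N$ such that for all $1\le p<2$ (with the sequences $\sigma_N$ not depending on $p$) we have $$\lim_{N\to\infty}\ \prod_{\lambda\in\sigma_N}|\lambda|\cdot\mathrm{cap}_{\mathcal{B}^0_{p,p}}(\sigma_N)=\infty,$$ where the product is taken over the entries of $\sigma_N$ counted with multiplicity.
   Context: $\mathbb{D}$ is the open unit disc in $\mathbb{C}$, $\mathbb{D}_*=\mathbb{D}\setminus\{0\}$, $\mathbb{T}$ is the unit circle with normalized Lebesgue measure. Besov spaces: for $1\le p<\infty$, $\mathcal{B}^0_{p,p}$ is the Banach space of analytic functions $f$ on $\mathbb{D}$ with $$\|f\|_{\mathcal{B}^0_{p,p}}=|f(0)|+\Big(\int_0^1(1-\rho)^{p-1}\|f'_\rho\|^p_{L^p(\mathbb{T})}\,d\rho\Big)^{1/p}<\infty,$$ where $f'_\rho(\zeta)=f'(\rho\zeta)$ for $\zeta\in\mathbb{T}$. Capacity: for a Banach space $X$ of analytic functions on $\mathbb{D}$ and a finite sequence $\sigma=(\lambda_1,\dots,\lambda_N)\in\mathbb{D}_*^N$, $\mathrm{cap}_X(\sigma)=\inf\{\|f\|_X: f\in X,\ f(0)=1,\ f|\sigma=0\}$, where $f|\sigma=0$ means that $f$ vanishes at every point of $\sigma$ with multiplicity at least the number of times that point occurs in $\sigma$. *)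

theory Defs
  imports "HOL-Complex_Analysis.Complex_Analysis"
begin

text \<open>
  Functions on the unit disc are total functions on the complex plane; everything below depends
  only on their values on \<^term>\<open>ball (0::complex) 1\<close>.
\<close>

text \<open>The norm of \<open>L\<^sup>p\<close> of the unit circle, with normalized Lebesgue measure
  \<open>dt / (2 \<pi>)\<close> in the parametrization \<^term>\<open>cis\<close>.\<close>

definition circle_Lp_norm :: "real \<Rightarrow> (complex \<Rightarrow> complex) \<Rightarrow> real" where
  "circle_Lp_norm p g =
     (1 / (2 * pi) * (LBINT t:{0..2 * pi}. norm (g (cis t)) powr p)) powr (1 / p)"

definition besov_integral :: "real \<Rightarrow> (complex \<Rightarrow> complex) \<Rightarrow> ennreal" where
  "besov_integral p f =
     (\<integral>\<^sup>+\<rho>\<in>{0..<1}. ennreal ((1 - \<rho>) powr (p - 1) *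
        circle_Lp_norm p (\<lambda>\<zeta>. deriv f (of_real \<rho> * \<zeta>)) powr p) \<partial>lborel)"

definition besov_space :: "real \<Rightarrow> (complex \<Rightarrow> complex) set" where
  "besov_space p = {f. f holomorphic_on ball 0 1 \<and> besov_integral p f < \<infinity>}"

definition besov_norm :: "real \<Rightarrow> (complex \<Rightarrow> complex) \<Rightarrow> real" where
  "besov_norm p f = norm (f 0) + enn2real (besov_integral p f) powr (1 / p)"

text \<open>Vanishing on a finite sequence, counted with multiplicity: a zero of multiplicity at least
  \<open>m\<close> is a common zero of the derivatives of order \<open>0, \<dots>, m - 1\<close>.\<close>

definition vanishes_on_seq :: "(complex \<Rightarrow> complex) \<Rightarrow> complex list \<Rightarrow> bool" where
  "vanishes_on_seq f \<sigma> \<longleftrightarrow>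
     (\<forall>z\<in>set \<sigma>. \<forall>k<count_list \<sigma> z. (deriv ^^ k) f z = 0)"

text \<open>The infimum is taken in the reals. For \<open>X\<close> containing the polynomials and \<open>\<sigma>\<close> avoiding
  \<open>0\<close>, the set is nonempty (take the normalized product of the factors \<open>z - \<lambda>\<close>), and it is
  bounded below by \<open>0\<close> whenever \<open>nrm\<close> is a norm.\<close>

definition capacity ::
    "(complex \<Rightarrow> complex) set \<Rightarrow> ((complex \<Rightarrow> complex) \<Rightarrow> real) \<Rightarrow> complex list \<Rightarrow> real" where
  "capacity X nrm \<sigma> = Inf (nrm ` {f \<in> X. f 0 = 1 \<and> vanishes_on_seq f \<sigma>})"

end

theory Submission
  imports Defs "HOL-Real_Asymp.Real_Asymp" "HOL-Computational_Algebra.Fundamental_Theorem_Algebra"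
begin

text \<open>
  Let \<open>f\<close> vanish on \<open>\<sigma>\<close>, let \<open>f 0 = 1\<close>, and write \<open>f = B g\<close> with the finite Blaschke product \<open>B\<close>
  that has the zeros \<open>\<sigma>\<close>. Then \<open>\<bar>g 0\<bar>\<close> is the reciprocal of the product of the \<open>\<bar>\<lambda>\<bar>\<close>, so the theorem
  says that \<open>\<sigma>\<close> can be chosen such that \<open>\<bar>g 0\<bar> = 1\<close> forces \<open>B g\<close> to have a large Besov norm.

  As \<open>\<bar>B\<bar> = 1\<close> on the circle, \<open>g 0\<close> is the mean of \<open>g = f cnj B\<close>, and the Littlewood-Paley identity
  turns this pairing into an integral of \<open>f' cnj B'\<close> against a weight of the size \<open>1 - \<bar>z\<bar>\<close>. If
  \<open>(1 - \<bar>z\<bar>) \<bar>B'\<bar> \<le> \<beta>\<close> with a small \<open>\<beta>\<close>, then, since \<open>p < 2\<close>, the pairing is small: pointwise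
  \<open>a c \<le> \<kappa> c\<^sup>2 + \<kappa>\<^bsup>1-p\<^esup> \<beta>\<^bsup>2-p\<^esup> a\<^sup>p\<close> for \<open>a = (1 - \<bar>z\<bar>) \<bar>f'\<bar>\<close> and \<open>c = (1 - \<bar>z\<bar>) \<bar>B'\<bar> \<le> \<beta>\<close>; the first term
  integrates to at most \<open>\<kappa>\<close> times the square mean of \<open>B\<close>, the second one to a multiple of the Besov
  integral with a factor proportional to \<open>\<beta>\<^bsup>2-p\<^esup>\<close> (\<open>besov_pairing\<close>). This contains the case \<open>p = 1\<close>,
  where the dual space is the Bloch space.

  A finite Blaschke product never has a small Bloch seminorm: near the outermost point with
  \<open>\<bar>B\<bar> = 1/2\<close>, the function \<open>log \<bar>B\<bar>\<close> is harmonic down to the circle, where it vanishes, and it has to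
  change at a definite rate. So \<open>B\<close> is only required to be close, on a circle \<open>\<bar>z\<bar> = r\<close>, to an entire
  function \<open>\<theta>\<close> with \<open>\<bar>\<theta>\<bar> < 1\<close> and a small Bloch seminorm. The price is the region where \<open>\<bar>\<theta>\<bar>\<close> is not
  close to \<open>1\<close>; it is a small part of the circle, but \<open>g\<close> could be concentrated there. A second
  analytic function \<open>w\<close> with \<open>w 0 = 1\<close> that is small on this part repairs this: on \<open>\<bar>z\<bar> = r\<close>,
  \<open>g w = f cnj \<theta> w + g w (1 - B cnj \<theta>)\<close>, and the last factor \<open>w (1 - B cnj \<theta>)\<close> is uniformly small, while
  the mean of \<open>\<bar>g\<bar>\<close> is controlled by that of \<open>\<bar>f\<bar>\<close>, hence by the Besov norm (\<open>besov_mean_bound\<close>).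
  The first term is the pairing of \<open>f\<close> with \<open>\<theta> cnj w\<close>, whose analytic projection must therefore have
  a small Bloch seminorm; \<open>bloch_bound_product\<close> gives this when the gradient of \<open>w\<close> is dominated by
  a small multiple of that of a bounded analytic function.

  The pair \<open>\<theta>, w\<close> comes from a Riesz product \<open>\<tau>\<close>, a product of many factors \<open>q (1 + b Re z\<^sup>m)\<close> with
  rapidly increasing exponents \<open>m\<close>. With the right \<open>q < 1\<close> the mean of \<open>\<tau>\<^sup>2\<close> stays \<open>1\<close> while the mean
  \<open>\<eta>\<close> of \<open>\<tau>\<close> tends to \<open>0\<close>, so \<open>\<tau>\<close> is small on most of the circle. Let \<open>F\<close> and \<open>H\<close> be the analytic
  functions with the real parts \<open>\<tau>\<^sup>2\<close> and \<open>\<tau>\<close>. A small \<open>b\<close> makes \<open>(1 - \<bar>z\<bar>) \<bar>F'\<bar>\<close> a small multiple of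
  \<open>Re F\<close> (\<open>riesz_stage_exists\<close>), so \<open>\<theta> = exp (- 2 F)\<close> has a small Bloch seminorm, and
  \<open>1 - \<bar>\<theta>\<bar>\<^sup>2 \<le> 4 \<tau>\<^sup>2\<close>. The function \<open>w = (2 \<eta> / (H + \<eta>))\<^sup>\<delta>\<close> equals \<open>1\<close> at \<open>0\<close>, is bounded by \<open>2\<close>, and is
  small where \<open>\<tau>\<close> is not; its logarithm has a bounded imaginary part (\<open>bloch_pair_exists\<close>).
  Finally, if \<open>P\<close> is a polynomial close to \<open>\<theta>\<close>, then \<open>z\<^sup>N + P\<close> is the numerator of a Blaschke product
  of degree \<open>N\<close> that tends to \<open>P\<close> inside the disc, which provides \<open>\<sigma>\<close> for every large \<open>N\<close>.
\<close>

section \<open>Means over the unit circle\<close>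

definition circle_mean :: "(complex \<Rightarrow> 'a::euclidean_space) \<Rightarrow> 'a" where
  "circle_mean g = (1 / (2 * pi)) *\<^sub>R integral {0..2 * pi} (\<lambda>t. g (cis t))"

lemma continuous_on_circle_path:
  assumes "continuous_on (sphere 0 1) g"
  shows "continuous_on {0..2 * pi} (\<lambda>t. g (cis t))"
  by (rule continuous_on_compose2[OF assms]) (auto intro!: continuous_intros)

lemma circle_path_integrable:
  fixes g :: "complex \<Rightarrow> 'a::euclidean_space"
  assumes "continuous_on (sphere 0 1) g"
  shows "(\<lambda>t. g (cis t)) integrable_on {0..2 * pi}"
  by (rule integrable_continuous_real[OF continuous_on_circle_path[OF assms]])

lemma continuous_on_dilated_circle:
  fixes F :: "complex \<Rightarrow> complex"
  assumes "continuous_on (ball 0 R) F" "0 \<le> s" "s < R"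
  shows "continuous_on (sphere 0 1) (\<lambda>z. F (of_real s * z))"
  by (rule continuous_on_compose2[OF assms(1)])
    (use assms in \<open>auto intro!: continuous_intros simp: norm_mult\<close>)

lemma circle_mean_cong:
  assumes "\<And>z. norm z = 1 \<Longrightarrow> f z = g z"
  shows "circle_mean f = circle_mean g"
  unfolding circle_mean_def using assms by simp

lemma circle_mean_const [simp]: "circle_mean (\<lambda>_. c) = c"
  by (simp add: circle_mean_def)

lemma circle_mean_add:
  assumes "continuous_on (sphere 0 1) f" "continuous_on (sphere 0 1) g"
  shows "circle_mean (\<lambda>z. f z + g z) = circle_mean f + circle_mean g"
  unfolding circle_mean_def
  using integral_add[OF assms[THEN circle_path_integrable]] by (simp add: scaleR_add_right)

lemma circle_mean_diff:
  assumes "continuous_on (sphere 0 1) f" "continuous_on (sphere 0 1) g"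
  shows "circle_mean (\<lambda>z. f z - g z) = circle_mean f - circle_mean g"
  unfolding circle_mean_def
  using integral_diff[OF assms[THEN circle_path_integrable]] by (simp add: scaleR_diff_right)

lemma circle_mean_cmult:
  fixes c :: "'a::{real_normed_field,euclidean_space}"
  shows "circle_mean (\<lambda>z. c * f z) = c * circle_mean f"
  by (simp add: circle_mean_def)

lemma circle_mean_cmult_right:
  fixes c :: "'a::{real_normed_field,euclidean_space}"
  shows "circle_mean (\<lambda>z. f z * c) = circle_mean f * c"
  by (simp add: circle_mean_def)

lemma circle_mean_cnj: "circle_mean (\<lambda>z. cnj (f z)) = cnj (circle_mean f)"
  by (simp add: circle_mean_def integral_cnj)

lemma circle_mean_of_real:
  fixes f :: "complex \<Rightarrow> real"
  assumes "continuous_on (sphere 0 1) f"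
  shows "circle_mean (\<lambda>z. complex_of_real (f z)) = of_real (circle_mean f)"
  using integral_linear[OF circle_path_integrable[OF assms] bounded_linear_of_real[where 'a=complex]]
  unfolding circle_mean_def o_def by (simp add: scaleR_conv_of_real)



lemma circle_mean_mono:
  fixes f g :: "complex \<Rightarrow> real"
  assumes "continuous_on (sphere 0 1) f" "continuous_on (sphere 0 1) g"
    and "\<And>z. norm z = 1 \<Longrightarrow> f z \<le> g z"
  shows "circle_mean f \<le> circle_mean g"
  unfolding circle_mean_def
  using integral_le[OF assms(1,2)[THEN circle_path_integrable]] assms(3)
  by (simp add: divide_right_mono)

lemma circle_mean_nonneg:
  fixes f :: "complex \<Rightarrow> real"
  assumes "continuous_on (sphere 0 1) f" and "\<And>z. norm z = 1 \<Longrightarrow> 0 \<le> f z"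
  shows "0 \<le> circle_mean f"
  using circle_mean_mono[of "\<lambda>_. 0" f] assms by simp

lemma norm_circle_mean_le:
  assumes "continuous_on (sphere 0 1) f"
  shows "norm (circle_mean f) \<le> circle_mean (\<lambda>z. norm (f z))"
proof -
  have "norm (integral {0..2 * pi} (\<lambda>t. f (cis t))) \<le> integral {0..2 * pi} (\<lambda>t. norm (f (cis t)))"
    by (rule integral_norm_bound_integral)
      (use assms in \<open>auto intro!: circle_path_integrable continuous_intros
         circle_path_integrable[where g = "\<lambda>z. norm (f z)"]\<close>)
  then show ?thesis
    by (simp add: circle_mean_def divide_right_mono)
qed

lemma norm_circle_mean_bound:
  assumes "continuous_on (sphere 0 1) f" and "\<And>z. norm z = 1 \<Longrightarrow> norm (f z) \<le> B"
  shows "norm (circle_mean f) \<le> B"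
proof -
  have "norm (circle_mean f) \<le> circle_mean (\<lambda>z. norm (f z))"
    by (rule norm_circle_mean_le[OF assms(1)])
  also have "\<dots> \<le> circle_mean (\<lambda>_. B)"
    using assms by (intro circle_mean_mono continuous_intros) auto
  finally show ?thesis by simp
qed

lemma circle_mean_swap:
  fixes f :: "complex \<Rightarrow> complex \<Rightarrow> 'a::euclidean_space"
  assumes "continuous_on (sphere 0 1 \<times> sphere 0 1) (\<lambda>(x, y). f x y)"
  shows "circle_mean (\<lambda>x. circle_mean (\<lambda>y. f x y)) = circle_mean (\<lambda>y. circle_mean (\<lambda>x. f x y))"
proof -
  have c: "continuous_on (cbox (0, 0) (2 * pi, 2 * pi)) (\<lambda>(s, t). f (cis s) (cis t))"
    unfolding case_prod_unfold
    by (rule continuous_on_compose2[OF assms, of _ "\<lambda>p. (cis (fst p), cis (snd p))",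
          unfolded case_prod_unfold, simplified])
      (auto intro!: continuous_intros)
  show ?thesis
    using integral_swap_continuous[OF c] by (simp add: circle_mean_def)
qed

lemma continuous_on_circle_mean:
  fixes f :: "'b::metric_space \<Rightarrow> complex \<Rightarrow> 'a::euclidean_space"
  assumes "continuous_on (S \<times> sphere 0 1) (\<lambda>(x, z). f x z)"
  shows "continuous_on S (\<lambda>x. circle_mean (f x))"
proof -
  have c: "continuous_on (S \<times> cbox 0 (2 * pi)) (\<lambda>(x, t). f x (cis t))"
    unfolding case_prod_unfold
    by (rule continuous_on_compose2[OF assms, of _ "\<lambda>p. (fst p, cis (snd p))",
          unfolded case_prod_unfold, simplified])
      (auto intro!: continuous_intros)
  show ?thesis
    unfolding circle_mean_def
    using integral_continuous_on_param[OF c] by (intro continuous_intros) simp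
qed

text \<open>On the unit circle \<open>1 - a * cnj z = (z - a) / z\<close>, so this is the Cauchy integral formula, the
  factor \<open>1 / z\<close> of \<open>dz = \<i> z dt\<close> being absorbed by the kernel.\<close>

lemma circle_mean_Cauchy:
  assumes "f holomorphic_on ball 0 R" "1 < R" "norm a < 1"
  shows "circle_mean (\<lambda>z. f z / (1 - a * cnj z)) = f a"
proof -
  have "f holomorphic_on cball 0 1"
    using assms by (auto intro: holomorphic_on_subset)
  then have "((\<lambda>u. f u / (u - a)) has_contour_integral (2 * of_real pi * \<i> * f a)) (circlepath 0 1)"
    using assms by (intro Cauchy_integral_circlepath_simple) auto
  then have "integral {0..2 * pi} (\<lambda>t. f (cis t) / (cis t - a) * \<i> * cis t) = 2 * of_real pi * \<i> * f a"
    unfolding circlepath_def by (subst (asm) has_contour_integral_part_circlepath_iff)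
      (auto dest: integral_unique)
  moreover have "f (cis t) / (cis t - a) * \<i> * cis t = \<i> * (f (cis t) / (1 - a * cnj (cis t)))" for t
  proof -
    have "cis t * cnj (cis t) = 1" by (simp add: cis_cnj cis_mult)
    moreover have "cis t \<noteq> a" using assms by auto
    moreover have "cis t \<noteq> 0" by simp
    ultimately have "1 - a * cnj (cis t) = (cis t - a) / cis t"
      by (simp add: field_simps)
    then show ?thesis by simp
  qed
  ultimately have "integral {0..2 * pi} (\<lambda>t. \<i> * (f (cis t) / (1 - a * cnj (cis t)))) = 2 * of_real pi * \<i> * f a"
    by simp
  then have "\<i> * integral {0..2 * pi} (\<lambda>t. f (cis t) / (1 - a * cnj (cis t))) = 2 * of_real pi * \<i> * f a"
    by (simp only: integral_mult_right)
  then show ?thesis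
    by (simp add: circle_mean_def scaleR_conv_of_real field_simps)
qed

lemma one_minus_cnj_nonzero:
  fixes a z :: complex
  assumes "norm a < 1" "norm z \<le> 1"
  shows "1 - a * cnj z \<noteq> 0" "1 - a * z \<noteq> 0"
proof -
  have "norm (a * z) < 1"
    using assms by (simp add: norm_mult) (metis mult_le_one less_eq_real_def mult_left_le
        norm_ge_zero order_le_less_trans)
  then have "norm (a * z) \<noteq> norm (1::complex)" "norm (a * cnj z) \<noteq> norm (1::complex)"
    by (simp_all add: norm_mult)
  then show "1 - a * z \<noteq> 0" "1 - a * cnj z \<noteq> 0"
    by (metis eq_iff_diff_eq_0)+
qed

text \<open>The integrand is the product of the Cauchy kernel and of the analytic function
  \<open>1 / (1 - cnj a * z)\<close>, so the Cauchy formula evaluates the latter at \<open>a\<close>.\<close>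

lemma circle_mean_Poisson:
  assumes "norm a < 1"
  shows "circle_mean (\<lambda>z. 1 / (norm (1 - a * cnj z))\<^sup>2) = 1 / (1 - (norm a)\<^sup>2)"
proof -
  define R where "R = (if a = 0 then 2 else 1 / norm a)"
  have R: "1 < R" using assms by (auto simp: R_def)
  have "1 - cnj a * z \<noteq> 0" if "z \<in> ball 0 R" for z
  proof
    assume "1 - cnj a * z = 0"
    then have "norm (cnj a * z) = 1" by simp
    then show False using that by (auto simp: R_def norm_mult field_simps split: if_splits)
  qed
  then have "(\<lambda>z. 1 / (1 - cnj a * z)) holomorphic_on ball 0 R"
    by (intro holomorphic_intros) auto
  from circle_mean_Cauchy[OF this R assms]
  have "circle_mean (\<lambda>z. 1 / (1 - cnj a * z) / (1 - a * cnj z)) = 1 / (1 - cnj a * a)" .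
  moreover have "1 / (1 - cnj a * z) / (1 - a * cnj z) = of_real (1 / (norm (1 - a * cnj z))\<^sup>2)" for z
  proof -
    have "(1 - cnj a * z) * (1 - a * cnj z) = of_real ((norm (1 - a * cnj z))\<^sup>2)"
      by (subst complex_norm_square) (simp add: algebra_simps)
    then show ?thesis by (simp add: divide_divide_eq_left)
  qed
  moreover have "1 / (1 - cnj a * a) = complex_of_real (1 / (1 - (norm a)\<^sup>2))"
    using complex_norm_square[of a] by (simp add: mult.commute)
  moreover have "continuous_on (sphere 0 1) (\<lambda>z. 1 / (norm (1 - a * cnj z))\<^sup>2)"
    using one_minus_cnj_nonzero[OF assms] by (intro continuous_intros) auto
  ultimately have "complex_of_real (circle_mean (\<lambda>z. 1 / (norm (1 - a * cnj z))\<^sup>2))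
      = of_real (1 / (1 - (norm a)\<^sup>2))"
    by (simp add: circle_mean_of_real[symmetric] del: of_real_divide)
  then show ?thesis by (simp only: of_real_eq_iff)
qed

text \<open>The value of \<open>g\<close> at \<open>r x\<close> is the Poisson average of its values at radius \<open>R\<close>. The Poisson kernel
  of \<open>r / R\<close> is symmetric in its two arguments on the circle and has mean \<open>1\<close> in each of them, so
  the claim follows by exchanging the two means.\<close>

lemma circle_mean_norm_mono:
  assumes g: "g holomorphic_on ball 0 1" and r: "0 < r" "r < R" "R < 1"
  shows "circle_mean (\<lambda>z. norm (g (of_real r * z))) \<le> circle_mean (\<lambda>z. norm (g (of_real R * z)))"
proof -
  define q where "q = r / R"
  have q: "0 < q" "q < 1" using r by (auto simp: q_def)
  define P where "P = (\<lambda>x y :: complex. (1 - q\<^sup>2) / (norm (1 - of_real q * x * cnj y))\<^sup>2)"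
  have nz: "1 - of_real q * x * cnj y \<noteq> 0" if "norm x = 1" "norm y = 1" for x y :: complex
    using one_minus_cnj_nonzero[of "of_real q * x" y] that q by (simp add: norm_mult)
  have Psym: "P x y = P y x" for x y
  proof -
    have "cnj (1 - of_real q * x * cnj y) = 1 - of_real q * y * cnj x" by (simp add: mult_ac)
    then show ?thesis unfolding P_def by (metis complex_mod_cnj)
  qed
  have Pmean: "circle_mean (P x) = 1" if "norm x = 1" for x
  proof -
    have "circle_mean (\<lambda>y. 1 / (norm (1 - (of_real q * x) * cnj y))\<^sup>2) = 1 / (1 - q\<^sup>2)"
      using circle_mean_Poisson[of "of_real q * x"] that q by (simp add: norm_mult)
    then have "(1 - q\<^sup>2) * circle_mean (\<lambda>y. 1 / (norm (1 - (of_real q * x) * cnj y))\<^sup>2) = 1"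
      using q by (simp add: power2_eq_1_iff)
    then show ?thesis unfolding P_def by (simp only: circle_mean_cmult[symmetric] times_divide_eq_right mult_1_right)
  qed
  have gR: "(\<lambda>z. g (of_real R * z)) holomorphic_on ball 0 (1 / R)"
    by (rule holomorphic_on_compose_gen[OF _ g, unfolded o_def])
      (use r in \<open>auto intro!: holomorphic_intros simp: norm_mult field_simps\<close>)
  have cgR: "continuous_on (sphere 0 1) (\<lambda>z. g (of_real R * z))"
    by (rule continuous_on_dilated_circle[OF holomorphic_on_imp_continuous_on[OF g]]) (use r in auto)
  have cgr: "continuous_on (sphere 0 1) (\<lambda>z. g (of_real r * z))"
    by (rule continuous_on_dilated_circle[OF holomorphic_on_imp_continuous_on[OF g]]) (use r in auto)
  have cP: "continuous_on (sphere 0 1) (P x)" if "norm x = 1" for x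
    unfolding P_def using nz that by (intro continuous_intros) auto
  have bound: "norm (g (of_real r * x)) \<le> circle_mean (\<lambda>y. norm (g (of_real R * y)) * P x y)"
    if x: "norm x = 1" for x
  proof -
    let ?a = "of_real q * x"
    define G where "G = (\<lambda>z. g (of_real R * z) * (1 - of_real (q\<^sup>2)) / (1 - cnj ?a * z))"
    have R1: "1 < min (1 / R) (1 / q)" using r q by auto
    have "1 - cnj ?a * z \<noteq> 0" if "z \<in> ball 0 (1 / q)" for z
    proof
      assume "1 - cnj ?a * z = 0"
      then have "norm (cnj ?a * z) = 1" by simp
      then show False using that q x by (auto simp: norm_mult field_simps)
    qed
    then have "G holomorphic_on ball 0 (min (1 / R) (1 / q))"
      unfolding G_def
      by (intro holomorphic_intros holomorphic_on_subset[OF gR]) auto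
    from circle_mean_Cauchy[OF this R1, of ?a]
    have "G ?a = circle_mean (\<lambda>y. G y / (1 - ?a * cnj y))"
      using q x by (simp add: norm_mult)
    also have "G ?a = g (of_real r * x)"
    proof -
      have "cnj ?a * ?a = of_real (q\<^sup>2)"
        using complex_norm_square[of ?a] q x by (simp add: norm_mult mult.commute)
      moreover have "q\<^sup>2 \<noteq> 1" using q by (simp add: power2_eq_1_iff)
      then have "1 - complex_of_real (q\<^sup>2) \<noteq> 0" by (metis eq_iff_diff_eq_0 of_real_1 of_real_eq_iff)
      moreover have "of_real R * ?a = of_real r * x" using r by (simp add: q_def)
      ultimately show ?thesis unfolding G_def
        by (simp only: nonzero_mult_div_cancel_right not_False_eq_True)
    qed
    also have "circle_mean (\<lambda>y. G y / (1 - ?a * cnj y)) = circle_mean (\<lambda>y. g (of_real R * y) * of_real (P x y))"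
    proof (rule circle_mean_cong)
      fix y :: complex assume y: "norm y = 1"
      have "(1 - cnj ?a * y) * (1 - ?a * cnj y) = of_real ((norm (1 - ?a * cnj y))\<^sup>2)"
        by (subst complex_norm_square) (simp add: algebra_simps)
      then show "G y / (1 - ?a * cnj y) = g (of_real R * y) * of_real (P x y)"
        by (simp add: G_def P_def divide_divide_eq_left)
    qed
    finally have "norm (g (of_real r * x)) \<le> circle_mean (\<lambda>y. norm (g (of_real R * y) * of_real (P x y)))"
      using cgR cP[OF x] by (simp add: norm_circle_mean_le continuous_intros)
    moreover have "0 \<le> P x y" for y using q by (simp add: P_def abs_square_le_1)
    ultimately show ?thesis by (simp add: norm_mult)
  qed
  have cgP: "continuous_on (sphere 0 1 \<times> sphere 0 1) (\<lambda>(x, y). norm (g (of_real R * y)) * P x y)"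
    unfolding case_prod_unfold P_def using nz
    by (intro continuous_intros continuous_on_compose2[OF cgR]) auto
  have "circle_mean (\<lambda>z. norm (g (of_real r * z)))
      \<le> circle_mean (\<lambda>x. circle_mean (\<lambda>y. norm (g (of_real R * y)) * P x y))"
    using bound cgr by (intro circle_mean_mono continuous_on_circle_mean cgP continuous_intros) auto
  also have "\<dots> = circle_mean (\<lambda>y. circle_mean (\<lambda>x. norm (g (of_real R * y)) * P x y))"
    by (rule circle_mean_swap[OF cgP])
  also have "\<dots> = circle_mean (\<lambda>y. norm (g (of_real R * y)))"
  proof (rule circle_mean_cong)
    fix y :: complex assume y: "norm y = 1"
    have "circle_mean (\<lambda>x. norm (g (of_real R * y)) * P x y) = norm (g (of_real R * y)) * circle_mean (P y)"
      by (subst Psym) (simp add: circle_mean_cmult)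
    then show "circle_mean (\<lambda>x. norm (g (of_real R * y)) * P x y) = norm (g (of_real R * y))"
      using Pmean[OF y] by simp
  qed
  finally show ?thesis .
qed

section \<open>The Littlewood-Paley identity\<close>

text \<open>The density in polar coordinates of the Green function of the disc with pole \<open>0\<close>, normalized such
  that its moment of order \<open>2 * k - 2\<close> on \<open>{0..1}\<close> is \<open>1 / k\<^sup>2\<close>.\<close>

definition LP_weight :: "real \<Rightarrow> real" where
  "LP_weight s = - 4 * s * ln s"

lemma LP_weight_nonneg: "0 \<le> s \<Longrightarrow> s \<le> 1 \<Longrightarrow> 0 \<le> LP_weight s"
  by (cases "s = 0") (auto simp: LP_weight_def mult_nonneg_nonpos)

lemma LP_weight_le:
  assumes "0 \<le> s" "s \<le> 1"
  shows "LP_weight s \<le> 4 * (1 - s)"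
proof (cases "s = 0")
  case False
  then have s: "0 < s" using assms by simp
  have "ln (1 / s) \<le> 1 / s - 1" using s by (intro ln_le_minus_one) simp
  then have "- ln s \<le> 1 / s - 1" using s by (simp add: ln_div)
  then have "s * - ln s \<le> s * (1 / s - 1)" using s by (intro mult_left_mono) auto
  then show ?thesis using s by (simp add: LP_weight_def right_diff_distrib)
qed (simp add: LP_weight_def)

lemma continuous_on_mult_ln: "continuous_on {0..1} (\<lambda>s::real. s * ln s)"
proof -
  have "((\<lambda>s::real. s * ln s) \<longlongrightarrow> 0) (at_right 0)" by real_asymp
  then have "((\<lambda>s::real. s * ln s) \<longlongrightarrow> 0) (at 0 within {0..1})"
    by (simp add: at_within_Icc_at_right)
  then have "continuous (at 0 within {0..1}) (\<lambda>s::real. s * ln s)"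
    by (simp add: continuous_within)
  moreover have "continuous (at s within {0..1}) (\<lambda>s::real. s * ln s)" if "s > 0" for s
    using that by (intro continuous_intros) auto
  ultimately show ?thesis
    unfolding continuous_on_eq_continuous_within
    by (metis atLeastAtMost_iff less_eq_real_def)
qed

lemma continuous_on_LP_weight: "continuous_on {0..1} LP_weight"
proof -
  have "continuous_on {0..1} (\<lambda>s::real. - 4 * (s * ln s))"
    by (intro continuous_intros continuous_on_mult_ln)
  then show ?thesis by (simp add: LP_weight_def[abs_def] mult.assoc)
qed

lemma continuous_on_polar:
  fixes F :: "complex \<Rightarrow> complex"
  assumes "continuous_on (ball 0 R) F" "1 < R" "S \<subseteq> {0..1}"
  shows "continuous_on (S \<times> sphere 0 1) (\<lambda>x. F (of_real (fst x) * snd x))"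
  by (rule continuous_on_compose2[OF assms(1)])
    (use assms in \<open>auto intro!: continuous_intros simp: norm_mult\<close>)

lemma continuous_on_circle_param:
  assumes "continuous_on (U \<times> sphere 0 1) (\<lambda>(s, z). f s z)"
  shows "continuous_on (U \<times> cbox 0 (2 * pi)) (\<lambda>(s, t). f s (cis t))"
  unfolding case_prod_unfold
  by (rule continuous_on_compose2[OF assms, of _ "\<lambda>p. (fst p, cis (snd p))",
        unfolded case_prod_unfold, simplified])
    (auto intro!: continuous_intros)

lemma continuous_on_deriv:
  assumes "F holomorphic_on ball 0 R"
  shows "continuous_on (ball 0 R) (deriv F)"
  using assms by (intro holomorphic_on_imp_continuous_on holomorphic_deriv) auto

lemma has_vector_derivative_holomorphic_comp:
  assumes "F holomorphic_on ball 0 R" "(g has_vector_derivative g') (at x)" "norm (g x) < R"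
  shows "((\<lambda>t. F (g t)) has_vector_derivative (g' * deriv F (g x))) (at x)"
proof -
  have "(F has_field_derivative deriv F (g x)) (at (g x))"
    using assms by (intro holomorphic_derivI[of F "ball 0 R"]) auto
  from field_vector_diff_chain_at[OF assms(2) this] show ?thesis by (simp add: o_def)
qed

text \<open>The angular derivative of \<open>F * cnj T\<close> has mean \<open>0\<close>, and for analytic functions the angular
  derivative is \<open>\<i>\<close> times the operator \<open>z d/dz\<close>; conjugation changes the sign of \<open>\<i>\<close>.\<close>

lemma circle_mean_radial_by_parts:
  assumes F: "F holomorphic_on ball 0 R" and T: "T holomorphic_on ball 0 R" and R: "1 < R"
    and s: "0 < s" "s < 1"
  shows "circle_mean (\<lambda>z. z * deriv F (of_real s * z) * cnj (T (of_real s * z)))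
       = circle_mean (\<lambda>z. F (of_real s * z) * cnj (z * deriv T (of_real s * z)))"
proof -
  let ?z = "\<lambda>t. complex_of_real s * cis t"
  define A where "A = (\<lambda>z. z * deriv F (of_real s * z) * cnj (T (of_real s * z)))"
  define B where "B = (\<lambda>z. F (of_real s * z) * cnj (z * deriv T (of_real s * z)))"
  have sub: "norm (of_real s * z) < R" if "norm z = 1" for z :: complex
    using that s R by (simp add: norm_mult)
  have d: "(?z has_vector_derivative \<i> * ?z t) (at t)" for t
    unfolding has_vector_derivative_def
    by (auto intro!: derivative_eq_intros simp: scaleR_conv_of_real)
  have "((\<lambda>t. F (?z t) * cnj (T (?z t))) has_vector_derivative
      (\<i> * of_real s * (A (cis t) - B (cis t)))) (at t within {0..2 * pi})" for t
  proof (rule has_vector_derivative_at_within)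
    have "((\<lambda>t. F (?z t) * cnj (T (?z t))) has_vector_derivative
        (F (?z t) * cnj (\<i> * ?z t * deriv T (?z t)) + (\<i> * ?z t * deriv F (?z t)) * cnj (T (?z t)))) (at t)"
      by (intro has_vector_derivative_mult has_vector_derivative_cnj
           has_vector_derivative_holomorphic_comp[OF F d] has_vector_derivative_holomorphic_comp[OF T d] sub) auto
    then show "((\<lambda>t. F (?z t) * cnj (T (?z t))) has_vector_derivative
        (\<i> * of_real s * (A (cis t) - B (cis t)))) (at t)"
      by (simp add: A_def B_def algebra_simps)
  qed
  then have "((\<lambda>t. \<i> * of_real s * (A (cis t) - B (cis t))) has_integral
      (F (?z (2 * pi)) * cnj (T (?z (2 * pi))) - F (?z 0) * cnj (T (?z 0)))) {0..2 * pi}"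
    by (intro fundamental_theorem_of_calculus) auto
  moreover have "F (?z (2 * pi)) * cnj (T (?z (2 * pi))) - F (?z 0) * cnj (T (?z 0)) = 0"
    by simp
  ultimately have "integral {0..2 * pi} (\<lambda>t. \<i> * of_real s * (A (cis t) - B (cis t))) = 0"
    by (metis integral_unique)
  then have "\<i> * of_real s * circle_mean (\<lambda>z. A z - B z) = 0"
    unfolding circle_mean_cmult[symmetric] by (simp add: circle_mean_def)
  moreover have "continuous_on (sphere 0 1) A" "continuous_on (sphere 0 1) B"
    unfolding A_def B_def
    by (intro continuous_intros continuous_on_compose2[OF continuous_on_deriv[OF F]]
        continuous_on_compose2[OF continuous_on_deriv[OF T]]
        continuous_on_compose2[OF holomorphic_on_imp_continuous_on[OF F]]
        continuous_on_compose2[OF holomorphic_on_imp_continuous_on[OF T]];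
        use sub in force)+
  ultimately show ?thesis
    using s by (simp add: circle_mean_diff A_def B_def)
qed

lemma circle_mean_radial_derivative:
  assumes F: "F holomorphic_on ball 0 R" and T: "T holomorphic_on ball 0 R" and R: "1 < R"
    and s: "0 < s" "s < 1"
  shows "((\<lambda>s. circle_mean (\<lambda>z. F (of_real s * z) * cnj (T (of_real s * z)))) has_vector_derivative
      2 * circle_mean (\<lambda>z. F (of_real s * z) * cnj (z * deriv T (of_real s * z)))) (at s)"
proof -
  let ?U = "{0<..<1::real}"
  let ?A = "\<lambda>s z. z * deriv F (of_real s * z) * cnj (T (of_real s * z))"
  let ?B = "\<lambda>s z. F (of_real s * z) * cnj (z * deriv T (of_real s * z))"
  have sub: "norm (of_real s * z) < R" if "norm z = 1" "s \<in> ?U" for z :: complex and s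
    using that R by (simp add: norm_mult)
  have cA: "continuous_on (?U \<times> sphere 0 1) (\<lambda>(s, z). ?A s z)"
    and cB: "continuous_on (?U \<times> sphere 0 1) (\<lambda>(s, z). ?B s z)"
    unfolding case_prod_unfold using R
    by (auto intro!: continuous_intros F T holomorphic_deriv
        continuous_on_polar[OF holomorphic_on_imp_continuous_on])
  have c: "continuous_on (?U \<times> cbox 0 (2 * pi)) (\<lambda>(s, t). ?B s (cis t) + ?A s (cis t))"
    using continuous_on_add[OF continuous_on_circle_param[OF cB] continuous_on_circle_param[OF cA]]
    by (simp add: case_prod_unfold)
  have "((\<lambda>s. integral (cbox 0 (2 * pi)) (\<lambda>t. F (of_real s * cis t) * cnj (T (of_real s * cis t))))
      has_vector_derivative integral (cbox 0 (2 * pi)) (\<lambda>t. ?B s (cis t) + ?A s (cis t))) (at s within ?U)"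
  proof (rule leibniz_rule_vector_derivative[OF _ _ c])
    fix x t assume x: "x \<in> ?U"
    have d: "((\<lambda>s. of_real s * cis t) has_vector_derivative cis t) (at x)"
      by (auto intro!: derivative_eq_intros)
    have "((\<lambda>x. F (of_real x * cis t) * cnj (T (of_real x * cis t))) has_vector_derivative
       (F (of_real x * cis t) * cnj (cis t * deriv T (of_real x * cis t))
        + cis t * deriv F (of_real x * cis t) * cnj (T (of_real x * cis t)))) (at x)"
      by (intro has_vector_derivative_mult has_vector_derivative_cnj
           has_vector_derivative_holomorphic_comp[OF F d] has_vector_derivative_holomorphic_comp[OF T d] sub x) auto
    then show "((\<lambda>x. F (of_real x * cis t) * cnj (T (of_real x * cis t))) has_vector_derivative
       (?B x (cis t) + ?A x (cis t))) (at x within ?U)"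
      by (rule has_vector_derivative_at_within)
  next
    fix x assume x: "x \<in> ?U"
    show "(\<lambda>t. F (of_real x * cis t) * cnj (T (of_real x * cis t))) integrable_on cbox 0 (2 * pi)"
      unfolding cbox_interval
      by (rule circle_path_integrable[where g = "\<lambda>z. F (of_real x * z) * cnj (T (of_real x * z))"],
        intro continuous_intros continuous_on_compose2[OF holomorphic_on_imp_continuous_on[OF F]]
          continuous_on_compose2[OF holomorphic_on_imp_continuous_on[OF T]]; use sub x in force)
  qed (use s in auto)
  then have "((\<lambda>s. circle_mean (\<lambda>z. F (of_real s * z) * cnj (T (of_real s * z)))) has_vector_derivative
      circle_mean (\<lambda>z. ?B s z + ?A s z)) (at s within ?U)"
    unfolding circle_mean_def cbox_interval scaleR_conv_of_real
    by (rule has_vector_derivative_mult_right)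
  moreover have "circle_mean (\<lambda>z. ?B s z + ?A s z) = circle_mean (?B s) + circle_mean (?A s)"
  proof (rule circle_mean_add)
    have i: "continuous_on (sphere 0 1) (\<lambda>z. (s, z))" "(\<lambda>z. (s, z)) ` sphere 0 1 \<subseteq> ?U \<times> sphere 0 1"
      using s by (auto intro!: continuous_intros)
    show "continuous_on (sphere 0 1) (?A s)" "continuous_on (sphere 0 1) (?B s)"
      using continuous_on_compose2[OF cA i] continuous_on_compose2[OF cB i] by simp_all
  qed
  ultimately have "((\<lambda>s. circle_mean (\<lambda>z. F (of_real s * z) * cnj (T (of_real s * z)))) has_vector_derivative
      2 * circle_mean (?B s)) (at s within ?U)"
    by (simp only: circle_mean_radial_by_parts[OF F T R s] mult_2)
  moreover have "at s within ?U = at s"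
    using s by (intro at_within_open) auto
  ultimately show ?thesis by (simp only:)
qed

text \<open>Let \<open>m s\<close> be the mean of \<open>F * cnj T\<close> at radius \<open>s\<close> and \<open>M s\<close> that of \<open>deriv F * cnj (deriv T)\<close>. The
  radial derivative can be put on either factor, so that \<open>(s m' s)' = 4 s M s\<close>, and
  \<open>m s - s ln s m' s\<close> is an antiderivative of the integrand. At \<open>s = 0\<close> it is continuous because
  \<open>s ln s\<close> is.\<close>

lemma circle_mean_Littlewood_Paley:
  assumes F: "F holomorphic_on ball 0 R" and T: "T holomorphic_on ball 0 R" and R: "1 < R"
  shows "((\<lambda>s. of_real (LP_weight s) * circle_mean (\<lambda>z. deriv F (of_real s * z) * cnj (deriv T (of_real s * z))))
      has_integral (circle_mean (\<lambda>z. F z * cnj (T z)) - F 0 * cnj (T 0))) {0..1}"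
proof -
  define m where "m = (\<lambda>s. circle_mean (\<lambda>z. F (of_real s * z) * cnj (T (of_real s * z))))"
  define k where "k = (\<lambda>s. 2 * circle_mean (\<lambda>z. F (of_real s * z) * cnj (z * deriv T (of_real s * z))))"
  define k' where "k' = (\<lambda>s. 2 * circle_mean (\<lambda>z. z * deriv F (of_real s * z) * cnj (T (of_real s * z))))"
  define M where "M = (\<lambda>s. circle_mean (\<lambda>z. deriv F (of_real s * z) * cnj (deriv T (of_real s * z))))"
  define F1 where "F1 = (\<lambda>z. z * deriv F z)"
  have F1: "F1 holomorphic_on ball 0 R"
    unfolding F1_def using F by (intro holomorphic_intros) auto
  have cm: "continuous_on {0..1} m" and ck: "continuous_on {0..1} k'"
    unfolding m_def k'_def using R
    by (intro continuous_intros continuous_on_circle_mean;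
        auto simp: case_prod_unfold intro!: continuous_intros F T holomorphic_deriv
        continuous_on_polar[OF holomorphic_on_imp_continuous_on])+
  have kk: "k s = k' s" if "0 < s" "s < 1" for s
    using circle_mean_radial_by_parts[OF F T R that] by (simp add: k_def k'_def)
  have dm: "(m has_vector_derivative k' s) (at s)" if "0 < s" "s < 1" for s
    using circle_mean_radial_derivative[OF F T R that] kk[OF that] by (simp add: k_def m_def)
  have sk: "of_real s * k' s = 2 * circle_mean (\<lambda>z. F1 (of_real s * z) * cnj (T (of_real s * z)))" for s
    by (simp add: k'_def F1_def circle_mean_cmult[symmetric] mult_ac)
  have dk: "((\<lambda>s. of_real s * k' s) has_vector_derivative 4 * of_real s * M s) (at s)" if "0 < s" "s < 1" for s
  proof -
    have "((\<lambda>s. 2 * circle_mean (\<lambda>z. F1 (of_real s * z) * cnj (T (of_real s * z)))) has_vector_derivative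
      2 * (2 * circle_mean (\<lambda>z. F1 (of_real s * z) * cnj (z * deriv T (of_real s * z))))) (at s)"
      by (intro has_vector_derivative_mult_right circle_mean_radial_derivative[OF F1 T R that])
    also have "circle_mean (\<lambda>z. F1 (of_real s * z) * cnj (z * deriv T (of_real s * z)))
        = circle_mean (\<lambda>z. of_real s * (deriv F (of_real s * z) * cnj (deriv T (of_real s * z))))"
    proof (rule circle_mean_cong)
      fix z :: complex assume "norm z = 1"
      then have "z * cnj z = 1" by (simp add: complex_norm_square[symmetric])
      then show "F1 (of_real s * z) * cnj (z * deriv T (of_real s * z))
          = of_real s * (deriv F (of_real s * z) * cnj (deriv T (of_real s * z)))"
        by (simp add: F1_def algebra_simps)
    qed
    finally show ?thesis by (simp add: sk circle_mean_cmult M_def mult.assoc)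
  qed
  define A where "A = (\<lambda>s. - of_real (s * ln s) * k' s + m s)"
  have "((\<lambda>s. of_real (LP_weight s) * M s) has_integral (A 1 - A 0)) {0..1}"
  proof (rule fundamental_theorem_of_calculus_interior)
    show "continuous_on {0..1} A"
      unfolding A_def by (intro continuous_intros cm ck continuous_on_mult_ln)
    fix s :: real assume "s \<in> {0<..<1}"
    then have s: "0 < s" "s < 1" by auto
    have ln: "((\<lambda>s. complex_of_real (ln s)) has_vector_derivative of_real (1 / s)) (at s)"
      using s by (intro has_vector_derivative_of_real) (auto intro!: derivative_eq_intros
          simp: has_real_derivative_iff_has_vector_derivative[symmetric])
    have "((\<lambda>s. - (of_real (ln s) * (of_real s * k' s)) + m s) has_vector_derivative
        (- (of_real (ln s) * (4 * of_real s * M s) + of_real (1 / s) * (of_real s * k' s)) + k' s)) (at s)"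
      by (intro has_vector_derivative_add has_vector_derivative_minus has_vector_derivative_mult ln dk dm s)
    then show "(A has_vector_derivative of_real (LP_weight s) * M s) (at s)"
      using s by (simp add: A_def[abs_def] LP_weight_def algebra_simps)
  qed simp
  moreover have "A 1 = circle_mean (\<lambda>z. F z * cnj (T z))" "A 0 = F 0 * cnj (T 0)"
    by (simp_all add: A_def m_def)
  ultimately show ?thesis by (simp add: M_def)
qed

lemma circle_mean_norm_square:
  assumes "continuous_on (sphere 0 1) g"
  shows "circle_mean (\<lambda>z. g z * cnj (g z)) = of_real (circle_mean (\<lambda>z. (norm (g z))\<^sup>2))"
proof -
  have "circle_mean (\<lambda>z. g z * cnj (g z)) = circle_mean (\<lambda>z. complex_of_real ((norm (g z))\<^sup>2))"
    by (rule circle_mean_cong) (rule complex_norm_square[symmetric])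
  also have "\<dots> = of_real (circle_mean (\<lambda>z. (norm (g z))\<^sup>2))"
    by (rule circle_mean_of_real) (intro continuous_intros assms)
  finally show ?thesis .
qed

lemma norm_circle_mean_pairing_le:
  assumes F: "F holomorphic_on ball 0 R" and T: "T holomorphic_on ball 0 R" and R: "1 < R"
  defines "G \<equiv> \<lambda>s. LP_weight s * circle_mean (\<lambda>z. norm (deriv F (of_real s * z)) * norm (deriv T (of_real s * z)))"
  shows "continuous_on {0..1} G"
    and "norm (circle_mean (\<lambda>z. F z * cnj (T z)) - F 0 * cnj (T 0)) \<le> integral {0..1} G"
proof -
  show cG: "continuous_on {0..1} G"
    unfolding G_def using R
    by (intro continuous_intros continuous_on_LP_weight continuous_on_circle_mean)
      (auto simp: case_prod_unfold intro!: continuous_intros F T holomorphic_deriv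
        continuous_on_polar[OF holomorphic_on_imp_continuous_on])
  let ?g = "\<lambda>s. of_real (LP_weight s) * circle_mean (\<lambda>z. deriv F (of_real s * z) * cnj (deriv T (of_real s * z)))"
  have I: "(?g has_integral (circle_mean (\<lambda>z. F z * cnj (T z)) - F 0 * cnj (T 0))) {0..1}"
    by (rule circle_mean_Littlewood_Paley[OF F T R])
  have "norm (integral {0..1} ?g) \<le> integral {0..1} G"
  proof (rule integral_norm_bound_integral)
    show "?g integrable_on {0..1}" using I by (rule has_integral_integrable)
    show "G integrable_on {0..1}" by (rule integrable_continuous_real[OF cG])
    fix s :: real assume s: "s \<in> {0..1}"
    have "norm (circle_mean (\<lambda>z. deriv F (of_real s * z) * cnj (deriv T (of_real s * z))))
        \<le> circle_mean (\<lambda>z. norm (deriv F (of_real s * z) * cnj (deriv T (of_real s * z))))"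
      using s R by (intro norm_circle_mean_le continuous_intros
          continuous_on_dilated_circle[OF continuous_on_deriv[OF F]]
          continuous_on_dilated_circle[OF continuous_on_deriv[OF T]]) auto
    then show "norm (?g s) \<le> G s"
      using s LP_weight_nonneg[of s] by (simp add: G_def norm_mult mult_left_mono)
  qed
  then show "norm (circle_mean (\<lambda>z. F z * cnj (T z)) - F 0 * cnj (T 0)) \<le> integral {0..1} G"
    using integral_unique[OF I] by simp
qed

lemma circle_mean_Littlewood_Paley_square:
  assumes F: "F holomorphic_on ball 0 R" and R: "1 < R"
  shows "((\<lambda>s. LP_weight s * circle_mean (\<lambda>z. (norm (deriv F (of_real s * z)))\<^sup>2))
      has_integral (circle_mean (\<lambda>z. (norm (F z))\<^sup>2) - (norm (F 0))\<^sup>2)) {0..1}"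
proof -
  have cF: "continuous_on (sphere 0 1) F"
    by (rule continuous_on_subset[OF holomorphic_on_imp_continuous_on[OF F]]) (use R in auto)
  have cd: "continuous_on (sphere 0 1) (\<lambda>z. deriv F (of_real s * z))" if "s \<in> {0..1}" for s
    by (rule continuous_on_dilated_circle[OF continuous_on_deriv[OF F]]) (use R that in auto)
  have "((\<lambda>s. of_real (LP_weight s) * circle_mean (\<lambda>z. deriv F (of_real s * z) * cnj (deriv F (of_real s * z))))
      has_integral complex_of_real (circle_mean (\<lambda>z. (norm (F z))\<^sup>2) - (norm (F 0))\<^sup>2)) {0..1}"
    using circle_mean_Littlewood_Paley[OF F F R]
    by (simp only: of_real_diff circle_mean_norm_square[OF cF, symmetric] complex_norm_square)
  then have "((\<lambda>s. complex_of_real (LP_weight s * circle_mean (\<lambda>z. (norm (deriv F (of_real s * z)))\<^sup>2)))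
      has_integral complex_of_real (circle_mean (\<lambda>z. (norm (F z))\<^sup>2) - (norm (F 0))\<^sup>2)) {0..1}"
    by (rule has_integral_eq[rotated]) (simp add: circle_mean_norm_square[OF cd])
  from has_integral_Re[OF this] show ?thesis by (simp only: Re_complex_of_real)
qed

section \<open>Cauchy transforms of continuous functions\<close>

text \<open>The analytic projection: it maps \<open>u\<close> to the power series of its Fourier coefficients of
  nonnegative index.\<close>

definition cauchy_transform :: "(complex \<Rightarrow> complex) \<Rightarrow> complex \<Rightarrow> complex" where
  "cauchy_transform u z = circle_mean (\<lambda>w. u w / (1 - z * cnj w))"

definition cauchy_transform_deriv :: "(complex \<Rightarrow> complex) \<Rightarrow> complex \<Rightarrow> complex" where
  "cauchy_transform_deriv u z = circle_mean (\<lambda>w. u w * cnj w / (1 - z * cnj w)\<^sup>2)"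

lemma cauchy_transform_has_derivative:
  assumes u: "continuous_on (sphere 0 1) u" and z: "norm z < 1"
  shows "(cauchy_transform u has_field_derivative cauchy_transform_deriv u z) (at z)"
proof -
  let ?U = "ball (0::complex) 1"
  have "((\<lambda>z. integral (cbox 0 (2 * pi)) (\<lambda>t. u (cis t) / (1 - z * cnj (cis t)))) has_field_derivative
      integral (cbox 0 (2 * pi)) (\<lambda>t. u (cis t) * cnj (cis t) / (1 - z * cnj (cis t))\<^sup>2)) (at z within ?U)"
  proof (rule leibniz_rule_field_derivative)
    fix x :: complex and t :: real assume "x \<in> ?U"
    then have "1 - x * cnj (cis t) \<noteq> 0" by (intro one_minus_cnj_nonzero) auto
    then show "((\<lambda>x. u (cis t) / (1 - x * cnj (cis t))) has_field_derivative
        u (cis t) * cnj (cis t) / (1 - x * cnj (cis t))\<^sup>2) (at x within ?U)"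
      by (auto intro!: derivative_eq_intros simp: power2_eq_square)
  next
    fix x assume "x \<in> ?U"
    then have "continuous_on (sphere 0 1) (\<lambda>w. u w / (1 - x * cnj w))"
      using one_minus_cnj_nonzero by (intro continuous_intros u) auto
    from circle_path_integrable[OF this]
    show "(\<lambda>t. u (cis t) / (1 - x * cnj (cis t))) integrable_on cbox 0 (2 * pi)" by simp
  next
    have "continuous_on (?U \<times> sphere 0 1) (\<lambda>(x, w). u w * cnj w / (1 - x * cnj w)\<^sup>2)"
      unfolding case_prod_unfold using one_minus_cnj_nonzero
      by (intro continuous_intros continuous_on_compose2[OF u]) auto
    from continuous_on_circle_param[OF this]
    show "continuous_on (?U \<times> cbox 0 (2 * pi)) (\<lambda>(x, t). u (cis t) * cnj (cis t) / (1 - x * cnj (cis t))\<^sup>2)" .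
  qed (use z in auto)
  then have "((\<lambda>z. circle_mean (\<lambda>w. u w / (1 - z * cnj w))) has_field_derivative
      cauchy_transform_deriv u z) (at z within ?U)"
    unfolding circle_mean_def cauchy_transform_deriv_def cbox_interval scaleR_conv_of_real
    by (rule DERIV_cmult)
  then show ?thesis
    using z by (simp add: cauchy_transform_def[abs_def] at_within_open[of z ?U])
qed

lemma cauchy_transform_holomorphic:
  assumes "continuous_on (sphere 0 1) u"
  shows "cauchy_transform u holomorphic_on ball 0 1"
  using cauchy_transform_has_derivative[OF assms]
  by (subst holomorphic_on_open) (simp, metis mem_ball_0)

lemma deriv_cauchy_transform:
  assumes "continuous_on (sphere 0 1) u" "norm z < 1"
  shows "deriv (cauchy_transform u) z = cauchy_transform_deriv u z"
  using cauchy_transform_has_derivative[OF assms] by (rule DERIV_imp_deriv)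

lemma cauchy_transform_0 [simp]: "cauchy_transform u 0 = circle_mean u"
  by (simp add: cauchy_transform_def)



lemma holomorphic_dilation:
  assumes "f holomorphic_on ball 0 1" "0 < r"
  shows "(\<lambda>z. f (of_real r * z)) holomorphic_on ball 0 (1 / r)"
  by (rule holomorphic_on_compose_gen[OF _ assms(1), unfolded o_def])
    (use assms in \<open>auto intro!: holomorphic_intros simp: norm_mult field_simps\<close>)

lemma deriv_dilation:
  assumes "f holomorphic_on ball 0 1" "0 < r" "norm z < 1 / r"
  shows "deriv (\<lambda>z. f (of_real r * z)) z = of_real r * deriv f (of_real r * z)"
proof -
  have "(f has_field_derivative deriv f (of_real r * z)) (at (of_real r * z))"
    using assms by (intro holomorphic_derivI[of f "ball 0 1"]) (auto simp: norm_mult field_simps)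
  moreover have "((\<lambda>z. of_real r * z) has_field_derivative of_real r) (at z)"
    by (auto intro!: derivative_eq_intros)
  ultimately have "((\<lambda>z. f (of_real r * z)) has_field_derivative deriv f (of_real r * z) * of_real r) (at z)"
    by (rule DERIV_chain2)
  then show ?thesis by (simp add: DERIV_imp_deriv mult.commute)
qed

text \<open>The analytic projection is selfadjoint, fixes analytic functions and commutes with dilations;
  concretely, exchange the two means and apply the Cauchy formula to the inner one.\<close>

lemma circle_mean_cauchy_transform:
  assumes f: "f holomorphic_on ball 0 R" "1 < R" and u: "continuous_on (sphere 0 1) u"
    and r: "0 \<le> r" "r < 1"
  shows "circle_mean (\<lambda>z. f z * cnj (cauchy_transform u (of_real r * z)))
       = circle_mean (\<lambda>w. f (of_real r * w) * cnj (u w))"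
proof -
  let ?K = "\<lambda>z w. f z / (1 - of_real r * w * cnj z) * cnj (u w)"
  have cf: "continuous_on (sphere 0 1) f"
    by (rule continuous_on_subset[OF holomorphic_on_imp_continuous_on[OF f(1)]]) (use f in auto)
  have nz: "1 - of_real r * w * cnj z \<noteq> 0" if "norm w = 1" "norm z = 1" for w z :: complex
    using one_minus_cnj_nonzero[of "of_real r * w" z] that r by (simp add: norm_mult)
  have c: "continuous_on (sphere 0 1 \<times> sphere 0 1) (\<lambda>(z, w). ?K z w)"
    unfolding case_prod_unfold using nz
    by (intro continuous_intros continuous_on_compose2[OF cf] continuous_on_compose2[OF u]) auto
  have "circle_mean (\<lambda>z. f z * cnj (cauchy_transform u (of_real r * z))) = circle_mean (\<lambda>z. circle_mean (?K z))"
    unfolding cauchy_transform_def circle_mean_cnj[symmetric] circle_mean_cmult[symmetric]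
    by (intro circle_mean_cong) (simp add: mult_ac)
  also have "\<dots> = circle_mean (\<lambda>w. circle_mean (\<lambda>z. ?K z w))"
    by (rule circle_mean_swap[OF c])
  also have "\<dots> = circle_mean (\<lambda>w. f (of_real r * w) * cnj (u w))"
    unfolding circle_mean_cmult_right
    using r by (intro circle_mean_cong) (simp add: circle_mean_Cauchy[OF f] norm_mult)
  finally show ?thesis .
qed

text \<open>The projection of a bounded function is a Bloch function: the modulus of the kernel is the one
  of \<open>circle_mean_Poisson\<close>.\<close>

lemma norm_cauchy_transform_deriv_le:
  assumes u: "continuous_on (sphere 0 1) u" "\<And>z. norm z = 1 \<Longrightarrow> norm (u z) \<le> U" and z: "norm z < 1"
  shows "(1 - norm z) * norm (cauchy_transform_deriv u z) \<le> U"
proof -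
  have U: "0 \<le> U" using order_trans[OF norm_ge_zero u(2)[of 1]] by simp
  have nz: "1 - z * cnj w \<noteq> 0" if "norm w = 1" for w
    using one_minus_cnj_nonzero[OF z] that by simp
  have "norm (cauchy_transform_deriv u z)
      \<le> circle_mean (\<lambda>w. norm (u w * cnj w / (1 - z * cnj w)\<^sup>2))"
    unfolding cauchy_transform_deriv_def
    using nz by (intro norm_circle_mean_le continuous_intros u) auto
  also have "\<dots> \<le> circle_mean (\<lambda>w. U * (1 / (norm (1 - z * cnj w))\<^sup>2))"
    using nz u by (intro circle_mean_mono continuous_intros) (auto simp: norm_divide norm_mult norm_power divide_right_mono)
  also have "\<dots> = U * (1 / (1 - (norm z)\<^sup>2))"
    by (simp only: circle_mean_cmult circle_mean_Poisson[OF z])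
  finally have "(1 - norm z) * norm (cauchy_transform_deriv u z) \<le> (1 - norm z) * (U * (1 / (1 - (norm z)\<^sup>2)))"
    using z by (intro mult_left_mono) auto
  also have "\<dots> = U / (1 + norm z)"
  proof -
    have "1 - (norm z)\<^sup>2 = (1 - norm z) * (1 + norm z)" by (simp add: power2_eq_square algebra_simps)
    then show ?thesis using z by simp
  qed
  also have "\<dots> \<le> U" using U by (simp add: pos_divide_le_eq add_pos_nonneg distrib_left)
  finally show ?thesis .
qed

lemma norm_cauchy_transform_le:
  assumes u: "continuous_on (sphere 0 1) u" "\<And>z. norm z = 1 \<Longrightarrow> norm (u z) \<le> U"
    and z: "norm z \<le> r" "r < 1"
  shows "norm (cauchy_transform u z) \<le> U / (1 - r)"
  unfolding cauchy_transform_def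
proof (rule norm_circle_mean_bound)
  have z1: "norm z < 1" using z by simp
  show "continuous_on (sphere 0 1) (\<lambda>w. u w / (1 - z * cnj w))"
    using one_minus_cnj_nonzero[OF z1] by (intro continuous_intros u) auto
  fix w :: complex assume w: "norm w = 1"
  have "1 - r \<le> 1 - norm (z * cnj w)" using z w by (simp add: norm_mult)
  also have "\<dots> \<le> norm (1 - z * cnj w)" using norm_triangle_ineq2[of 1 "z * cnj w"] by simp
  finally show "norm (u w / (1 - z * cnj w)) \<le> U / (1 - r)"
    using u(2)[OF w] z order_trans[OF norm_ge_zero u(2)[OF w]] by (auto simp: norm_divide intro!: frac_le)
qed

text \<open>With \<open>a r\<close> the mean in question, selfadjointness gives that \<open>a r\<close> is the pairing of \<open>u\<close> with the
  projection at radius \<open>r\<^sup>2\<close>, hence \<open>a r \<le> (a (r\<^sup>2) + U\<^sup>2) / 2\<close>. As \<open>a\<close> is bounded on \<open>{0..r0}\<close>, its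
  supremum \<open>S\<close> there satisfies \<open>S \<le> (S + U\<^sup>2) / 2\<close>.\<close>

lemma cauchy_transform_Bessel:
  assumes u: "continuous_on (sphere 0 1) u" "\<And>z. norm z = 1 \<Longrightarrow> norm (u z) \<le> U"
    and r0: "0 \<le> r0" "r0 < 1"
  shows "circle_mean (\<lambda>z. (norm (cauchy_transform u (of_real r0 * z)))\<^sup>2) \<le> U\<^sup>2"
proof -
  let ?h = "cauchy_transform u"
  define a where "a = (\<lambda>r. circle_mean (\<lambda>z. (norm (?h (of_real r * z)))\<^sup>2))"
  have ch: "continuous_on (sphere 0 1) (\<lambda>z. ?h (of_real r * z))" if "0 \<le> r" "r < 1" for r
    by (rule continuous_on_dilated_circle[OF holomorphic_on_imp_continuous_on[OF cauchy_transform_holomorphic[OF u(1)]]]) (use that in auto)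
  have step: "a r \<le> (a (r\<^sup>2) + U\<^sup>2) / 2" if r: "0 \<le> r" "r < 1" for r
  proof (cases "r = 0")
    case True
    have "norm (circle_mean u) \<le> U" by (rule norm_circle_mean_bound[OF u])
    then have "(norm (circle_mean u))\<^sup>2 \<le> U\<^sup>2" by (intro power_mono) auto
    then show ?thesis using True by (simp add: a_def)
  next
    case False
    then have r: "0 < r" "r < 1" "r\<^sup>2 < 1" using that by (auto simp: power_less_one_iff)
    have "of_real (a r) = circle_mean (\<lambda>z. complex_of_real ((norm (?h (of_real r * z)))\<^sup>2))"
      unfolding a_def using ch r by (subst circle_mean_of_real) (auto intro!: continuous_intros)
    also have "\<dots> = circle_mean (\<lambda>z. ?h (of_real r * z) * cnj (?h (of_real r * z)))"
      by (intro circle_mean_cong complex_norm_square)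
    also have "\<dots> = circle_mean (\<lambda>w. ?h (of_real r * (of_real r * w)) * cnj (u w))"
      by (rule circle_mean_cauchy_transform[OF holomorphic_dilation[OF cauchy_transform_holomorphic]])
        (use u r in auto)
    finally have "complex_of_real (a r) = circle_mean (\<lambda>w. ?h (of_real (r\<^sup>2) * w) * cnj (u w))"
      by (simp only: of_real_power of_real_mult power2_eq_square mult.assoc)
    then have "a r \<le> norm (circle_mean (\<lambda>w. ?h (of_real (r\<^sup>2) * w) * cnj (u w)))"
      by (metis abs_ge_self norm_of_real)
    also have "\<dots> \<le> circle_mean (\<lambda>w. norm (?h (of_real (r\<^sup>2) * w) * cnj (u w)))"
      using r by (intro norm_circle_mean_le continuous_intros ch u) auto
    also have "\<dots> \<le> circle_mean (\<lambda>w. (1 / 2) * ((norm (?h (of_real (r\<^sup>2) * w)))\<^sup>2 + U\<^sup>2))"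
    proof (rule circle_mean_mono)
      fix w :: complex assume w: "norm w = 1"
      let ?x = "norm (?h (of_real (r\<^sup>2) * w))"
      have "0 \<le> (?x - norm (u w))\<^sup>2" by simp
      then have "2 * (?x * norm (u w)) \<le> ?x\<^sup>2 + (norm (u w))\<^sup>2" by (simp add: power2_diff)
      also have "\<dots> \<le> ?x\<^sup>2 + U\<^sup>2" using u(2)[OF w] by (intro add_left_mono power_mono) auto
      finally show "norm (?h (of_real (r\<^sup>2) * w) * cnj (u w)) \<le> (1 / 2) * (?x\<^sup>2 + U\<^sup>2)"
        by (simp add: norm_mult)
    qed (use r in \<open>intro continuous_intros ch u; simp\<close>)+
    also have "\<dots> = (1 / 2) * (a (r\<^sup>2) + U\<^sup>2)"
      unfolding a_def circle_mean_cmult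
      using ch[of "r\<^sup>2"] r by (subst circle_mean_add) (auto intro!: continuous_intros simp del: of_real_power)
    finally show ?thesis by simp
  qed
  define S where "S = Sup (a ` {0..r0})"
  have bdd: "bdd_above (a ` {0..r0})"
  proof (rule bdd_aboveI2)
    fix r assume "r \<in> {0..r0}"
    then have r: "0 \<le> r" "r \<le> r0" "r < 1" using r0 by auto
    have "a r \<le> circle_mean (\<lambda>_. (U / (1 - r0))\<^sup>2)"
      unfolding a_def using r r0
      by (intro circle_mean_mono continuous_intros ch power_mono norm_cauchy_transform_le[OF u])
        (auto simp: norm_mult)
    then show "a r \<le> (U / (1 - r0))\<^sup>2" by simp
  qed
  have le: "a r \<le> S" if "r \<in> {0..r0}" for r
    unfolding S_def using bdd that by (intro cSup_upper) auto
  have "S \<le> (S + U\<^sup>2) / 2"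
    unfolding S_def
  proof (rule cSup_least)
    fix y assume "y \<in> a ` {0..r0}"
    then obtain r where r: "r \<in> {0..r0}" "y = a r" by auto
    have "r\<^sup>2 \<le> r" using r r0 by (simp add: power2_eq_square mult_left_le)
    then have "r\<^sup>2 \<in> {0..r0}" using r by auto
    then have "a (r\<^sup>2) \<le> S" by (rule le)
    then show "y \<le> (Sup (a ` {0..r0}) + U\<^sup>2) / 2"
      using step[of r] r r0 by (simp add: S_def)
  qed (use r0 in auto)
  then have "S \<le> U\<^sup>2" by simp
  then show ?thesis using le[of r0] r0 by (simp add: a_def)
qed

text \<open>For a bounded analytic \<open>G\<close> the measure \<open>\<bar>G'\<bar>\<^sup>2 (1 - \<bar>z\<bar>) dA\<close> is a Carleson measure: write
  \<open>k G' = (k G)' - k' G\<close> and apply the Littlewood-Paley identity to \<open>k G\<close> and to \<open>k\<close>.\<close>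

lemma weighted_square_bound:
  assumes k: "k holomorphic_on ball 0 R" "1 < R"
    and G: "G holomorphic_on ball 0 R" and C: "\<And>z. norm z \<le> 1 \<Longrightarrow> norm (G z) \<le> C"
  shows "integral {0..1} (\<lambda>s. LP_weight s * circle_mean (\<lambda>z. (norm (k (of_real s * z) * deriv G (of_real s * z)))\<^sup>2))
     \<le> 4 * C\<^sup>2 * circle_mean (\<lambda>z. (norm (k z))\<^sup>2)"
proof -
  let ?d = "\<lambda>F s. circle_mean (\<lambda>z. (norm (F (of_real s * z :: complex) :: complex))\<^sup>2)"

  define P where "P = (\<lambda>z. k z * G z)"
  have P: "P holomorphic_on ball 0 R" unfolding P_def by (intro holomorphic_intros k G)
  have dP: "deriv P z = k z * deriv G z + deriv k z * G z" if "norm z < R" for z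
    unfolding P_def using that k G
    by (intro deriv_mult holomorphic_on_imp_differentiable_at[of _ "ball 0 R"]) auto
  have cont: "continuous_on {0..1} (?d F)" if "F holomorphic_on ball 0 R" for F
    by (intro continuous_on_circle_mean) (use that k in \<open>auto simp: case_prod_unfold intro!: continuous_intros
      continuous_on_polar[OF holomorphic_on_imp_continuous_on]\<close>)
  have conts: "continuous_on (sphere 0 1) (\<lambda>z. F (of_real s * z))" if "F holomorphic_on ball 0 R" "s \<in> {0..1}" for F :: "complex \<Rightarrow> complex" and s
    by (rule continuous_on_dilated_circle[OF holomorphic_on_imp_continuous_on[OF that(1)]]) (use that k in auto)
  have hd: "deriv F holomorphic_on ball 0 R" if "F holomorphic_on ball 0 R" for F
    using that by (intro holomorphic_deriv) auto
  have kd: "(\<lambda>z. k z * deriv G z) holomorphic_on ball 0 R"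
    by (intro holomorphic_intros k hd G)
  have LP: "((\<lambda>s. LP_weight s * ?d (deriv F) s) has_integral (circle_mean (\<lambda>z. (norm (F z))\<^sup>2) - (norm (F 0))\<^sup>2)) {0..1}"
    if "F holomorphic_on ball 0 R" for F
    by (rule circle_mean_Littlewood_Paley_square[OF that k(2)])
  have "integral {0..1} (\<lambda>s. LP_weight s * ?d (\<lambda>z. k z * deriv G z) s)
      \<le> 2 * (circle_mean (\<lambda>z. (norm (P z))\<^sup>2) - (norm (P 0))\<^sup>2)
        + 2 * C\<^sup>2 * (circle_mean (\<lambda>z. (norm (k z))\<^sup>2) - (norm (k 0))\<^sup>2)"
  proof (rule has_integral_le)
    show "((\<lambda>s. LP_weight s * ?d (\<lambda>z. k z * deriv G z) s) has_integral
        integral {0..1} (\<lambda>s. LP_weight s * ?d (\<lambda>z. k z * deriv G z) s)) {0..1}"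
      by (intro integrable_integral integrable_continuous_real continuous_intros continuous_on_LP_weight cont kd)
    show "((\<lambda>s. 2 * (LP_weight s * ?d (deriv P) s) + 2 * C\<^sup>2 * (LP_weight s * ?d (deriv k) s)) has_integral
        2 * (circle_mean (\<lambda>z. (norm (P z))\<^sup>2) - (norm (P 0))\<^sup>2)
        + 2 * C\<^sup>2 * (circle_mean (\<lambda>z. (norm (k z))\<^sup>2) - (norm (k 0))\<^sup>2)) {0..1}"
      by (intro has_integral_add has_integral_mult_right LP P k)
    fix s :: real assume s: "s \<in> {0..1}"
    have "?d (\<lambda>z. k z * deriv G z) s \<le> circle_mean (\<lambda>z. 2 * (norm (deriv P (of_real s * z)))\<^sup>2
        + 2 * C\<^sup>2 * (norm (deriv k (of_real s * z)))\<^sup>2)"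
    proof (rule circle_mean_mono)
      fix z :: complex assume z: "norm z = 1"
      let ?z = "of_real s * z"
      have nz: "norm ?z \<le> 1" "norm ?z < R" using z s k by (auto simp: norm_mult)
      have "k ?z * deriv G ?z = deriv P ?z - deriv k ?z * G ?z" using dP[OF nz(2)] by simp
      then have "norm (k ?z * deriv G ?z) \<le> norm (deriv P ?z) + norm (deriv k ?z) * norm (G ?z)"
        by (metis norm_triangle_ineq4 norm_mult)
      also have "\<dots> \<le> norm (deriv P ?z) + C * norm (deriv k ?z)"
        using mult_right_mono[OF C[OF nz(1)], of "norm (deriv k ?z)"] by (simp add: mult.commute)
      finally have "(norm (k ?z * deriv G ?z))\<^sup>2 \<le> (norm (deriv P ?z) + C * norm (deriv k ?z))\<^sup>2"
        by (intro power_mono) auto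
      also have "\<dots> \<le> 2 * (norm (deriv P ?z))\<^sup>2 + 2 * (C * norm (deriv k ?z))\<^sup>2"
        using sum_squares_bound[of "norm (deriv P ?z)" "C * norm (deriv k ?z)"] by (simp add: power2_sum)
      finally show "(norm (k ?z * deriv G ?z))\<^sup>2 \<le> 2 * (norm (deriv P ?z))\<^sup>2 + 2 * C\<^sup>2 * (norm (deriv k ?z))\<^sup>2"
        by (simp add: power_mult_distrib mult.assoc)
    qed (use s in \<open>intro continuous_intros conts hd k P G; simp\<close>)+
    also have "\<dots> = 2 * ?d (deriv P) s + 2 * C\<^sup>2 * ?d (deriv k) s"
      using s by (subst circle_mean_add) (auto intro!: continuous_intros conts hd k P simp: circle_mean_cmult)
    finally have "LP_weight s * ?d (\<lambda>z. k z * deriv G z) s \<le> LP_weight s * (2 * ?d (deriv P) s + 2 * C\<^sup>2 * ?d (deriv k) s)"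
      using s by (intro mult_left_mono LP_weight_nonneg) auto
    then show "LP_weight s * ?d (\<lambda>z. k z * deriv G z) s
        \<le> 2 * (LP_weight s * ?d (deriv P) s) + 2 * C\<^sup>2 * (LP_weight s * ?d (deriv k) s)"
      by (simp add: algebra_simps)
  qed
  also have "\<dots> \<le> 2 * circle_mean (\<lambda>z. (norm (P z))\<^sup>2) + 2 * C\<^sup>2 * circle_mean (\<lambda>z. (norm (k z))\<^sup>2)"
    by (intro add_mono mult_left_mono) auto
  also have "circle_mean (\<lambda>z. (norm (P z))\<^sup>2) \<le> circle_mean (\<lambda>z. C\<^sup>2 * (norm (k z))\<^sup>2)"
  proof (rule circle_mean_mono)
    show "continuous_on (sphere 0 1) (\<lambda>z. (norm (P z))\<^sup>2)" "continuous_on (sphere 0 1) (\<lambda>z. C\<^sup>2 * (norm (k z))\<^sup>2)"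
      using conts[OF P, of 1] conts[OF k(1), of 1] by (auto intro!: continuous_intros)
    fix z :: complex assume "norm z = 1"
    then have "norm (P z) \<le> C * norm (k z)" using C[of z] by (simp add: P_def norm_mult mult.commute mult_right_mono)
    then have "(norm (P z))\<^sup>2 \<le> (C * norm (k z))\<^sup>2" by (intro power_mono) auto
    then show "(norm (P z))\<^sup>2 \<le> C\<^sup>2 * (norm (k z))\<^sup>2" by (simp add: power_mult_distrib)
  qed
  finally show ?thesis by (simp add: circle_mean_cmult)
qed

section \<open>The pairing of a Besov function with a continuous function\<close>

text \<open>For \<open>a \<le> \<kappa> c\<close> the first term suffices. Otherwise \<open>a\<^bsup>1-p\<^esup> \<le> (\<kappa> c)\<^bsup>1-p\<^esup>\<close>, which leaves the factor
  \<open>c\<^bsup>2-p\<^esup> \<le> \<beta>\<^bsup>2-p\<^esup>\<close>. This is where \<open>p < 2\<close> makes a small \<open>\<beta>\<close> useful.\<close>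

lemma Young_type_inequality:
  fixes a c \<beta> \<kappa> p :: real
  assumes a: "0 \<le> a" and c: "0 \<le> c" "c \<le> \<beta>" and \<kappa>: "0 < \<kappa>" and p: "1 \<le> p" "p < 2"
  shows "a * c \<le> \<kappa> * c\<^sup>2 + \<kappa> powr (1 - p) * \<beta> powr (2 - p) * a powr p"
proof (cases "a \<le> \<kappa> * c")
  case True
  then have "a * c \<le> \<kappa> * c * c" using c by (intro mult_right_mono)
  moreover have "0 \<le> \<kappa> powr (1 - p) * \<beta> powr (2 - p) * a powr p" by simp
  ultimately show ?thesis unfolding power2_eq_square mult.assoc[of \<kappa>] by linarith
next
  case False
  show ?thesis
  proof (cases "c = 0")
    case True
    then show ?thesis by simp
  next
    case False
    with c have c0: "0 < c" by simp
    have ka: "0 < \<kappa> * c" "\<kappa> * c < a" using c0 \<kappa> \<open>\<not> a \<le> \<kappa> * c\<close> by auto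
    then have a0: "0 < a" by linarith
    have "a = a powr p * a powr (1 - p)" using a0 by (simp add: powr_add[symmetric])
    also have "\<dots> \<le> a powr p * (\<kappa> * c) powr (1 - p)"
      using ka p by (intro mult_left_mono powr_mono2') auto
    finally have "a * c \<le> a powr p * (\<kappa> * c) powr (1 - p) * c"
      using c0 by (intro mult_right_mono) auto
    also have "\<dots> = \<kappa> powr (1 - p) * c powr (2 - p) * a powr p"
    proof -
      have "c powr (1 - p) * c = c powr (2 - p)"
        using c0 powr_add[of c "1 - p" 1] by simp
      then show ?thesis using \<kappa> c0 by (simp add: powr_mult mult_ac)
    qed
    also have "\<dots> \<le> \<kappa> powr (1 - p) * \<beta> powr (2 - p) * a powr p"
      using c p by (intro mult_right_mono mult_left_mono powr_mono2) auto
    finally have "a * c \<le> \<kappa> powr (1 - p) * \<beta> powr (2 - p) * a powr p" .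
    moreover have "0 \<le> \<kappa> * c\<^sup>2" using \<kappa> by simp
    ultimately show ?thesis by linarith
  qed
qed

definition besov_density :: "real \<Rightarrow> (complex \<Rightarrow> complex) \<Rightarrow> real \<Rightarrow> real" where
  "besov_density p f s = (1 - s) powr (p - 1) * circle_mean (\<lambda>z. norm (deriv f (of_real s * z)) powr p)"

lemma continuous_on_polar_open:
  fixes F :: "complex \<Rightarrow> complex"
  assumes "continuous_on (ball 0 1) F"
  shows "continuous_on ({0..<1} \<times> sphere 0 1) (\<lambda>x. F (of_real (fst x) * snd x))"
  by (rule continuous_on_compose2[OF assms])
    (auto intro!: continuous_intros simp: norm_mult)

lemma continuous_on_besov_density:
  assumes f: "f holomorphic_on ball 0 1" and p: "1 \<le> p"
  shows "continuous_on {0..<1} (besov_density p f)"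
  unfolding besov_density_def[abs_def]
proof (intro continuous_intros continuous_on_circle_mean)
  have "continuous_on ({0..<1} \<times> sphere 0 1) (\<lambda>x. norm (deriv f (of_real (fst x) * snd x)) powr p)"
    using p by (intro continuous_on_powr' continuous_intros continuous_on_polar_open continuous_on_deriv f) auto
  then show "continuous_on ({0..<1} \<times> sphere 0 1) (\<lambda>(s, z). norm (deriv f (of_real s * z)) powr p)"
    by (simp add: case_prod_unfold)
qed auto

lemma circle_Lp_norm_powr:
  assumes g: "continuous_on (sphere 0 1) g" and p: "1 \<le> p"
  shows "circle_Lp_norm p g powr p = circle_mean (\<lambda>z. norm (g z) powr p)"
proof -
  have c: "continuous_on (sphere 0 1) (\<lambda>z. norm (g z) powr p)"
    using p by (intro continuous_on_powr' continuous_intros g) auto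
  have "(LBINT t:{0..2 * pi}. norm (g (cis t)) powr p) = integral {0..2 * pi} (\<lambda>t. norm (g (cis t)) powr p)"
    by (intro set_borel_integral_eq_integral borel_integrable_atLeastAtMost'
        continuous_on_circle_path[where g = "\<lambda>z. norm (g z) powr p"] c)
  then have "1 / (2 * pi) * (LBINT t:{0..2 * pi}. norm (g (cis t)) powr p) = circle_mean (\<lambda>z. norm (g z) powr p)"
    by (simp add: circle_mean_def)
  moreover have "0 \<le> circle_mean (\<lambda>z. norm (g z) powr p)"
    by (rule circle_mean_nonneg[OF c]) simp
  ultimately show ?thesis using p by (simp add: circle_Lp_norm_def powr_powr)
qed

lemma besov_integral_eq:
  assumes f: "f holomorphic_on ball 0 1" and p: "1 \<le> p"
  shows "besov_integral p f = (\<integral>\<^sup>+s. ennreal (besov_density p f s) * indicator {0..<1} s \<partial>lborel)"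
  unfolding besov_integral_def
proof (intro nn_integral_cong)
  fix s :: real
  have "continuous_on (sphere 0 1) (\<lambda>z. deriv f (of_real s * z))" if "s \<in> {0..<1}"
    by (rule continuous_on_dilated_circle[OF continuous_on_deriv[OF f]]) (use that in auto)
  then show "ennreal ((1 - s) powr (p - 1) * circle_Lp_norm p (\<lambda>\<zeta>. deriv f (of_real s * \<zeta>)) powr p) * indicator {0..<1} s
      = ennreal (besov_density p f s) * indicator {0..<1} s"
    using p by (auto simp: besov_density_def circle_Lp_norm_powr split: split_indicator)
qed

lemma measurable_besov_density:
  assumes f: "f holomorphic_on ball 0 1" and p: "1 \<le> p"
  shows "(\<lambda>s. ennreal (besov_density p f s) * indicator {0..<1} s) \<in> borel_measurable borel"
proof -
  have "(\<lambda>s. ennreal (indicator {0..<1} s *\<^sub>R besov_density p f s)) \<in> borel_measurable borel"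
    by (intro measurable_compose[OF _ measurable_ennreal] borel_measurable_continuous_on_indicator
        continuous_on_besov_density f p) auto
  then show ?thesis
    by (rule subst[of _ _ "\<lambda>h. h \<in> borel_measurable borel", rotated])
      (auto simp: fun_eq_iff split: split_indicator)
qed

lemma besov_density_nonneg:
  assumes f: "f holomorphic_on ball 0 1" and p: "1 \<le> p" and s: "0 \<le> s" "s < 1"
  shows "0 \<le> besov_density p f s"
proof -
  have "continuous_on (sphere 0 1) (\<lambda>z. deriv f (of_real s * z))"
    by (rule continuous_on_dilated_circle[OF continuous_on_deriv[OF f]]) (use s in auto)
  then show ?thesis
    unfolding besov_density_def using p
    by (intro mult_nonneg_nonneg circle_mean_nonneg continuous_on_powr' continuous_intros) auto
qed

lemma besov_integral_dilation_le:
  assumes f: "f holomorphic_on ball 0 1" and p: "1 \<le> p" and r: "0 < r" "r < 1"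
  shows "besov_integral p (\<lambda>z. f (of_real r * z)) \<le> besov_integral p f"
proof -
  let ?g = "\<lambda>z. f (of_real r * z)"
  let ?Z = "\<lambda>s. ennreal (besov_density p f s) * indicator {0..<1} s"
  have g: "?g holomorphic_on ball 0 1"
    by (rule holomorphic_on_subset[OF holomorphic_dilation[OF f r(1)]])
      (use r in \<open>simp add: subset_ball\<close>)
  have le: "besov_density p ?g s \<le> r * besov_density p f (r * s)" if s: "0 \<le> s" "s < 1" for s
  proof -
    have sr: "r * s < 1" using r s mult_strict_mono[of r 1 s 1] by (cases "s = 0") auto
    have "circle_mean (\<lambda>z. norm (deriv ?g (of_real s * z)) powr p)
        = circle_mean (\<lambda>z. r powr p * norm (deriv f (of_real (r * s) * z)) powr p)"
    proof (rule circle_mean_cong)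
      fix z :: complex assume "norm z = 1"
      then have "norm (of_real s * z) < 1 / r"
        using r s sr by (simp add: norm_mult field_simps)
      then show "norm (deriv ?g (of_real s * z)) powr p = r powr p * norm (deriv f (of_real (r * s) * z)) powr p"
        using r by (simp add: deriv_dilation[OF f r(1)] norm_mult powr_mult mult.assoc)
    qed
    then have e: "besov_density p ?g s
        = r powr p * (1 - s) powr (p - 1) * circle_mean (\<lambda>z. norm (deriv f (of_real (r * s) * z)) powr p)"
      by (simp add: besov_density_def circle_mean_cmult)
    have "r powr p * (1 - s) powr (p - 1) = r * (r * (1 - s)) powr (p - 1)"
      using r s powr_add[of r 1 "p - 1"] by (simp add: powr_mult)
    also have "\<dots> \<le> r * (1 - r * s) powr (p - 1)"
      using r s p by (intro mult_left_mono powr_mono2) (auto simp: algebra_simps)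
    finally have le: "r powr p * (1 - s) powr (p - 1) \<le> r * (1 - r * s) powr (p - 1)" .
    have "0 \<le> circle_mean (\<lambda>z. norm (deriv f (of_real (r * s) * z)) powr p)"
    proof (rule circle_mean_nonneg)
      have "continuous_on (sphere 0 1) (\<lambda>z. deriv f (of_real (r * s) * z))"
        by (rule continuous_on_dilated_circle[OF continuous_on_deriv[OF f]]) (use r s sr in auto)
      then show "continuous_on (sphere 0 1) (\<lambda>z. norm (deriv f (of_real (r * s) * z)) powr p)"
        using p by (intro continuous_on_powr' continuous_intros) auto
    qed simp
    from mult_right_mono[OF le this] show ?thesis
      unfolding e unfolding besov_density_def mult.assoc .
  qed
  have "besov_integral p ?g \<le> (\<integral>\<^sup>+s. ennreal r * ?Z (0 + r * s) \<partial>lborel)"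
    unfolding besov_integral_eq[OF g p]
  proof (rule nn_integral_mono)
    fix s :: real
    show "ennreal (besov_density p ?g s) * indicator {0..<1} s \<le> ennreal r * ?Z (0 + r * s)"
    proof (cases "s \<in> {0..<1}")
      case True
      then have s: "0 \<le> s" "s < 1" by auto
      have "r * s \<le> s" using r s by (simp add: mult_left_le_one_le)
      then have "r * s \<in> {0..<1}" using r s by auto
      then show ?thesis
        using True le[OF s] r by (simp add: ennreal_mult'[symmetric] ennreal_leI)
    qed simp
  qed
  also have "\<dots> = ennreal r * (\<integral>\<^sup>+s. ?Z (0 + r * s) \<partial>lborel)"
    by (rule nn_integral_cmult)
      (rule measurable_compose[OF _ measurable_besov_density[OF f p]], measurable)
  also have "\<dots> = (\<integral>\<^sup>+s. ?Z s \<partial>lborel)"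
    using nn_integral_real_affine[OF measurable_besov_density[OF f p], of r 0] r by simp
  finally show ?thesis by (simp add: besov_integral_eq[OF f p])
qed

text \<open>The Littlewood-Paley identity for \<open>f\<close> and the analytic projection \<open>T\<close> of \<open>u\<close>, with
  \<open>Young_type_inequality\<close> at every point for \<open>t (1 - s) \<bar>f'\<bar>\<close> and \<open>(1 - s) \<bar>T'\<bar>\<close>. The square term is
  integrated by the Littlewood-Paley identity for \<open>T\<close> and the Bessel inequality. The parameter \<open>t\<close>
  makes the estimate usable for multiples of \<open>f\<close>.\<close>

lemma besov_pairing_regular:
  assumes f: "f holomorphic_on ball 0 R" "1 < R"
    and u: "continuous_on (sphere 0 1) u" "\<And>z. norm z = 1 \<Longrightarrow> norm (u z) \<le> U"
    and \<beta>: "\<And>z. norm z < 1 \<Longrightarrow> (1 - norm z) * norm (cauchy_transform_deriv u z) \<le> \<beta>"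
    and r: "0 < r" "r < 1" and \<kappa>: "0 < \<kappa>" and t: "0 \<le> t" and p: "1 \<le> p" "p < 2"
  shows "ennreal (t * norm (circle_mean (\<lambda>z. f (of_real r * z) * cnj (u z)) - f 0 * cnj (circle_mean u)))
     \<le> ennreal (\<kappa> * U\<^sup>2) + ennreal (4 * \<kappa> powr (1 - p) * \<beta> powr (2 - p) * t powr p) * besov_integral p f"
proof -
  define T where "T = (\<lambda>z. cauchy_transform u (of_real r * z))"
  define R' where "R' = min R (1 / r)"
  define K where "K = \<kappa> powr (1 - p) * \<beta> powr (2 - p)"
  have K0: "0 \<le> K" by (simp add: K_def)
  have R': "1 < R'" using f r by (simp add: R'_def)
  have f': "f holomorphic_on ball 0 R'" and f1: "f holomorphic_on ball 0 1"
    using f R' by (auto simp: R'_def intro: holomorphic_on_subset)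
  have T: "T holomorphic_on ball 0 R'"
    unfolding T_def
    by (rule holomorphic_on_subset[OF holomorphic_dilation[OF cauchy_transform_holomorphic[OF u(1)] r(1)]])
      (auto simp: R'_def)
  have dT: "deriv T z = of_real r * cauchy_transform_deriv u (of_real r * z)" if "norm z \<le> 1" for z
  proof -
    have "1 < 1 / r" using r by simp
    with that have "norm z < 1 / r" by linarith
    moreover have "norm (of_real r * z) < 1"
    proof -
      have "r * norm z \<le> r" using that r by (intro mult_left_le) auto
      moreover have "norm (of_real r * z) = r * norm z" using r by (simp add: norm_mult)
      ultimately show ?thesis using r by linarith
    qed
    ultimately show ?thesis
      unfolding T_def using deriv_dilation[OF cauchy_transform_holomorphic[OF u(1)] r(1)]
        deriv_cauchy_transform[OF u(1)] by simp
  qed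
  have d: "deriv f holomorphic_on ball 0 R'" "deriv T holomorphic_on ball 0 R'"
    using f' T by (auto intro: holomorphic_deriv)
  have conts: "continuous_on (sphere 0 1) (\<lambda>z. F (of_real s * z))"
    if "F holomorphic_on ball 0 R'" "s \<in> {0..1}" for F :: "complex \<Rightarrow> complex" and s
    by (rule continuous_on_dilated_circle[OF holomorphic_on_imp_continuous_on[OF that(1)]]) (use that R' in auto)
  define G where "G = (\<lambda>s. LP_weight s * circle_mean (\<lambda>z. norm (deriv f (of_real s * z)) * norm (deriv T (of_real s * z))))"
  define H where "H = (\<lambda>s. LP_weight s * circle_mean (\<lambda>z. (norm (deriv T (of_real s * z)))\<^sup>2))"
  have cG: "continuous_on {0..1} G"
    unfolding G_def by (rule norm_circle_mean_pairing_le(1)[OF f' T R'])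
  have G0: "0 \<le> G s" if "s \<in> {0..1}" for s
    unfolding G_def using that
    by (intro mult_nonneg_nonneg LP_weight_nonneg circle_mean_nonneg continuous_intros conts d) auto
  have H0: "0 \<le> H s" if "s \<in> {0..1}" for s
    unfolding H_def using that
    by (intro mult_nonneg_nonneg LP_weight_nonneg circle_mean_nonneg continuous_intros conts d) auto
  have iH: "(H has_integral (circle_mean (\<lambda>z. (norm (T z))\<^sup>2) - (norm (T 0))\<^sup>2)) {0..1}"
    unfolding H_def by (rule circle_mean_Littlewood_Paley_square[OF T R'])
  have HU: "circle_mean (\<lambda>z. (norm (T z))\<^sup>2) - (norm (T 0))\<^sup>2 \<le> U\<^sup>2"
    using cauchy_transform_Bessel[OF u, of r] r zero_le_power2[of "norm (T 0)"]
    unfolding T_def by linarith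
  have "circle_mean (\<lambda>z. f (of_real r * z) * cnj (u z)) - f 0 * cnj (circle_mean u)
      = circle_mean (\<lambda>z. f z * cnj (T z)) - f 0 * cnj (T 0)"
    using circle_mean_cauchy_transform[OF f u(1), of r] r by (simp add: T_def)
  also have "norm \<dots> \<le> integral {0..1} G"
    unfolding G_def by (rule norm_circle_mean_pairing_le(2)[OF f' T R'])
  finally have le: "norm (circle_mean (\<lambda>z. f (of_real r * z) * cnj (u z)) - f 0 * cnj (circle_mean u)) \<le> integral {0..1} G" .
  have pt: "t * G s \<le> \<kappa> * H s + 4 * K * t powr p * besov_density p f s" if s: "0 \<le> s" "s < 1" for s
  proof -
    let ?a = "\<lambda>z. norm (deriv f (of_real s * z))" and ?c = "\<lambda>z. norm (deriv T (of_real s * z))"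
    have s': "s \<in> {0..1}" using s by simp
    have W: "0 \<le> LP_weight s" "LP_weight s \<le> 4 * (1 - s)"
      using LP_weight_nonneg LP_weight_le s by auto
    have cp: "continuous_on (sphere 0 1) (\<lambda>z. ?a z powr p)"
      using p by (intro continuous_on_powr' continuous_intros conts d s') auto
    have "LP_weight s * (t * circle_mean (\<lambda>z. ?a z * ?c z)) = circle_mean (\<lambda>z. LP_weight s * (t * (?a z * ?c z)))"
      by (simp only: circle_mean_cmult)
    also have "\<dots> \<le> circle_mean (\<lambda>z. LP_weight s * (\<kappa> * (?c z)\<^sup>2) + 4 * K * t powr p * ((1 - s) powr (p - 1) * ?a z powr p))"
    proof (rule circle_mean_mono)
      fix z :: complex assume z: "norm z = 1"
      let ?s = "1 - s"
      have s1: "0 < ?s" using s by simp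
      have nz: "norm (of_real s * z) \<le> 1" using s z by (simp add: norm_mult)
      have cb: "?s * ?c z \<le> \<beta>"
      proof -
        have rs: "norm (of_real r * (of_real s * z)) = r * s" using r s z by (simp add: norm_mult)
        have "r * s \<le> r" using r s by (intro mult_left_le) auto
        then have "r * s < 1" using r by linarith
        have "r * ?s \<le> 1 - r * s" using r by (simp add: algebra_simps)
        then have "r * ?s * norm (cauchy_transform_deriv u (of_real r * (of_real s * z)))
            \<le> (1 - r * s) * norm (cauchy_transform_deriv u (of_real r * (of_real s * z)))"
          by (intro mult_right_mono) auto
        also have "\<dots> \<le> \<beta>" using \<beta>[of "of_real r * (of_real s * z)"] \<open>r * s < 1\<close> rs by simp
        finally show ?thesis unfolding dT[OF nz] norm_mult norm_of_real using r by (simp add: mult_ac)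
      qed
      have "(t * (?s * ?a z)) * (?s * ?c z) \<le> \<kappa> * (?s * ?c z)\<^sup>2 + K * (t * (?s * ?a z)) powr p"
        unfolding K_def by (rule Young_type_inequality) (use t s cb \<kappa> p in auto)
      also have "(t * (?s * ?a z)) powr p = t powr p * (?s\<^sup>2 * (?s powr (p - 2) * ?a z powr p))"
      proof -
        have "?s powr p = ?s\<^sup>2 * ?s powr (p - 2)"
          using powr_add[of ?s 2 "p - 2"] s1 by simp
        then show ?thesis using t s1 by (simp add: powr_mult mult_ac)
      qed
      finally have "?s\<^sup>2 * (t * (?a z * ?c z)) \<le> ?s\<^sup>2 * (\<kappa> * (?c z)\<^sup>2 + K * t powr p * (?s powr (p - 2) * ?a z powr p))"
        by (simp add: algebra_simps power2_eq_square)
      then have "t * (?a z * ?c z) \<le> \<kappa> * (?c z)\<^sup>2 + K * t powr p * (?s powr (p - 2) * ?a z powr p)"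
        using s1 by (simp add: mult_le_cancel_left_pos)
      then have "LP_weight s * (t * (?a z * ?c z))
          \<le> LP_weight s * (\<kappa> * (?c z)\<^sup>2 + K * t powr p * (?s powr (p - 2) * ?a z powr p))"
        using W by (intro mult_left_mono)
      also have "\<dots> = LP_weight s * (\<kappa> * (?c z)\<^sup>2) + LP_weight s * (K * t powr p * (?s powr (p - 2) * ?a z powr p))"
        by (simp add: distrib_left)
      also have "\<dots> \<le> LP_weight s * (\<kappa> * (?c z)\<^sup>2) + 4 * ?s * (K * t powr p * (?s powr (p - 2) * ?a z powr p))"
        using W K0 by (intro add_left_mono mult_right_mono) auto
      also have "4 * ?s * (K * t powr p * (?s powr (p - 2) * ?a z powr p))
          = 4 * K * t powr p * (?s powr (p - 1) * ?a z powr p)"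
      proof -
        have "?s powr (p - 1) = ?s * ?s powr (p - 2)"
          using powr_add[of ?s 1 "p - 2"] s1 by simp
        then show ?thesis by (simp add: mult_ac)
      qed
      finally show "LP_weight s * (t * (?a z * ?c z))
          \<le> LP_weight s * (\<kappa> * (?c z)\<^sup>2) + 4 * K * t powr p * (?s powr (p - 1) * ?a z powr p)" .
    qed (intro continuous_intros conts d s' cp)+
    also have "\<dots> = \<kappa> * H s + 4 * K * t powr p * besov_density p f s"
      by (subst circle_mean_add, intro continuous_intros conts d s', intro continuous_intros cp)
        (simp add: circle_mean_cmult H_def besov_density_def)
    finally show ?thesis by (simp add: G_def mult_ac)
  qed
  let ?D = "\<lambda>s. ennreal (besov_density p f s) * indicator {0..<1} s"
  have "ennreal (t * integral {0..1} G) = (\<integral>\<^sup>+s. ennreal (t * G s) * indicator {0..1} s \<partial>lborel)"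
    by (rule nn_integral_has_integral_lebesgue'[symmetric])
      (use G0 t in \<open>auto intro!: has_integral_mult_right integrable_integral integrable_continuous_real cG\<close>)
  also have "\<dots> \<le> (\<integral>\<^sup>+s. (ennreal (\<kappa> * H s) * indicator {0..1} s + ennreal (4 * K * t powr p) * ?D s) \<partial>lborel)"
  proof (rule nn_integral_mono_AE)
    have "AE s in lborel. s \<noteq> (1::real)" by (rule AE_lborel_singleton)
    then show "AE s in lborel. ennreal (t * G s) * indicator {0..1} s
        \<le> ennreal (\<kappa> * H s) * indicator {0..1} s + ennreal (4 * K * t powr p) * ?D s"
    proof eventually_elim
      case (elim s)
      show ?case
      proof (cases "s \<in> {0..1}")
        case True
        then have s: "0 \<le> s" "s < 1" using elim by auto
        show ?thesis
          using pt[OF s] True s K0 \<kappa> H0[of s] besov_density_nonneg[OF f1 p(1) s]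
          by (simp add: ennreal_mult'[symmetric] ennreal_plus[symmetric] ennreal_leI del: ennreal_plus)
      qed simp
    qed
  qed
  also have "\<dots> = (\<integral>\<^sup>+s. ennreal (\<kappa> * H s) * indicator {0..1} s \<partial>lborel) + (\<integral>\<^sup>+s. ennreal (4 * K * t powr p) * ?D s \<partial>lborel)"
  proof (rule nn_integral_add)
    have "continuous_on {0..1} H"
      unfolding H_def using R'
      by (intro continuous_intros continuous_on_LP_weight continuous_on_circle_mean)
        (auto simp: case_prod_unfold intro!: continuous_intros d continuous_on_polar[OF holomorphic_on_imp_continuous_on])
    then have "(\<lambda>s. ennreal (indicator {0..1} s *\<^sub>R (\<kappa> * H s))) \<in> borel_measurable borel"
      by (intro measurable_compose[OF _ measurable_ennreal] borel_measurable_continuous_on_indicator continuous_intros) auto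
    also have "(\<lambda>s. ennreal (indicator {0..1} s *\<^sub>R (\<kappa> * H s))) = (\<lambda>s. ennreal (\<kappa> * H s) * indicator {0..1} s)"
      by (auto simp: fun_eq_iff split: split_indicator)
    finally show "(\<lambda>s. ennreal (\<kappa> * H s) * indicator {0..1} s) \<in> borel_measurable lborel" by simp
  next
    show "(\<lambda>s. ennreal (4 * K * t powr p) * ?D s) \<in> borel_measurable lborel"
      by (rule borel_measurable_times_ennreal[OF borel_measurable_const])
        (use measurable_besov_density[OF f1 p(1)] in simp)
  qed
  also have "(\<integral>\<^sup>+s. ennreal (\<kappa> * H s) * indicator {0..1} s \<partial>lborel)
      = ennreal (\<kappa> * (circle_mean (\<lambda>z. (norm (T z))\<^sup>2) - (norm (T 0))\<^sup>2))"
    by (rule nn_integral_has_integral_lebesgue')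
      (use H0 \<kappa> iH in \<open>auto intro!: has_integral_mult_right\<close>)
  also have "(\<integral>\<^sup>+s. ennreal (4 * K * t powr p) * ?D s \<partial>lborel) = ennreal (4 * K * t powr p) * besov_integral p f"
    unfolding besov_integral_eq[OF f1 p(1)]
    using measurable_besov_density[OF f1 p(1)] by (intro nn_integral_cmult) simp
  also have "ennreal (\<kappa> * (circle_mean (\<lambda>z. (norm (T z))\<^sup>2) - (norm (T 0))\<^sup>2)) \<le> ennreal (\<kappa> * U\<^sup>2)"
    using HU \<kappa> by (intro ennreal_leI mult_left_mono) auto
  finally have "ennreal (t * integral {0..1} G) \<le> ennreal (\<kappa> * U\<^sup>2) + ennreal (4 * K * t powr p) * besov_integral p f"
    by (simp add: add_right_mono)
  then show ?thesis
    using le t by (auto simp: K_def mult.assoc intro: order_trans[OF ennreal_leI[OF mult_left_mono]])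
qed

text \<open>A Besov function pairs weakly with every bounded \<open>u\<close> whose projection has a small Bloch
  seminorm \<open>\<beta>\<close>: the constant \<open>\<kappa>\<close> can be chosen first, and then \<open>\<beta>\<close>.\<close>

proposition besov_pairing:
  assumes f: "f holomorphic_on ball 0 1" "besov_integral p f < \<infinity>"
    and u: "continuous_on (sphere 0 1) u" "\<And>z. norm z = 1 \<Longrightarrow> norm (u z) \<le> U"
    and \<beta>: "\<And>z. norm z < 1 \<Longrightarrow> (1 - norm z) * norm (cauchy_transform_deriv u z) \<le> \<beta>"
    and r: "0 < r" "r < 1" and \<kappa>: "0 < \<kappa>" and t: "0 \<le> t" and p: "1 \<le> p" "p < 2"
  shows "t * norm (circle_mean (\<lambda>z. f (of_real r * z) * cnj (u z)))
     \<le> t * norm (f 0) * U + \<kappa> * U\<^sup>2 + 4 * \<kappa> powr (1 - p) * \<beta> powr (2 - p) * t powr p * enn2real (besov_integral p f)"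
proof -
  \<comment> \<open>One factor of \<open>r = q * q\<close> makes \<open>f\<close> analytic across the circle, the other one dilates the
    projection of \<open>u\<close>.\<close>
  define q where "q = sqrt r"
  have q: "0 < q" "q < 1" "q * q = r" using r by (auto simp: q_def)
  let ?g = "\<lambda>z. f (of_real q * z)"
  let ?A = "circle_mean (\<lambda>z. f (of_real r * z) * cnj (u z))"
  let ?K = "4 * \<kappa> powr (1 - p) * \<beta> powr (2 - p) * t powr p"
  have "ennreal (t * norm (circle_mean (\<lambda>z. ?g (of_real q * z) * cnj (u z)) - ?g 0 * cnj (circle_mean u)))
      \<le> ennreal (\<kappa> * U\<^sup>2) + ennreal ?K * besov_integral p ?g"
    by (rule besov_pairing_regular[OF holomorphic_dilation[OF f(1) q(1)] _ u \<beta> q(1,2) \<kappa> t p]) (use q in auto)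
  also have "\<dots> \<le> ennreal (\<kappa> * U\<^sup>2) + ennreal ?K * besov_integral p f"
    by (intro add_left_mono mult_left_mono besov_integral_dilation_le f p q) auto
  also have "\<dots> = ennreal (\<kappa> * U\<^sup>2) + ennreal ?K * ennreal (enn2real (besov_integral p f))"
    using f(2) by (simp add: ennreal_enn2real_if)
  also have "\<dots> = ennreal (\<kappa> * U\<^sup>2 + ?K * enn2real (besov_integral p f))"
    using \<kappa> by (simp add: ennreal_mult'[symmetric] ennreal_plus[symmetric] del: ennreal_plus)
  also have "circle_mean (\<lambda>z. ?g (of_real q * z) * cnj (u z)) = ?A"
    by (simp add: mult.assoc[symmetric] of_real_mult[symmetric] q del: of_real_mult)
  finally have "t * norm (?A - f 0 * cnj (circle_mean u)) \<le> \<kappa> * U\<^sup>2 + ?K * enn2real (besov_integral p f)"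
    using \<kappa> by (subst (asm) ennreal_le_iff) auto
  moreover have "norm ?A \<le> norm (?A - f 0 * cnj (circle_mean u)) + norm (f 0) * U"
  proof -
    have "norm ?A \<le> norm (?A - f 0 * cnj (circle_mean u)) + norm (f 0 * cnj (circle_mean u))"
      using norm_triangle_sub[of ?A "f 0 * cnj (circle_mean u)"] by linarith
    also have "norm (f 0 * cnj (circle_mean u)) \<le> norm (f 0) * U"
      using norm_circle_mean_bound[OF u] by (simp add: norm_mult mult_left_mono)
    finally show ?thesis by simp
  qed
  then have "t * norm ?A \<le> t * (norm (?A - f 0 * cnj (circle_mean u)) + norm (f 0) * U)"
    using t by (intro mult_left_mono)
  ultimately show ?thesis by (simp add: distrib_left mult.assoc)
qed

section \<open>The Bloch seminorm of a projected product\<close>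

lemma circle_mean_cube_le:
  assumes "norm a < 1"
  shows "circle_mean (\<lambda>z. 1 / (norm (1 - a * cnj z)) ^ 3) \<le> 1 / (1 - norm a)\<^sup>2"
proof -
  have nz: "1 - a * cnj z \<noteq> 0" if "norm z = 1" for z
    using one_minus_cnj_nonzero[OF assms] that by simp
  have ge: "1 - norm a \<le> norm (1 - a * cnj z)" if "norm z = 1" for z
    using norm_triangle_ineq2[of 1 "a * cnj z"] that by (simp add: norm_mult)
  have "circle_mean (\<lambda>z. 1 / (norm (1 - a * cnj z)) ^ 3)
      \<le> circle_mean (\<lambda>z. 1 / (1 - norm a) * (1 / (norm (1 - a * cnj z))\<^sup>2))"
  proof (rule circle_mean_mono)
    fix z :: complex assume z: "norm z = 1"
    have "1 / norm (1 - a * cnj z) \<le> 1 / (1 - norm a)"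
      using assms ge[OF z] nz[OF z] by (intro divide_left_mono mult_pos_pos) auto
    then have "1 / norm (1 - a * cnj z) * (1 / (norm (1 - a * cnj z))\<^sup>2)
        \<le> 1 / (1 - norm a) * (1 / (norm (1 - a * cnj z))\<^sup>2)"
      by (rule mult_right_mono) simp
    then show "1 / (norm (1 - a * cnj z)) ^ 3 \<le> 1 / (1 - norm a) * (1 / (norm (1 - a * cnj z))\<^sup>2)"
      by (simp add: power3_eq_cube power2_eq_square mult.assoc)
  qed (use nz assms in \<open>auto intro!: continuous_intros\<close>)
  also have "\<dots> = 1 / (1 - norm a) * (1 / (1 - (norm a)\<^sup>2))"
    by (simp only: circle_mean_cmult circle_mean_Poisson[OF assms])
  also have "\<dots> \<le> 1 / (1 - norm a) * (1 / (1 - norm a))"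
  proof (intro mult_left_mono divide_left_mono)
    show "1 - norm a \<le> 1 - (norm a)\<^sup>2"
      using assms by (simp add: power2_eq_square mult_left_le)
    show "0 < (1 - (norm a)\<^sup>2) * (1 - norm a)"
      using assms by (simp add: power_less_one_iff abs_square_less_1)
  qed (use assms in auto)
  finally show ?thesis by (simp add: power2_eq_square)
qed

lemma integral_inverse_square_le:
  assumes "0 \<le> b" "b < 1"
  shows "((\<lambda>s. 1 / (1 - b * s)\<^sup>2) has_integral 1 / (1 - b)) {0..1::real}"
proof -
  have pos: "0 < 1 - b * s" if "s \<in> {0..1}" for s
  proof -
    have "b * s \<le> b" using that assms by (intro mult_left_le) auto
    then show ?thesis using assms by simp
  qed
  have "((\<lambda>s. 1 / (1 - b * s)\<^sup>2) has_integral (1 / (1 - b * 1) - 0 / (1 - b * 0))) {0..1::real}" if "b = 0"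
    using has_integral_const_real[of "1::real" 0 1] that by simp
  moreover have "((\<lambda>s. 1 / (1 - b * s)\<^sup>2) has_integral (1 / (1 - b * 1) / b - 1 / (1 - b * 0) / b)) {0..1::real}" if "b \<noteq> 0"
  proof (rule fundamental_theorem_of_calculus)
    fix s :: real assume s: "s \<in> {0..1}"
    have "((\<lambda>s. 1 / (1 - b * s) / b) has_real_derivative 1 / (1 - b * s)\<^sup>2) (at s within {0..1})"
      using pos[OF s] that by (auto intro!: derivative_eq_intros simp: power2_eq_square divide_simps)
    then show "((\<lambda>s. 1 / (1 - b * s) / b) has_vector_derivative 1 / (1 - b * s)\<^sup>2) (at s within {0..1})"
      by (simp add: has_real_derivative_iff_has_vector_derivative)
  qed simp
  moreover have "1 / (1 - b * 1) / b - 1 / (1 - b * 0) / b = 1 / (1 - b)" if "b \<noteq> 0"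
    using assms that by (simp add: field_simps)
  ultimately show ?thesis by (cases "b = 0") auto
qed

text \<open>The conjugate of the derivative of the projection at \<open>a\<close> is the pairing of \<open>f w\<close> with \<open>\<theta>\<close> (at
  radius \<open>r\<close>), where \<open>f z = z / (1 - cnj a z)\<^sup>2\<close>. In the Littlewood-Paley identity the derivative of \<open>f w\<close>
  falls on one of the two factors. If it falls on \<open>f\<close>, the Bloch bound for \<open>\<theta>\<close> leaves the area
  integral of \<open>\<bar>f'\<bar>\<close>, which is of the size \<open>1 / (1 - \<bar>a\<bar>)\<close>. If it falls on \<open>w\<close>, split
  \<open>\<bar>f\<bar> \<le> \<bar>k\<bar> \<bar>k\<bar>\<close> with \<open>k z = 1 / (1 - cnj a z)\<close> and use the Carleson measures
  (\<open>weighted_square_bound\<close>) of the bounded functions \<open>V\<close> and \<open>\<theta>\<close>.\<close>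

proposition bloch_bound_product:
  fixes \<theta> w V :: "complex \<Rightarrow> complex" and \<epsilon> \<delta> C :: real and r :: real
  assumes \<theta>: "\<theta> holomorphic_on ball 0 1" "\<And>z. norm z < 1 \<Longrightarrow> norm (\<theta> z) \<le> 1"
      "\<And>z. norm z < 1 \<Longrightarrow> (1 - norm z) * norm (deriv \<theta> z) \<le> \<epsilon>"
    and w: "w holomorphic_on ball 0 1" "\<And>z. norm z < 1 \<Longrightarrow> norm (w z) \<le> 2"
      "\<And>z. norm z < 1 \<Longrightarrow> norm (deriv w z) \<le> \<delta> * norm (deriv V z)"
    and V: "V holomorphic_on ball 0 1" "\<And>z. norm z < 1 \<Longrightarrow> norm (V z) \<le> C"
    and r: "0 < r" "r < 1" and a: "norm a < 1" and \<delta>: "0 \<le> \<delta>"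
  defines "u \<equiv> \<lambda>z. \<theta> (of_real r * z) * cnj (w (of_real r * z))"
  shows "(1 - norm a) * norm (cauchy_transform_deriv u a) \<le> 16 * \<epsilon> + 2 * \<delta> * (C\<^sup>2 + 1)"
proof -
  have \<epsilon>0: "0 \<le> \<epsilon>" using order_trans[OF norm_ge_zero] \<theta>(3)[of 0] by simp
  define R where "R = (if a = 0 then 1 / r else min (1 / r) (1 / norm a))"
  have R: "1 < R" "R \<le> 1 / r" using r a by (auto simp: R_def)
  define \<theta>r wr Vr where "\<theta>r = (\<lambda>z. \<theta> (of_real r * z))" and "wr = (\<lambda>z. w (of_real r * z))"
    and "Vr = (\<lambda>z. V (of_real r * z))"
  have hol: "\<theta>r holomorphic_on ball 0 R" "wr holomorphic_on ball 0 R" "Vr holomorphic_on ball 0 R"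
    unfolding \<theta>r_def wr_def Vr_def
    using R by (auto intro: holomorphic_on_subset[OF holomorphic_dilation[OF _ r(1)]] \<theta> w V)
  have sub1: "norm z < 1 / r" "norm (of_real r * z) < 1" if "norm z \<le> 1" for z :: complex
  proof -
    show "norm z < 1 / r" using R that by linarith
    then show "norm (of_real r * z) < 1" using r by (simp add: norm_mult field_simps)
  qed
  have der: "deriv \<theta>r z = of_real r * deriv \<theta> (of_real r * z)"
    "deriv wr z = of_real r * deriv w (of_real r * z)"
    "deriv Vr z = of_real r * deriv V (of_real r * z)" if "norm z \<le> 1" for z
    unfolding \<theta>r_def wr_def Vr_def
    using deriv_dilation[OF \<theta>(1) r(1) sub1(1)[OF that]] deriv_dilation[OF w(1) r(1) sub1(1)[OF that]]
      deriv_dilation[OF V(1) r(1) sub1(1)[OF that]] by auto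
  define k where "k = (\<lambda>z. 1 / (1 - cnj a * z))"
  define f where "f = (\<lambda>z. z / (1 - cnj a * z)\<^sup>2)"
  have nz: "1 - cnj a * z \<noteq> 0" if "norm z < R" for z
  proof
    assume "1 - cnj a * z = 0"
    then have "norm (cnj a * z) = 1" by simp
    then show False using that by (auto simp: R_def norm_mult field_simps split: if_splits)
  qed
  have k: "k holomorphic_on ball 0 R" and f: "f holomorphic_on ball 0 R"
    unfolding k_def f_def using nz by (auto intro!: holomorphic_intros)
  define F where "F = (\<lambda>z. f z * wr z)"
  have F: "F holomorphic_on ball 0 R" unfolding F_def by (intro holomorphic_intros f hol)
  have dF: "deriv F z = f z * deriv wr z + deriv f z * wr z" if "norm z \<le> 1" for z
    unfolding F_def using that R
    by (intro deriv_mult holomorphic_on_imp_differentiable_at[of _ "ball 0 R"] f hol) auto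
  have df: "norm (deriv f z) \<le> 2 * (1 / (norm (1 - cnj a * z)) ^ 3)" if "norm z \<le> 1" for z
  proof -
    have n: "1 - cnj a * z \<noteq> 0" using that R by (intro nz) auto
    define x where "x = 1 - cnj a * z"
    have "(f has_field_derivative (1 * x\<^sup>2 - z * (2 * x * - cnj a)) / (x\<^sup>2 * x\<^sup>2)) (at z)"
      unfolding f_def x_def using n
      by (auto intro!: derivative_eq_intros)
    also have "1 * x\<^sup>2 - z * (2 * x * - cnj a) = x * (1 + cnj a * z)"
      by (simp add: x_def algebra_simps power2_eq_square)
    also have "x * (1 + cnj a * z) / (x\<^sup>2 * x\<^sup>2) = (1 + cnj a * z) / x ^ 3"
      using n by (simp add: x_def[symmetric] power2_eq_square power3_eq_cube)
    finally have "(f has_field_derivative (1 + cnj a * z) / (1 - cnj a * z) ^ 3) (at z)"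
      unfolding x_def .
    then have "deriv f z = (1 + cnj a * z) / (1 - cnj a * z) ^ 3" by (rule DERIV_imp_deriv)
    moreover have "norm (1 + cnj a * z) \<le> 2"
      using norm_triangle_ineq[of 1 "cnj a * z"] mult_le_one[of "norm a" "norm z"] that a by (simp add: norm_mult)
    ultimately show ?thesis
      using divide_right_mono[of "norm (1 + cnj a * z)" 2 "norm (1 - cnj a * z) ^ 3"]
      by (simp add: norm_divide norm_power)
  qed
  have conts: "continuous_on (sphere 0 1) (\<lambda>z. F (of_real s * z))"
    if "F holomorphic_on ball 0 R" "s \<in> {0..1}" for F :: "complex \<Rightarrow> complex" and s
    by (rule continuous_on_dilated_circle[OF holomorphic_on_imp_continuous_on[OF that(1)]]) (use that R in auto)
  have hd: "deriv F holomorphic_on ball 0 R" if "F holomorphic_on ball 0 R" for F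
    using that by (intro holomorphic_deriv) auto
  note polar = continuous_on_polar[OF holomorphic_on_imp_continuous_on]
  define A where "A = (\<lambda>s. LP_weight s * circle_mean (\<lambda>z. norm (deriv F (of_real s * z)) * norm (deriv \<theta>r (of_real s * z))))"
  define D where "D = (\<lambda>G s. LP_weight s * circle_mean (\<lambda>z. (norm (k (of_real s * z) * deriv G (of_real s * z)))\<^sup>2))"
  have cA: "continuous_on {0..1} A"
    unfolding A_def by (rule norm_circle_mean_pairing_le(1)[OF F hol(1) R(1)])
  have cD: "continuous_on {0..1} (D G)" if "G holomorphic_on ball 0 R" for G
    unfolding D_def using R that
    by (intro continuous_intros continuous_on_LP_weight continuous_on_circle_mean)
      (auto simp: case_prod_unfold intro!: continuous_intros hd k polar)
  have DD: "integral {0..1} (D G) \<le> 4 * B\<^sup>2 * (1 / (1 - norm a))"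
    if "G holomorphic_on ball 0 R" "\<And>z. norm z \<le> 1 \<Longrightarrow> norm (G z) \<le> B" for G B
  proof -
    have "integral {0..1} (D G) \<le> 4 * B\<^sup>2 * circle_mean (\<lambda>z. (norm (k z))\<^sup>2)"
      unfolding D_def by (rule weighted_square_bound[OF k R(1) that])
    also have "circle_mean (\<lambda>z. (norm (k z))\<^sup>2) = circle_mean (\<lambda>z. 1 / (norm (1 - a * cnj z))\<^sup>2)"
    proof (rule circle_mean_cong)
      fix z
      have "norm (1 - cnj a * z) = norm (cnj (1 - a * cnj z))" by simp
      also have "\<dots> = norm (1 - a * cnj z)" by (rule complex_mod_cnj)
      finally show "(norm (k z))\<^sup>2 = 1 / (norm (1 - a * cnj z))\<^sup>2"
        by (simp add: k_def norm_divide power_divide)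
    qed
    also have "\<dots> = 1 / (1 - (norm a)\<^sup>2)" by (rule circle_mean_Poisson[OF a])
    also have "4 * B\<^sup>2 * (1 / (1 - (norm a)\<^sup>2)) \<le> 4 * B\<^sup>2 * (1 / (1 - norm a))"
    proof (intro mult_left_mono divide_left_mono)
      show "1 - norm a \<le> 1 - (norm a)\<^sup>2"
        using a by (simp add: power2_eq_square mult_left_le)
      show "0 < (1 - (norm a)\<^sup>2) * (1 - norm a)"
        using a by (simp add: power_less_one_iff abs_square_less_1)
    qed auto
    finally show ?thesis .
  qed
  have "cnj (cauchy_transform_deriv u a) = circle_mean (\<lambda>z. F z * cnj (\<theta>r z))"
    unfolding cauchy_transform_deriv_def circle_mean_cnj[symmetric]
    by (intro circle_mean_cong) (simp add: u_def F_def f_def \<theta>r_def wr_def mult_ac)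
  then have "norm (cauchy_transform_deriv u a) = norm (circle_mean (\<lambda>z. F z * cnj (\<theta>r z)) - F 0 * cnj (\<theta>r 0))"
    by (metis complex_mod_cnj F_def f_def div_0 diff_zero mult_zero_left)
  also have "\<dots> \<le> integral {0..1} A"
    unfolding A_def by (rule norm_circle_mean_pairing_le(2)[OF F hol(1) R(1)])
  also have "\<dots> \<le> integral {0..1} (\<lambda>s. 16 * \<epsilon> * (1 / (1 - norm a * s)\<^sup>2) + \<delta> / 2 * (D Vr s + D \<theta>r s))"
  proof (rule integral_le)
    show "A integrable_on {0..1}" by (rule integrable_continuous_real[OF cA])
    show "(\<lambda>s. 16 * \<epsilon> * (1 / (1 - norm a * s)\<^sup>2) + \<delta> / 2 * (D Vr s + D \<theta>r s)) integrable_on {0..1}"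
      by (intro integrable_add integrable_on_mult_right integrable_continuous_real[OF cD] hol
          has_integral_integrable[OF integral_inverse_square_le] a) simp
    fix s :: real assume s: "s \<in> {0..1}"
    have W: "0 \<le> LP_weight s" "LP_weight s \<le> 4 * (1 - s)"
      using LP_weight_nonneg LP_weight_le s by auto
    have as: "norm (a * of_real s) < 1"
      using a s mult_left_le[of s "norm a"] by (simp add: norm_mult)
    have nzs: "1 - a * of_real s * cnj z \<noteq> 0" if "norm z = 1" for z
      using one_minus_cnj_nonzero[OF as] that by simp
    let ?q = "\<lambda>z. (norm (k (of_real s * z) * deriv Vr (of_real s * z)))\<^sup>2 + (norm (k (of_real s * z) * deriv \<theta>r (of_real s * z)))\<^sup>2"
    have "A s = circle_mean (\<lambda>z. LP_weight s * (norm (deriv F (of_real s * z)) * norm (deriv \<theta>r (of_real s * z))))"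
      by (simp only: A_def circle_mean_cmult)
    also have "\<dots> \<le> circle_mean (\<lambda>z. 16 * \<epsilon> * (1 / (norm (1 - a * of_real s * cnj z)) ^ 3) + \<delta> / 2 * LP_weight s * ?q z)"
    proof (rule circle_mean_mono)
      fix z :: complex assume z: "norm z = 1"
      let ?z = "of_real s * z"
      have nz: "norm ?z \<le> 1" "norm ?z = s" using s z by (auto simp: norm_mult)
      note rz = sub1(2)[OF nz(1)]
      let ?t = "norm (deriv \<theta>r ?z)"
      have Wt: "LP_weight s * ?t \<le> 4 * \<epsilon>"
      proof -
        have nr: "norm (of_real r * ?z) = r * s" using r nz by (simp add: norm_mult)
        have "(1 - s) * ?t = (r * (1 - s)) * norm (deriv \<theta> (of_real r * ?z))"
          unfolding der(1)[OF nz(1)] norm_mult norm_of_real using r by simp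
        also have "\<dots> \<le> (1 - r * s) * norm (deriv \<theta> (of_real r * ?z))"
          using r by (intro mult_right_mono) (auto simp: algebra_simps)
        also have "\<dots> \<le> \<epsilon>" using \<theta>(3)[OF rz] unfolding nr .
        finally have "4 * (1 - s) * ?t \<le> 4 * \<epsilon>" unfolding mult.assoc[of 4] by linarith
        moreover have "LP_weight s * ?t \<le> 4 * (1 - s) * ?t" using W by (intro mult_right_mono) auto
        ultimately show ?thesis by linarith
      qed
      have "norm (1 - cnj a * ?z) = norm (cnj (1 - a * of_real s * cnj z))" by (simp add: mult_ac)
      then have e: "norm (1 - cnj a * ?z) = norm (1 - a * of_real s * cnj z)" by (simp only: complex_mod_cnj)
      have "norm (deriv F ?z) \<le> norm (f ?z * deriv wr ?z) + norm (deriv f ?z * wr ?z)"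
        unfolding dF[OF nz(1)] by (rule norm_triangle_ineq)
      also have "norm (deriv f ?z * wr ?z) \<le> (2 * (1 / (norm (1 - cnj a * ?z)) ^ 3)) * 2"
        unfolding norm_mult using df[OF nz(1)] w(2)[OF rz] by (intro mult_mono) (auto simp: wr_def)
      also have "norm (f ?z * deriv wr ?z) \<le> \<delta> * (norm (k ?z) * norm (k ?z * deriv Vr ?z))"
      proof -
        have "norm (f ?z) = norm ?z * (norm (k ?z))\<^sup>2"
          by (simp add: f_def k_def norm_divide norm_power power_divide)
        also have "\<dots> \<le> (norm (k ?z))\<^sup>2" using nz(1) by (intro mult_left_le_one_le) auto
        finally have 1: "norm (f ?z) \<le> (norm (k ?z))\<^sup>2" .
        have 2: "norm (deriv wr ?z) \<le> \<delta> * norm (deriv Vr ?z)"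
          unfolding der[OF nz(1)] norm_mult[of "of_real r"] norm_of_real
          using mult_left_mono[OF w(3)[OF rz], of "\<bar>r\<bar>"] by (simp add: mult.left_commute)
        have "norm (f ?z) * norm (deriv wr ?z) \<le> (norm (k ?z))\<^sup>2 * (\<delta> * norm (deriv Vr ?z))"
          by (intro mult_mono 1 2) auto
        then show ?thesis by (simp add: norm_mult power2_eq_square mult_ac)
      qed
      finally have n: "norm (deriv F ?z) \<le> \<delta> * (norm (k ?z) * norm (k ?z * deriv Vr ?z)) + 4 * (1 / (norm (1 - a * of_real s * cnj z)) ^ 3)"
        unfolding e by simp
      let ?x = "norm (k ?z * deriv Vr ?z)" and ?y = "norm (k ?z * deriv \<theta>r ?z)" and ?c = "1 / (norm (1 - a * of_real s * cnj z)) ^ 3"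
      have "LP_weight s * (norm (deriv F ?z) * ?t) \<le> LP_weight s * ((\<delta> * (norm (k ?z) * ?x) + 4 * ?c) * ?t)"
        using W n by (intro mult_left_mono mult_right_mono) auto
      also have "\<dots> = \<delta> * LP_weight s * (?x * ?y) + 4 * ?c * (LP_weight s * ?t)"
        by (simp add: norm_mult algebra_simps)
      also have "\<dots> \<le> \<delta> * LP_weight s * ((?x\<^sup>2 + ?y\<^sup>2) / 2) + 4 * ?c * (4 * \<epsilon>)"
      proof (intro add_mono mult_left_mono)
        show "?x * ?y \<le> (?x\<^sup>2 + ?y\<^sup>2) / 2" using sum_squares_bound[of ?x ?y] by simp
      qed (use Wt W \<delta> in auto)
      also have "\<dots> = 16 * \<epsilon> * ?c + \<delta> / 2 * LP_weight s * ?q z" by algebra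
      finally show "LP_weight s * (norm (deriv F ?z) * ?t) \<le> 16 * \<epsilon> * ?c + \<delta> / 2 * LP_weight s * ?q z" .
    qed (use nzs s in \<open>auto intro!: continuous_intros conts hd F hol k holomorphic_on_mult\<close>)
    also have "\<dots> = 16 * \<epsilon> * circle_mean (\<lambda>z. 1 / (norm (1 - a * of_real s * cnj z)) ^ 3) + \<delta> / 2 * LP_weight s * circle_mean ?q"
    proof -
      have 1: "continuous_on (sphere 0 1) (\<lambda>z. 16 * \<epsilon> * (1 / (norm (1 - a * of_real s * cnj z)) ^ 3))"
        using nzs by (auto intro!: continuous_intros)
      have 2: "continuous_on (sphere 0 1) (\<lambda>z. \<delta> / 2 * LP_weight s * ?q z)"
        using s by (auto intro!: continuous_intros conts hd hol k holomorphic_on_mult)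
      show ?thesis by (simp only: circle_mean_add[OF 1 2] circle_mean_cmult)
    qed
    also have "\<delta> / 2 * LP_weight s * circle_mean ?q = \<delta> / 2 * (D Vr s + D \<theta>r s)"
    proof -
      have 1: "continuous_on (sphere 0 1) (\<lambda>z. (norm (k (of_real s * z) * deriv G (of_real s * z)))\<^sup>2)"
        if "G holomorphic_on ball 0 R" for G
        using s that by (auto intro!: continuous_intros conts hd k holomorphic_on_mult)
      show ?thesis
        unfolding D_def by (simp only: circle_mean_add[OF 1 1] hol) (simp only: distrib_left mult.assoc)
    qed
    also have "16 * \<epsilon> * circle_mean (\<lambda>z. 1 / (norm (1 - a * of_real s * cnj z)) ^ 3) \<le> 16 * \<epsilon> * (1 / (1 - norm a * s)\<^sup>2)"
      using circle_mean_cube_le[OF as] s \<epsilon>0 by (intro mult_left_mono) (auto simp: norm_mult)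
    finally show "A s \<le> 16 * \<epsilon> * (1 / (1 - norm a * s)\<^sup>2) + \<delta> / 2 * (D Vr s + D \<theta>r s)" by simp
  qed
  also have "\<dots> = 16 * \<epsilon> * (1 / (1 - norm a)) + \<delta> / 2 * (integral {0..1} (D Vr) + integral {0..1} (D \<theta>r))"
  proof (rule integral_unique, intro has_integral_add has_integral_mult_right)
    show "((\<lambda>s. 1 / (1 - norm a * s)\<^sup>2) has_integral 1 / (1 - norm a)) {0..1}"
      using a by (intro integral_inverse_square_le) auto
  qed (intro integrable_integral integrable_continuous_real cD hol)+
  also have "\<dots> \<le> 16 * \<epsilon> * (1 / (1 - norm a)) + \<delta> / 2 * (4 * C\<^sup>2 * (1 / (1 - norm a)) + 4 * 1\<^sup>2 * (1 / (1 - norm a)))"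
    using \<delta> sub1 V(2) \<theta>(2)
    by (intro add_left_mono mult_left_mono add_mono DD hol) (auto simp: Vr_def \<theta>r_def)
  also have "\<dots> = (16 * \<epsilon> + 2 * \<delta> * (C\<^sup>2 + 1)) / (1 - norm a)"
    by (simp add: add_divide_distrib algebra_simps)
  finally show ?thesis
    using a by (simp add: pos_le_divide_eq mult.commute)
qed

section \<open>Riesz products with slowly varying Herglotz transforms\<close>

lemma weighted_power_le_1:
  fixes x :: real
  assumes "0 \<le> x" "x \<le> 1"
  shows "(1 - x) * (of_nat k * x ^ (k - 1)) \<le> 1"
proof (cases k)
  case (Suc n)
  have "(1 - x) * (of_nat k * x ^ n) = (1 - x) * (\<Sum>j<k. x ^ n)" by simp
  also have "\<dots> \<le> (1 - x) * (\<Sum>j<k. x ^ j)"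
    using assms Suc by (intro mult_left_mono sum_mono power_decreasing) auto
  also have "\<dots> = 1 - x ^ k" by (simp add: one_diff_power_eq)
  also have "\<dots> \<le> 1" using assms by simp
  finally show ?thesis using Suc by simp
qed simp

lemma power_derivative_tendsto_0:
  fixes x e :: real
  assumes "0 \<le> x" "x < 1" "0 < e"
  obtains M where "\<And>k. k \<ge> M \<Longrightarrow> of_nat k * x ^ (k - 1) < e"
proof -
  have "(\<lambda>n. of_nat (Suc n) * x ^ n) \<longlonglongrightarrow> 0"
  proof -
    have "(\<lambda>n. of_nat n * x ^ n) \<longlonglongrightarrow> 0" by (rule powser_times_n_limit_0) (use assms in auto)
    moreover have "(\<lambda>n. x ^ n) \<longlonglongrightarrow> 0" using assms by (intro LIMSEQ_realpow_zero) auto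
    ultimately have "(\<lambda>n. of_nat n * x ^ n + x ^ n) \<longlonglongrightarrow> 0 + 0" by (rule tendsto_add)
    then show ?thesis by (simp add: algebra_simps)
  qed
  from order_tendstoD(2)[OF this assms(3)] obtain M where M: "\<And>n. n \<ge> M \<Longrightarrow> of_nat (Suc n) * x ^ n < e"
    by (auto simp: eventually_sequentially)
  show thesis
  proof (rule that[of "Suc M"])
    fix k assume "k \<ge> Suc M"
    then obtain n where "k = Suc n" "n \<ge> M" by (cases k) auto
    then show "of_nat k * x ^ (k - 1) < e" using M by simp
  qed
qed

lemma positive_near_circle:
  fixes \<Theta> :: "complex \<Rightarrow> real"
  assumes c: "continuous_on (cball 0 1) \<Theta>" and pos: "\<And>z. norm z = 1 \<Longrightarrow> 0 < \<Theta> z"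
  obtains \<rho> where "0 \<le> \<rho>" "\<rho> < 1" "\<And>z. \<rho> < norm z \<Longrightarrow> norm z \<le> 1 \<Longrightarrow> 0 < \<Theta> z"
proof -
  define K where "K = cball 0 1 \<inter> {z. \<Theta> z \<le> 0}"
  have K: "K = cball 0 1 \<inter> \<Theta> -` {..0}" by (auto simp: K_def)
  have "closed K"
    unfolding K by (rule continuous_closed_preimage[OF c closed_cball closed_atMost])
  then have "compact (cball 0 1 \<inter> K)"
    by (intro compact_Int_closed compact_cball)
  then have "compact K" by (simp add: K_def Int_assoc[symmetric])
  show thesis
  proof (cases "K = {}")
    case True
    have "0 < \<Theta> z" if "norm z \<le> 1" for z
      using True that unfolding K_def by (force simp: not_le)
    then show thesis by (intro that[of 0]) auto
  next
    case False
    then obtain z0 where z0: "z0 \<in> K" "\<And>z. z \<in> K \<Longrightarrow> norm z \<le> norm z0"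
      using continuous_attains_sup[OF \<open>compact K\<close>, of norm] by (auto intro: continuous_intros)
    have "norm z0 < 1" using z0(1) pos[of z0] unfolding K_def by (force simp: not_le)
    moreover have "0 < \<Theta> z" if "norm z0 < norm z" "norm z \<le> 1" for z
      using z0(2)[of z] that unfolding K_def by (force simp: not_le)
    ultimately show thesis by (intro that[of "norm z0"]) auto
  qed
qed

text \<open>On the circle \<open>\<tau>\<close> is a positive trigonometric polynomial; it is carried along as the entire function
  \<open>E\<close>, which is \<open>\<tau>\<close> shifted by \<open>d\<close> frequencies. \<open>F\<close> and \<open>H\<close> are the Herglotz transforms of \<open>\<tau>\<^sup>2\<close> and \<open>\<tau>\<close>,
  so \<open>F 0 = 1\<close> and \<open>H 0 = \<eta>\<close> give the means of \<open>\<tau>\<^sup>2\<close> and \<open>\<tau>\<close>. The last clause is strict on the closed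
  disc, hence stable under small perturbations; this is what the induction needs.\<close>

definition riesz_stage ::
    "real \<Rightarrow> real \<Rightarrow> (complex \<Rightarrow> complex) \<Rightarrow> (complex \<Rightarrow> complex) \<Rightarrow> (complex \<Rightarrow> complex) \<Rightarrow> nat \<Rightarrow> (complex \<Rightarrow> real) \<Rightarrow> bool" where
  "riesz_stage c \<eta> F H E d \<tau> \<longleftrightarrow>
     F holomorphic_on UNIV \<and> H holomorphic_on UNIV \<and> E holomorphic_on UNIV \<and>
     F 0 = 1 \<and> H 0 = of_real \<eta> \<and>
     (\<forall>z. norm z = 1 \<longrightarrow> 0 < \<tau> z \<and> E z = z ^ d * of_real (\<tau> z) \<and> Re (F z) = (\<tau> z)\<^sup>2 \<and> Re (H z) = \<tau> z) \<and>
     (\<forall>z. norm z \<le> 1 \<longrightarrow> (1 - norm z) * norm (deriv F z) < c * Re (F z))"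

text \<open>The change of the Herglotz transform of \<open>\<tau>\<^sup>2\<close> when \<open>\<tau>\<^sup>2\<close> is multiplied by \<open>1 + a1 Re z\<^sup>m + a2 Re z\<^bsup>2m\<^esup>\<close>:
  if \<open>E = z\<^sup>d \<tau>\<close> on the circle, then the exponents \<open>m - 2 d\<close> and \<open>2 m - 2 d\<close> turn \<open>E\<^sup>2\<close> into \<open>z\<^sup>m \<tau>\<^sup>2\<close> and
  \<open>z\<^bsup>2m\<^esup> \<tau>\<^sup>2\<close>.\<close>

definition riesz_update ::
    "real \<Rightarrow> real \<Rightarrow> nat \<Rightarrow> nat \<Rightarrow> (complex \<Rightarrow> complex) \<Rightarrow> (complex \<Rightarrow> complex) \<Rightarrow> complex \<Rightarrow> complex" where
  "riesz_update a1 a2 k l F E z = F z + (of_real a1 * z ^ k + of_real a2 * z ^ l) * (E z)\<^sup>2"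

text \<open>Deep inside the disc the added term is negligible for large exponents, and the strict
  inequality for \<open>F\<close> has room. Close to the circle \<open>(1 - \<bar>z\<bar>) \<bar>F'\<bar>\<close> is small instead, and the
  derivative of a power satisfies \<open>(1 - \<bar>z\<bar>) \<bar>(z\<^sup>k)'\<bar> \<le> 1\<close> for every \<open>k\<close>; so the new left-hand side is
  at most about \<open>(a1 + a2) \<bar>E\<bar>\<^sup>2\<close>, and the new right-hand side at least about
  \<open>c (1 - (a1 + a2)) \<bar>E\<bar>\<^sup>2\<close>.\<close>

lemma riesz_bloch_step:
  fixes F E :: "complex \<Rightarrow> complex" and a1 a2 c :: real
  assumes F: "F holomorphic_on UNIV" and E: "E holomorphic_on UNIV"
    and pos: "\<And>z. norm z = 1 \<Longrightarrow> 0 < Re (F z)"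
    and sq: "\<And>z. norm z = 1 \<Longrightarrow> (norm (E z))\<^sup>2 = Re (F z)"
    and bl: "\<And>z. norm z \<le> 1 \<Longrightarrow> (1 - norm z) * norm (deriv F z) < c * Re (F z)"
    and a: "0 \<le> a1" "0 \<le> a2" "a1 + a2 < c * (1 - (a1 + a2))" and c: "0 < c"
  shows "\<exists>M. \<forall>k l z. M \<le> k \<longrightarrow> M \<le> l \<longrightarrow> norm z \<le> 1 \<longrightarrow>
      (1 - norm z) * norm (deriv (riesz_update a1 a2 k l F E) z)
        < c * Re (riesz_update a1 a2 k l F E z)"
proof -
  define A where "A = a1 + a2"
  have A: "0 \<le> A" "A < c * (1 - A)" using a by (auto simp: A_def)
  have cont: "continuous_on S F" "continuous_on S E" "continuous_on S (deriv F)" "continuous_on S (deriv E)" for S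
    using F E by (auto intro!: continuous_on_subset[OF holomorphic_on_imp_continuous_on, of _ UNIV] holomorphic_deriv)
  \<comment> \<open>A lower bound, independent of the exponents, for the room in the claim; it is positive on the
    circle, hence near it.\<close>
  define \<Theta> where "\<Theta> = (\<lambda>z. c * (Re (F z) - A * (norm (E z))\<^sup>2) - A * (norm (E z))\<^sup>2
      - (1 - norm z) * (norm (deriv F z) + 2 * A * norm (E z) * norm (deriv E z)))"
  have c\<Theta>: "continuous_on S \<Theta>" for S unfolding \<Theta>_def by (intro continuous_intros cont)
  have \<Theta>1: "0 < \<Theta> z" if "norm z = 1" for z
  proof -
    have "\<Theta> z = (c * (1 - A) - A) * Re (F z)" using sq[OF that] that by (simp add: \<Theta>_def algebra_simps)
    then show ?thesis using A pos[OF that] by simp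
  qed
  obtain \<rho> where \<rho>: "0 \<le> \<rho>" "\<rho> < 1" and out: "\<And>z. \<rho> < norm z \<Longrightarrow> norm z \<le> 1 \<Longrightarrow> 0 < \<Theta> z"
    using positive_near_circle[OF c\<Theta> \<Theta>1] by blast
  obtain \<mu> where \<mu>: "0 < \<mu>" "\<And>z. norm z \<le> 1 \<Longrightarrow> \<mu> \<le> c * Re (F z) - (1 - norm z) * norm (deriv F z)"
  proof -
    have "continuous_on (cball 0 1) (\<lambda>z. c * Re (F z) - (1 - norm z) * norm (deriv F z))"
      by (intro continuous_intros cont)
    from continuous_attains_inf[OF compact_cball _ this] obtain z where
      z: "z \<in> cball 0 1" "\<And>w. w \<in> cball 0 1 \<Longrightarrow> c * Re (F z) - (1 - norm z) * norm (deriv F z) \<le> c * Re (F w) - (1 - norm w) * norm (deriv F w)"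
      by auto
    show thesis using bl[of z] z by (intro that[of "c * Re (F z) - (1 - norm z) * norm (deriv F z)"]) auto
  qed
  obtain S where S: "0 < S" "\<And>z. norm z \<le> 1 \<Longrightarrow> norm (E z) \<le> S" "\<And>z. norm z \<le> 1 \<Longrightarrow> norm (deriv E z) \<le> S"
  proof -
    have "bounded (E ` cball 0 1)" "bounded (deriv E ` cball 0 1)"
      by (intro compact_imp_bounded compact_continuous_image cont compact_cball)+
    then obtain S1 S2 where "0 < S1" "\<forall>x\<in>E ` cball 0 1. norm x \<le> S1" "0 < S2" "\<forall>x\<in>deriv E ` cball 0 1. norm x \<le> S2"
      by (auto simp: bounded_pos)
    then show thesis by (intro that[of "max S1 S2"]) (auto simp: le_max_iff_disj)
  qed
  define e where "e = \<mu> / (2 * (A + 1) * (c + 3) * S\<^sup>2)"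
  have e: "0 < e" using \<mu> A S c by (simp add: e_def)
  obtain M where M: "\<And>k. M \<le> k \<Longrightarrow> of_nat k * \<rho> ^ (k - 1) < e"
    using power_derivative_tendsto_0[OF \<rho> e] by blast
  show ?thesis
  proof (intro exI[of _ "Suc M"] allI impI)
    fix k l z assume k: "Suc M \<le> k" and l: "Suc M \<le> l" and z: "norm (z::complex) \<le> 1"
    let ?p = "of_real a1 * z ^ k + of_real a2 * z ^ l"
    let ?p' = "of_real a1 * (of_nat k * z ^ (k - 1)) + of_real a2 * (of_nat l * z ^ (l - 1))"
    have dE: "(E has_field_derivative deriv E z) (at z)" and dF: "(F has_field_derivative deriv F z) (at z)"
      using E F by (auto intro: holomorphic_derivI)
    have "(riesz_update a1 a2 k l F E has_field_derivative
        deriv F z + (?p' * (E z)\<^sup>2 + ?p * (2 * E z * deriv E z))) (at z)"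
      unfolding riesz_update_def[abs_def] by (auto intro!: derivative_eq_intros dE dF simp: algebra_simps)
    then have D: "deriv (riesz_update a1 a2 k l F E) z
        = deriv F z + (?p' * (E z)\<^sup>2 + ?p * (2 * E z * deriv E z))"
      by (rule DERIV_imp_deriv)
    let ?x = "norm z" and ?E = "norm (E z)" and ?E' = "norm (deriv E z)"
    have np: "norm ?p \<le> a1 * ?x ^ k + a2 * ?x ^ l"
      by (rule order_trans[OF norm_triangle_ineq]) (use a in \<open>simp add: norm_mult norm_power\<close>)
    have np': "norm ?p' \<le> a1 * (of_nat k * ?x ^ (k - 1)) + a2 * (of_nat l * ?x ^ (l - 1))"
      by (rule order_trans[OF norm_triangle_ineq]) (use a in \<open>simp add: norm_mult norm_power\<close>)
    have "norm (deriv F z + (?p' * (E z)\<^sup>2 + ?p * (2 * E z * deriv E z)))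
        \<le> norm (deriv F z) + (norm (?p' * (E z)\<^sup>2) + norm (?p * (2 * E z * deriv E z)))"
      by (intro order_trans[OF norm_triangle_ineq] add_mono order_refl norm_triangle_ineq)
    also have "\<dots> = norm (deriv F z) + (norm ?p' * ?E\<^sup>2 + norm ?p * (2 * ?E * ?E'))"
      by (simp add: norm_mult norm_power)
    finally have N: "norm (deriv F z + (?p' * (E z)\<^sup>2 + ?p * (2 * E z * deriv E z)))
        \<le> norm (deriv F z) + (norm ?p' * ?E\<^sup>2 + norm ?p * (2 * ?E * ?E'))" .
    have re: "Re (F z) - norm ?p * ?E\<^sup>2 \<le> Re (F z + ?p * (E z)\<^sup>2)"
    proof -
      have "- norm (?p * (E z)\<^sup>2) \<le> Re (?p * (E z)\<^sup>2)" using abs_Re_le_cmod[of "?p * (E z)\<^sup>2"] by linarith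
      then show ?thesis by (simp add: norm_mult norm_power)
    qed
    have "(1 - ?x) * (norm (deriv F z) + (norm ?p' * ?E\<^sup>2 + norm ?p * (2 * ?E * ?E'))) < c * (Re (F z) - norm ?p * ?E\<^sup>2)"
    proof (cases "\<rho> < ?x")
      case True
      have p1: "norm ?p \<le> A"
      proof -
        have "a1 * ?x ^ k + a2 * ?x ^ l \<le> a1 * 1 + a2 * 1"
          using a z by (intro add_mono mult_left_mono power_le_one) auto
        then show ?thesis using np by (simp add: A_def)
      qed
      have p1': "(1 - ?x) * norm ?p' \<le> A"
      proof -
        have "(1 - ?x) * norm ?p' \<le> (1 - ?x) * (a1 * (of_nat k * ?x ^ (k - 1)) + a2 * (of_nat l * ?x ^ (l - 1)))"
          using np' z by (intro mult_left_mono) auto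
        also have "\<dots> = a1 * ((1 - ?x) * (of_nat k * ?x ^ (k - 1))) + a2 * ((1 - ?x) * (of_nat l * ?x ^ (l - 1)))"
          by (simp add: algebra_simps)
        also have "\<dots> \<le> a1 * 1 + a2 * 1"
          using a z by (intro add_mono mult_left_mono weighted_power_le_1) auto
        finally show ?thesis by (simp add: A_def)
      qed
      have "(1 - ?x) * (norm (deriv F z) + (norm ?p' * ?E\<^sup>2 + norm ?p * (2 * ?E * ?E')))
          = (1 - ?x) * norm (deriv F z) + ((1 - ?x) * norm ?p') * ?E\<^sup>2 + (1 - ?x) * (norm ?p * (2 * ?E * ?E'))"
        by (simp add: algebra_simps)
      also have "\<dots> \<le> (1 - ?x) * norm (deriv F z) + A * ?E\<^sup>2 + (1 - ?x) * (A * (2 * ?E * ?E'))"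
        using p1 p1' z by (intro add_mono mult_left_mono mult_right_mono order_refl) auto
      also have "\<dots> < c * (Re (F z) - A * ?E\<^sup>2)"
        using out[OF True z] by (simp add: \<Theta>_def algebra_simps)
      also have "\<dots> \<le> c * (Re (F z) - norm ?p * ?E\<^sup>2)"
        using c p1 by (intro mult_left_mono diff_left_mono mult_right_mono) auto
      finally show ?thesis .
    next
      case False
      then have x: "?x \<le> \<rho>" by simp
      have mono: "of_nat j * ?x ^ (j - 1) \<le> e" "?x ^ j \<le> e" if "Suc M \<le> j" for j
      proof -
        have "of_nat j * ?x ^ (j - 1) \<le> of_nat j * \<rho> ^ (j - 1)"
          using x by (intro mult_left_mono power_mono) auto
        also have "\<dots> \<le> e" using M[of j] that by simp
        finally show 1: "of_nat j * ?x ^ (j - 1) \<le> e" .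
        have "?x ^ j = ?x * ?x ^ (j - 1)" using that by (cases j) auto
        also have "\<dots> \<le> of_nat j * ?x ^ (j - 1)"
          using that z by (intro mult_right_mono) auto
        finally show "?x ^ j \<le> e" using 1 by simp
      qed
      have p1: "norm ?p \<le> A * e"
      proof -
        have "a1 * ?x ^ k + a2 * ?x ^ l \<le> a1 * e + a2 * e"
          using a mono k l by (intro add_mono mult_left_mono) auto
        then show ?thesis using np by (simp add: A_def algebra_simps)
      qed
      have p1': "norm ?p' \<le> A * e"
      proof -
        have "a1 * (of_nat k * ?x ^ (k - 1)) + a2 * (of_nat l * ?x ^ (l - 1)) \<le> a1 * e + a2 * e"
          using a mono k l by (intro add_mono mult_left_mono) auto
        then show ?thesis using np' by (simp add: A_def algebra_simps)
      qed
      have E2: "?E\<^sup>2 \<le> S\<^sup>2" "2 * ?E * ?E' \<le> 2 * S\<^sup>2"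
        using S(2,3)[OF z] S(1) by (auto simp: power2_eq_square intro!: mult_mono)
      have Ae: "0 \<le> A * e" using A e by simp
      have "(1 - ?x) * (norm ?p' * ?E\<^sup>2 + norm ?p * (2 * ?E * ?E')) \<le> 1 * (A * e * S\<^sup>2 + A * e * (2 * S\<^sup>2))"
      proof (rule mult_mono)
        show "norm ?p' * ?E\<^sup>2 + norm ?p * (2 * ?E * ?E') \<le> A * e * S\<^sup>2 + A * e * (2 * S\<^sup>2)"
          by (intro add_mono mult_mono[OF p1' E2(1)] mult_mono[OF p1 E2(2)] Ae) auto
      qed (use z in auto)
      moreover have "c * (norm ?p * ?E\<^sup>2) \<le> c * (A * e * S\<^sup>2)"
        using c by (intro mult_left_mono mult_mono[OF p1 E2(1)] Ae) auto
      moreover have "A * e * S\<^sup>2 + A * e * (2 * S\<^sup>2) + c * (A * e * S\<^sup>2) < \<mu>"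
      proof -
        have "A * e * S\<^sup>2 + A * e * (2 * S\<^sup>2) + c * (A * e * S\<^sup>2) = A * ((c + 3) * S\<^sup>2) * e"
          by (simp add: algebra_simps)
        also have "\<dots> \<le> (A + 1) * ((c + 3) * S\<^sup>2) * e"
          using e c S by (intro mult_right_mono) auto
        also have "\<dots> = \<mu> / 2"
        proof -
          define X where "X = (A + 1) * ((c + 3) * S\<^sup>2)"
          have "0 < X" using A c S by (simp add: X_def)
          moreover have "e = \<mu> / (2 * X)" by (simp add: e_def X_def mult.assoc)
          ultimately show ?thesis unfolding X_def[symmetric] by simp
        qed
        finally show ?thesis using \<mu> by simp
      qed
      ultimately show ?thesis using \<mu>(2)[OF z] by (simp add: algebra_simps)
    qed
    then have "(1 - ?x) * (norm (deriv F z) + (norm ?p' * ?E\<^sup>2 + norm ?p * (2 * ?E * ?E'))) < c * Re (F z + ?p * (E z)\<^sup>2)"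
      using mult_left_mono[OF re, of c] c by linarith
    then show "(1 - norm z) * norm (deriv (riesz_update a1 a2 k l F E) z)
        < c * Re (riesz_update a1 a2 k l F E z)"
      unfolding D riesz_update_def using mult_left_mono[OF N, of "1 - ?x"] z by linarith
  qed
qed

text \<open>Multiply \<open>\<tau>\<close> by \<open>q (1 + b Re z\<^sup>m)\<close>. The constant \<open>q\<close> is such that the square of this factor is
  \<open>1 + a1 Re z\<^sup>m + a2 Re z\<^bsup>2m\<^esup>\<close>. For \<open>m > 2 d\<close> all the new frequencies of \<open>\<tau>\<close> and of \<open>\<tau>\<^sup>2\<close> are nonzero, so
  the mean of \<open>\<tau>\<^sup>2\<close> does not change and that of \<open>\<tau>\<close> is multiplied by \<open>q\<close>.\<close>

lemma riesz_step:
  assumes st: "riesz_stage (4 * b) \<eta> F H E d \<tau>" and b: "0 < b" "b \<le> 1 / 24"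
  defines "q \<equiv> 1 / sqrt (1 + b\<^sup>2 / 2)"
  shows "\<exists>F' H' E' d' \<tau>'. riesz_stage (4 * b) (q * \<eta>) F' H' E' d' \<tau>'"
proof -
  define a1 where "a1 = 2 * b * q\<^sup>2"
  define a2 where "a2 = q\<^sup>2 * b\<^sup>2 / 2"
  have q: "0 < q" unfolding q_def by (simp add: add_pos_nonneg)
  have b2: "1 \<le> 1 + b\<^sup>2 / 2" by simp
  have q2': "q\<^sup>2 = 1 / (1 + b\<^sup>2 / 2)" using b2 unfolding q_def by (simp add: power_divide)
  have q2: "q\<^sup>2 * (1 + b\<^sup>2 / 2) = 1" unfolding q2' using b2 by (intro nonzero_eq_divide_eq[THEN iffD1]) linarith+
  have q21: "q\<^sup>2 \<le> 1" unfolding q2' using b2 by (subst divide_le_eq_1) linarith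
  have a: "0 \<le> a1" "0 \<le> a2" using b by (auto simp: a1_def a2_def)
  have a3: "a1 + a2 \<le> 3 * b"
  proof -
    have "a1 + a2 = q\<^sup>2 * (2 * b + b\<^sup>2 / 2)" by (simp add: a1_def a2_def algebra_simps)
    also have "\<dots> \<le> 1 * (2 * b + b\<^sup>2 / 2)" using q21 b by (intro mult_right_mono) auto
    also have "b\<^sup>2 \<le> b" using b by (simp add: power2_eq_square mult_left_le)
    finally show ?thesis using b by simp
  qed
  have ac: "a1 + a2 < 4 * b * (1 - (a1 + a2))"
  proof -
    have "4 * b * (7 / 8) \<le> 4 * b * (1 - (a1 + a2))" using a3 b by (intro mult_left_mono) auto
    moreover have "4 * b * (7 / 8) = 7 / 2 * b" by simp
    ultimately show ?thesis using a3 b by linarith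
  qed
  have hol: "F holomorphic_on UNIV" "H holomorphic_on UNIV" "E holomorphic_on UNIV"
    and at0: "F 0 = 1" "H 0 = of_real \<eta>"
    and circ: "\<And>z. norm z = 1 \<Longrightarrow> 0 < \<tau> z \<and> E z = z ^ d * of_real (\<tau> z) \<and> Re (F z) = (\<tau> z)\<^sup>2 \<and> Re (H z) = \<tau> z"
    and bl: "\<And>z. norm z \<le> 1 \<Longrightarrow> (1 - norm z) * norm (deriv F z) < 4 * b * Re (F z)"
    using st unfolding riesz_stage_def by auto
  have sq: "(norm (E z))\<^sup>2 = Re (F z)" and pos: "0 < Re (F z)" if "norm z = 1" for z
    using circ[OF that] that by (auto simp: norm_mult norm_power)
  have b4: "0 < 4 * b" using b by simp
  have "\<exists>M. \<forall>k l z. M \<le> k \<longrightarrow> M \<le> l \<longrightarrow> norm z \<le> 1 \<longrightarrow>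
      (1 - norm z) * norm (deriv (riesz_update a1 a2 k l F E) z)
        < 4 * b * Re (riesz_update a1 a2 k l F E z)"
    using hol(1,3) pos sq bl a ac b4 by (rule riesz_bloch_step)
  then obtain M where M: "\<And>k l z. M \<le> k \<Longrightarrow> M \<le> l \<Longrightarrow> norm z \<le> 1 \<Longrightarrow>
      (1 - norm z) * norm (deriv (riesz_update a1 a2 k l F E) z)
        < 4 * b * Re (riesz_update a1 a2 k l F E z)"
    by (elim exE) blast
  define m where "m = M + 2 * d + 1"
  define F' where "F' = riesz_update a1 a2 (m - 2 * d) (2 * m - 2 * d) F E"
  define H' where "H' = (\<lambda>z. of_real q * (H z + of_real b * z ^ (m - d) * E z))"
  define E' where "E' = (\<lambda>z. of_real q * E z * (z ^ m + of_real b / 2 * (z ^ (2 * m) + 1)))"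
  define \<tau>' where "\<tau>' = (\<lambda>z. q * \<tau> z * (1 + b * Re (z ^ m)))"
  have "riesz_stage (4 * b) (q * \<eta>) F' H' E' (d + m) \<tau>'"
    unfolding riesz_stage_def
  proof (intro conjI allI impI)
    show "F' holomorphic_on UNIV" "H' holomorphic_on UNIV" "E' holomorphic_on UNIV"
      unfolding F'_def riesz_update_def[abs_def] H'_def E'_def by (intro holomorphic_intros hol; simp)+
    show "F' 0 = 1" "H' 0 = of_real (q * \<eta>)"
      by (simp_all add: F'_def riesz_update_def H'_def at0 m_def)
  next
    fix z :: complex assume "norm z \<le> 1"
    then show "(1 - norm z) * norm (deriv F' z) < 4 * b * Re (F' z)"
      unfolding F'_def by (intro M) (auto simp: m_def)
  next
    fix z :: complex assume z: "norm z = 1"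
    note cz = circ[OF z]
    define t where "t = \<tau> z"
    have t: "0 < t" "E z = z ^ d * of_real t" "Re (F z) = t\<^sup>2" "Re (H z) = t" using cz by (auto simp: t_def)
    define c where "c = Re (z ^ m)"
    have nzm: "norm (z ^ m) = 1" using z by (simp add: norm_power)
    have c1: "\<bar>c\<bar> \<le> 1" using abs_Re_le_cmod[of "z ^ m"] nzm by (simp add: c_def)
    have zm: "z ^ (2 * m) = z ^ m * z ^ m" by (simp add: mult_2 power_add)
    have one: "z ^ m * cnj (z ^ m) = 1" using complex_norm_square[of "z ^ m"] nzm by simp
    have c2: "of_real c = (z ^ m + cnj (z ^ m)) / 2"
      by (simp only: c_def complex_add_cnj) simp
    have re2: "Re (z ^ (2 * m)) = 2 * c\<^sup>2 - 1"
    proof -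
      have "(Re (z ^ m))\<^sup>2 + (Im (z ^ m))\<^sup>2 = 1" using nzm cmod_power2[of "z ^ m"] by simp
      then show ?thesis unfolding zm times_complex.sel c_def power2_eq_square by linarith
    qed
    show "0 < \<tau>' z"
    proof -
      have "b * \<bar>c\<bar> \<le> b" using b c1 by (intro mult_left_le) auto
      moreover have "\<bar>b * c\<bar> = b * \<bar>c\<bar>" using b by (simp add: abs_mult)
      ultimately have "0 < 1 + b * c" using b by linarith
      then show ?thesis unfolding \<tau>'_def c_def[symmetric] t_def[symmetric] using q t(1) by simp
    qed
    show "E' z = z ^ (d + m) * of_real (\<tau>' z)"
    proof -
      have "z ^ (d + m) * of_real (\<tau>' z) = of_real q * of_real t * z ^ d * (z ^ m * (1 + of_real b * of_real c))"
        unfolding \<tau>'_def c_def[symmetric] t_def[symmetric] by (simp add: power_add mult_ac)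
      also have "z ^ m * (1 + of_real b * of_real c) = z ^ m + of_real b / 2 * (z ^ m * z ^ m + z ^ m * cnj (z ^ m))"
        unfolding c2 by (simp add: algebra_simps add_divide_distrib)
      finally show ?thesis unfolding E'_def t(2) one zm by (simp add: mult_ac)
    qed
    show "Re (H' z) = \<tau>' z"
    proof -
      have "m - d + d = m" by (simp add: m_def)
      then have "z ^ (m - d) * z ^ d = z ^ m" by (metis power_add)
      then have "of_real b * z ^ (m - d) * E z = of_real (b * t) * z ^ m"
        unfolding t(2) by (metis (no_types, lifting) mult.assoc mult.commute of_real_mult)
      then have "H' z = of_real q * (H z + of_real (b * t) * z ^ m)" by (simp only: H'_def)
      then have "Re (H' z) = q * (t + b * t * c)"
        using t(4) by (simp add: c_def)
      then show ?thesis
        unfolding \<tau>'_def c_def[symmetric] t_def[symmetric] by (simp add: algebra_simps)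
    qed
    show "Re (F' z) = (\<tau>' z)\<^sup>2"
    proof -
      have e: "(E z)\<^sup>2 = z ^ (2 * d) * of_real (t\<^sup>2)" unfolding t(2) by (simp add: power_mult_distrib power_mult[symmetric] mult.commute)
      have "m - 2 * d + 2 * d = m" "2 * m - 2 * d + 2 * d = 2 * m" by (simp_all add: m_def)
      then have "z ^ (m - 2 * d) * z ^ (2 * d) = z ^ m" "z ^ (2 * m - 2 * d) * z ^ (2 * d) = z ^ (2 * m)"
        by (metis power_add)+
      then have "(of_real a1 * z ^ (m - 2 * d) + of_real a2 * z ^ (2 * m - 2 * d)) * (E z)\<^sup>2
          = of_real (t\<^sup>2) * (of_real a1 * z ^ m + of_real a2 * z ^ (2 * m))"
      proof -
        have "(\<alpha> * x + \<beta> * y) * (w * T) = T * (\<alpha> * (x * w) + \<beta> * (y * w))" for \<alpha> x \<beta> y w T :: complex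
          by (simp add: algebra_simps)
        then show ?thesis
          unfolding e by (simp only: \<open>z ^ (m - 2 * d) * z ^ (2 * d) = z ^ m\<close>
            \<open>z ^ (2 * m - 2 * d) * z ^ (2 * d) = z ^ (2 * m)\<close>)
      qed
      then have "Re (F' z) = t\<^sup>2 + t\<^sup>2 * (a1 * c + a2 * (2 * c\<^sup>2 - 1))"
        unfolding F'_def riesz_update_def using t(3) re2 by (simp add: c_def[symmetric])
      also have "\<dots> = t\<^sup>2 * ((1 - a2) + a1 * c + 2 * a2 * c\<^sup>2)" by (simp add: algebra_simps)
      also have "1 - a2 = q\<^sup>2" using q2 by (simp add: a2_def algebra_simps)
      also have "t\<^sup>2 * (q\<^sup>2 + a1 * c + 2 * a2 * c\<^sup>2) = (q * t * (1 + b * c))\<^sup>2"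
        by (simp add: a1_def a2_def power2_eq_square algebra_simps)
      finally show ?thesis unfolding \<tau>'_def c_def t_def .
    qed
  qed
  then show ?thesis by blast
qed

proposition riesz_stage_exists:
  assumes b: "0 < b" "b \<le> 1 / 24"
  shows "\<exists>F H E d \<tau>. riesz_stage (4 * b) ((1 / sqrt (1 + b\<^sup>2 / 2)) ^ n) F H E d \<tau>"
proof (induction n)
  case 0
  have "riesz_stage (4 * b) 1 (\<lambda>_. 1) (\<lambda>_. 1) (\<lambda>_. 1) 0 (\<lambda>_. 1)"
    using b by (simp add: riesz_stage_def)
  then show ?case by (metis power_0)
next
  case (Suc n)
  then show ?case using riesz_step[OF _ b] by (metis power_Suc)
qed

section \<open>Zeros counted along a sequence, and finite Blaschke products\<close>

definition vanishes_to_order :: "nat \<Rightarrow> (complex \<Rightarrow> complex) \<Rightarrow> complex \<Rightarrow> bool" where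
  "vanishes_to_order n f b \<longleftrightarrow> (\<forall>j<n. (deriv ^^ j) f b = 0)"

lemma vanishes_on_seq_iff:
  "vanishes_on_seq f \<sigma> \<longleftrightarrow> (\<forall>z. vanishes_to_order (count_list \<sigma> z) f z)"
  unfolding vanishes_on_seq_def vanishes_to_order_def
  by (metis count_list_0_iff less_zeroE)

lemma vanishes_to_order_mult:
  assumes "f holomorphic_on S" "u holomorphic_on S" "open S" "b \<in> S" "vanishes_to_order n f b"
  shows "vanishes_to_order n (\<lambda>z. u z * f z) b"
  unfolding vanishes_to_order_def
proof (intro allI impI)
  fix j assume j: "j < n"
  have "(deriv ^^ (j - i)) f b = 0" for i
    using assms(5) j by (auto simp: vanishes_to_order_def)
  then show "(deriv ^^ j) (\<lambda>z. u z * f z) b = 0"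
    by (simp add: higher_deriv_mult[OF assms(2,1,3,4)])
qed

lemma higher_deriv_linear_factor:
  assumes "f holomorphic_on S" "open S" "b \<in> S"
  shows "(deriv ^^ Suc j) (\<lambda>z. (z - b) * f z) b = of_nat (Suc j) * (deriv ^^ j) f b"
proof -
  have d: "(deriv ^^ i) (\<lambda>z. z - b) b = (if i = 1 then 1 else 0)" for i
  proof (cases i)
    case (Suc k)
    have "deriv (\<lambda>z. z - b) = (\<lambda>_. 1)" by (auto simp: fun_eq_iff intro!: DERIV_imp_deriv derivative_eq_intros)
    then have "(deriv ^^ Suc k) (\<lambda>z. z - b) = (deriv ^^ k) (\<lambda>_. 1)"
      by (simp add: funpow_Suc_right del: funpow.simps)
    then show ?thesis using Suc by (simp del: funpow.simps)
  qed simp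
  have "(deriv ^^ Suc j) (\<lambda>z. (z - b) * f z) b
      = (\<Sum>i = 0..Suc j. of_nat (Suc j choose i) * (deriv ^^ i) (\<lambda>z. z - b) b * (deriv ^^ (Suc j - i)) f b)"
    by (rule higher_deriv_mult[OF _ assms]) (auto intro!: holomorphic_intros)
  also have "\<dots> = (\<Sum>i = 0..Suc j. if i = 1 then of_nat (Suc j choose 1) * (deriv ^^ (Suc j - 1)) f b else 0)"
    by (intro sum.cong) (auto simp: d simp del: funpow.simps)
  also have "\<dots> = of_nat (Suc j) * (deriv ^^ j) f b"
    by (subst sum.delta) auto
  finally show ?thesis .
qed

lemma vanishes_to_order_linear_factor:
  assumes "f holomorphic_on S" "open S" "b \<in> S"
  shows "vanishes_to_order (Suc n) (\<lambda>z. (z - b) * f z) b \<longleftrightarrow> vanishes_to_order n f b"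
proof
  assume L: "vanishes_to_order (Suc n) (\<lambda>z. (z - b) * f z) b"
  show "vanishes_to_order n f b"
    unfolding vanishes_to_order_def
  proof (intro allI impI)
    fix j assume "j < n"
    then have "(deriv ^^ Suc j) (\<lambda>z. (z - b) * f z) b = 0"
      using L unfolding vanishes_to_order_def by blast
    then show "(deriv ^^ j) f b = 0"
      unfolding higher_deriv_linear_factor[OF assms] by (simp del: of_nat_Suc)
  qed
next
  assume R: "vanishes_to_order n f b"
  show "vanishes_to_order (Suc n) (\<lambda>z. (z - b) * f z) b"
    unfolding vanishes_to_order_def
  proof (intro allI impI)
    fix j assume j: "j < Suc n"
    show "(deriv ^^ j) (\<lambda>z. (z - b) * f z) b = 0"
    proof (cases j)
      case (Suc i)
      then show ?thesis
        using R j unfolding Suc higher_deriv_linear_factor[OF assms] vanishes_to_order_def by simp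
    qed simp
  qed
qed

lemma vanishes_to_order_other_point:
  assumes "f holomorphic_on S" "open S" "b \<in> S" "b \<noteq> a"
  shows "vanishes_to_order n (\<lambda>z. (z - a) * f z) b \<longleftrightarrow> vanishes_to_order n f b"
proof
  assume "vanishes_to_order n f b"
  then show "vanishes_to_order n (\<lambda>z. (z - a) * f z) b"
    by (intro vanishes_to_order_mult[OF assms(1) _ assms(2,3)]) (auto intro!: holomorphic_intros)
next
  let ?S = "S - {a}"
  have S: "open ?S" "b \<in> ?S" using assms by auto
  have f: "f holomorphic_on ?S" using assms(1) by (rule holomorphic_on_subset) auto
  have g: "(\<lambda>z. (z - a) * f z) holomorphic_on ?S" by (intro holomorphic_intros f)
  have i: "(\<lambda>z. 1 / (z - a)) holomorphic_on ?S" by (auto intro!: holomorphic_intros)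
  assume "vanishes_to_order n (\<lambda>z. (z - a) * f z) b"
  then have "vanishes_to_order n (\<lambda>z. 1 / (z - a) * ((z - a) * f z)) b"
    by (rule vanishes_to_order_mult[OF g i S])
  moreover have "(deriv ^^ j) (\<lambda>z. 1 / (z - a) * ((z - a) * f z)) b = (deriv ^^ j) f b" for j
    by (rule higher_deriv_transform_within_open[OF holomorphic_on_mult[OF i g] f S]) auto
  ultimately show "vanishes_to_order n f b" by (simp add: vanishes_to_order_def)
qed

text \<open>The induction step for splitting off zeros: the factor \<open>z - a\<close> raises the order of vanishing by
  exactly one at \<open>a\<close> and does not change it elsewhere.\<close>

lemma vanishes_on_seq_Cons:
  assumes "f holomorphic_on S" "open S" "set (a # \<sigma>) \<subseteq> S"
  shows "vanishes_on_seq (\<lambda>z. (z - a) * f z) (a # \<sigma>) \<longleftrightarrow> vanishes_on_seq f \<sigma>"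
proof -
  have "vanishes_to_order (count_list (a # \<sigma>) z) (\<lambda>z. (z - a) * f z) z
      \<longleftrightarrow> vanishes_to_order (count_list \<sigma> z) f z" for z
  proof (cases "z \<in> S")
    case True
    then show ?thesis
      using vanishes_to_order_linear_factor[OF assms(1,2)] vanishes_to_order_other_point[OF assms(1,2)]
      by (cases "z = a") auto
  next
    case False
    then have "z \<noteq> a" "count_list \<sigma> z = 0" using assms(3) by (auto simp: count_list_0_iff)
    then show ?thesis by (simp add: vanishes_to_order_def)
  qed
  then show ?thesis by (simp only: vanishes_on_seq_iff)
qed

lemma vanishes_on_seq_prod:
  assumes "f holomorphic_on S" "open S" "set \<sigma> \<subseteq> S"
  shows "vanishes_on_seq (\<lambda>z. (\<Prod>a\<leftarrow>\<sigma>. z - a) * f z) \<sigma>"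
  using assms(3)
proof (induction \<sigma>)
  case Nil
  then show ?case by (simp add: vanishes_on_seq_def)
next
  case (Cons a \<sigma>)
  have "(\<lambda>z. (\<Prod>a\<leftarrow>\<sigma>. z - a)) holomorphic_on S"
    by (induction \<sigma>) (auto intro!: holomorphic_intros)
  then have h: "(\<lambda>z. (\<Prod>a\<leftarrow>\<sigma>. z - a) * f z) holomorphic_on S"
    using assms(1) by (rule holomorphic_on_mult)
  show ?case
    using vanishes_on_seq_Cons[OF h assms(2) Cons.prems] Cons by (simp add: mult.assoc)
qed

lemma vanishes_on_seq_factor:
  assumes "f holomorphic_on S" "open S" "set \<sigma> \<subseteq> S" "vanishes_on_seq f \<sigma>"
  obtains k where "k holomorphic_on S" "\<And>z. z \<in> S \<Longrightarrow> f z = (\<Prod>a\<leftarrow>\<sigma>. z - a) * k z"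
  using assms
proof (induction \<sigma> arbitrary: f thesis)
  case Nil
  then show ?case by simp
next
  case (Cons a \<sigma>)
  have a: "a \<in> S" "f a = 0"
    using Cons.prems by (auto simp: vanishes_on_seq_def dest!: bspec[of _ _ a] spec[of _ 0])
  define g where "g = (\<lambda>z. if z = a then deriv f a else f z / (z - a))"
  have fg: "f z = (z - a) * g z" for z using a by (simp add: g_def)
  have g: "g holomorphic_on S"
    by (rule pole_theorem_open_0[OF Cons.prems(2,3), of a]) (use fg a in \<open>auto simp: g_def\<close>)
  have "vanishes_on_seq (\<lambda>z. (z - a) * g z) (a # \<sigma>)"
    using Cons.prems(5) by (simp only: fg[symmetric])
  then have "vanishes_on_seq g \<sigma>"
    using vanishes_on_seq_Cons[OF g Cons.prems(3,4)] by simp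
  moreover have "set \<sigma> \<subseteq> S" using Cons.prems(4) by simp
  ultimately obtain k where
    k: "k holomorphic_on S" "\<And>z. z \<in> S \<Longrightarrow> g z = (\<Prod>a\<leftarrow>\<sigma>. z - a) * k z"
    using Cons.IH[OF _ g Cons.prems(3)] by blast
  have "f z = (\<Prod>a\<leftarrow>a # \<sigma>. z - a) * k z" if "z \<in> S" for z
    unfolding fg k(2)[OF that] by simp
  then show ?case by (rule Cons.prems(1)[OF k(1)])
qed

text \<open>The polynomial \<open>z\<^sup>N + p\<close> and its reflection \<open>1 + q\<close> are numerator and denominator of a Blaschke
  product. On the circle \<open>\<bar>q\<bar> = \<bar>p\<bar> < 1\<close>, so \<open>1 + q\<close> has no zeros in the closed disc; by reflection
  \<open>z\<^sup>N + p\<close> has none outside the open disc.\<close>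

lemma blaschke_type_factorization:
  fixes p :: "complex poly" and N :: nat
  assumes N: "degree p < N" and p: "\<And>z. norm z = 1 \<Longrightarrow> norm (poly p z) < 1" and p0: "poly p 0 \<noteq> 0"
  defines "q \<equiv> \<lambda>z. \<Sum>k\<le>degree p. cnj (coeff p k) * z ^ (N - k)"
  obtains \<sigma> where "length \<sigma> = N" "set \<sigma> \<subseteq> ball 0 1 - {0}"
    "\<And>z. z ^ N + poly p z = (\<Prod>a\<leftarrow>\<sigma>. z - a)"
    "\<And>z. norm z \<le> 1 \<Longrightarrow> norm (q z) < 1"
    "\<And>z. norm z = 1 \<Longrightarrow> z ^ N + poly p z = z ^ N * cnj (1 + q z)"
proof -
  have refl: "z ^ N * cnj (q (1 / cnj z)) = poly p z" if "z \<noteq> 0" for z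
  proof -
    have "z ^ N * cnj (q (1 / cnj z)) = (\<Sum>k\<le>degree p. coeff p k * (z ^ N * (1 / z) ^ (N - k)))"
      by (simp add: q_def sum_distrib_left mult_ac)
    also have "\<dots> = (\<Sum>k\<le>degree p. coeff p k * z ^ k)"
    proof (rule sum.cong)
      fix k assume "k \<in> {..degree p}"
      then have k: "k \<le> N" using N by auto
      have "z ^ N * (1 / z) ^ (N - k) = z ^ N / z ^ (N - k)" by (simp add: power_one_over divide_inverse power_inverse)
      also have "\<dots> = z ^ k" using k that by (simp add: power_diff)
      finally show "coeff p k * (z ^ N * (1 / z) ^ (N - k)) = coeff p k * z ^ k" by simp
    qed simp
    finally show ?thesis by (simp add: poly_altdef)
  qed
  have circ: "1 / cnj z = z" if "norm z = 1" for z
    using complex_norm_square[of z] that by (metis eq_divide_imp mult_zero_right of_real_1 one_power2 zero_neq_one)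
  have qp: "z ^ N * cnj (q z) = poly p z" if "norm z = 1" for z
    using refl[of z] circ[OF that] that by (metis norm_zero zero_neq_one)
  have q1: "norm (q z) < 1" if z: "norm z \<le> 1" for z
  proof -
    have "norm (q w) < 1" if "norm w = 1" for w
      using p[OF that] qp[OF that] that by (metis complex_mod_cnj mult_1 norm_mult norm_power power_one)
    then have sph: "\<And>w. w \<in> sphere 0 1 \<Longrightarrow> norm (q w) < 1" by simp
    have cq: "continuous_on S (\<lambda>z. norm (q z))" for S unfolding q_def by (intro continuous_intros)
    obtain w where w: "w \<in> sphere 0 1" "\<And>v. v \<in> sphere 0 1 \<Longrightarrow> norm (q v) \<le> norm (q w)"
      using continuous_attains_sup[of "sphere (0::complex) 1" "\<lambda>z. norm (q z)"] cq
      by (auto simp: Ball_def)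
    have "norm (q z) \<le> norm (q w)"
    proof (rule maximum_modulus_frontier[of q "cball 0 1"])
      show "q holomorphic_on interior (cball 0 1)" unfolding q_def by (intro holomorphic_intros)
      show "continuous_on (closure (cball 0 1)) q" unfolding q_def by (intro continuous_intros)
    qed (use w z in auto)
    then show ?thesis using sph[OF w(1)] by simp
  qed
  define P where "P = monom 1 N + p"
  have Pz: "poly P z = z ^ N + poly p z" for z by (simp add: P_def poly_monom)
  have dP: "degree P = N" "lead_coeff P = 1"
  proof -
    show d: "degree P = N" unfolding P_def using N by (subst degree_add_eq_left) (auto simp: degree_monom_eq)
    show "lead_coeff P = 1" unfolding d using N by (simp add: P_def coeff_eq_0)
  qed
  then have "P \<noteq> 0" by auto
  from alg_closed_imp_factorization[OF this]
  obtain A where A: "size A = degree P" "P = smult (lead_coeff P) (\<Prod>x\<in>#A. [:-x, 1:])"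
    by (elim exE conjE) (rule that)
  have PA: "P = (\<Prod>x\<in>#A. [:-x, 1:])" using A(2) unfolding dP(2) smult_1_left .
  obtain \<sigma> where \<sigma>: "mset \<sigma> = A" using ex_mset by blast
  have prod: "poly P z = (\<Prod>a\<leftarrow>\<sigma>. z - a)" for z
  proof -
    have "poly P z = poly (\<Prod>x\<in>#mset \<sigma>. [:-x, 1:]) z" by (simp only: \<sigma> PA[symmetric])
    also have "\<dots> = (\<Prod>a\<leftarrow>\<sigma>. z - a)"
      by (induction \<sigma>) (auto simp: algebra_simps)
    finally show ?thesis .
  qed
  have "a \<in> ball 0 1 - {0}" if "a \<in> set \<sigma>" for a
  proof -
    have "(\<Prod>b\<leftarrow>\<sigma>. a - b) = 0" using that by (auto simp: prod_list_zero_iff image_iff)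
    then have z: "a ^ N + poly p a = 0" using prod[of a] Pz[of a] by simp
    have a0: "a \<noteq> 0" using z p0 N by (auto simp: zero_power)
    have "norm a < 1"
    proof (rule ccontr)
      assume "\<not> norm a < 1"
      then have n: "norm (1 / cnj a) \<le> 1" by (simp add: norm_divide divide_le_eq_1)
      have "a ^ N * (1 + cnj (q (1 / cnj a))) = 0" using z refl[OF a0] by (simp add: distrib_left)
      then have "cnj (q (1 / cnj a)) = - 1" using a0 by (simp add: add_eq_0_iff)
      from arg_cong[OF this, of norm] have "norm (q (1 / cnj a)) = 1" by simp
      then show False using q1[OF n] by simp
    qed
    then show ?thesis using a0 by simp
  qed
  moreover have "length \<sigma> = N" using A(1) dP \<sigma> by (metis size_mset)
  moreover have "z ^ N + poly p z = (\<Prod>a\<leftarrow>\<sigma>. z - a)" for z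
    using prod[of z] Pz[of z] by simp
  moreover have "z ^ N + poly p z = z ^ N * cnj (1 + q z)" if "norm z = 1" for z
    using qp[OF that] by (simp add: distrib_left)
  ultimately show thesis
    using q1 by (intro that[of \<sigma>]) blast+
qed

section \<open>From the analytic pair to the capacity\<close>

lemma entire_polynomial_approximation:
  fixes f :: "complex \<Rightarrow> complex"
  assumes f: "f holomorphic_on UNIV" and e: "0 < e"
  obtains p :: "complex poly" where "\<And>z. norm z \<le> 1 \<Longrightarrow> norm (poly p z - f z) < e"
proof -
  define a where "a = (\<lambda>n. (deriv ^^ n) f 0 / fact n)"
  have s: "(\<lambda>n. a n * z ^ n) sums f z" for z
    using holomorphic_power_series[of f 0 "norm z + 1" z] f
    by (auto simp: a_def intro: holomorphic_on_subset)
  have "summable (\<lambda>n. norm (a n * 1 ^ n))"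
    by (rule powser_insidea[OF sums_summable[OF s[of 2]]]) simp
  then have sm: "summable (\<lambda>n. norm (a n))" by simp
  have "uniform_limit (cball 0 1) (\<lambda>n z. \<Sum>i<n. a i * z ^ i) (\<lambda>z. suminf (\<lambda>i. a i * z ^ i)) sequentially"
    by (rule Weierstrass_m_test[OF _ sm]) (auto simp: norm_mult norm_power mult_left_le power_le_one)
  from eventually_happens'[OF sequentially_bot uniform_limitD[OF this e]] obtain n where
    n: "\<forall>z\<in>cball 0 1. dist (\<Sum>i<n. a i * z ^ i) (suminf (\<lambda>i. a i * z ^ i)) < e"
    by blast
  show thesis
  proof (rule that[of "\<Sum>i<n. monom (a i) i"])
    fix z :: complex assume "norm z \<le> 1"
    then show "norm (poly (\<Sum>i<n. monom (a i) i) z - f z) < e"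
      using bspec[OF n, of z] sums_unique[OF s[of z]] by (simp add: poly_sum poly_monom dist_norm)
  qed
qed

lemma entire_in_besov_space:
  assumes f: "f holomorphic_on UNIV" and p: "1 \<le> p"
  shows "f \<in> besov_space p"
proof -
  have f1: "f holomorphic_on ball 0 1" using f by (rule holomorphic_on_subset) auto
  have "continuous_on (cball 0 1) (deriv f)"
    using f by (intro continuous_on_subset[OF holomorphic_on_imp_continuous_on, of _ UNIV] holomorphic_deriv) auto
  then have "bounded (deriv f ` cball 0 1)"
    by (intro compact_imp_bounded compact_continuous_image compact_cball)
  then obtain B where B: "0 < B" "\<And>z. norm z \<le> 1 \<Longrightarrow> norm (deriv f z) \<le> B"
    by (auto simp: bounded_pos)
  have "besov_density p f s \<le> B powr p" if s: "0 \<le> s" "s < 1" for s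
  proof -
    have c: "continuous_on (sphere 0 1) (\<lambda>z. deriv f (of_real s * z))"
      by (rule continuous_on_dilated_circle[OF continuous_on_deriv[OF f1]]) (use s in auto)
    have "circle_mean (\<lambda>z. norm (deriv f (of_real s * z)) powr p) \<le> circle_mean (\<lambda>_. B powr p)"
    proof (rule circle_mean_mono)
      show "continuous_on (sphere 0 1) (\<lambda>z. norm (deriv f (of_real s * z)) powr p)"
        using p c by (intro continuous_on_powr' continuous_intros) auto
      fix z :: complex assume "norm z = 1"
      then show "norm (deriv f (of_real s * z)) powr p \<le> B powr p"
        using s p by (intro powr_mono2 B) (auto simp: norm_mult)
    qed auto
    moreover have "(1 - s) powr (p - 1) \<le> 1" using s p by (intro powr_le1) auto
    moreover have "0 \<le> circle_mean (\<lambda>z. norm (deriv f (of_real s * z)) powr p)"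
      using p c by (intro circle_mean_nonneg continuous_on_powr' continuous_intros) auto
    ultimately show ?thesis
      unfolding besov_density_def using mult_mono[of "(1 - s) powr (p - 1)" 1] by fastforce
  qed
  then have "besov_integral p f \<le> (\<integral>\<^sup>+s. ennreal (B powr p) * indicator {0..<1} s \<partial>(lborel :: real measure))"
    unfolding besov_integral_eq[OF f1 p]
    by (intro nn_integral_mono) (auto split: split_indicator intro: ennreal_leI)
  also have "\<dots> = ennreal (B powr p)" by (simp add: nn_integral_cmult_indicator)
  also have "\<dots> < \<infinity>" by simp
  finally show ?thesis using f1 by (simp add: besov_space_def)
qed

text \<open>An infimum over the empty set would be an unspecified real number, so an admissible function is
  needed: the normalized product of the factors \<open>z - a\<close>.\<close>

lemma capacity_geI:
  assumes \<sigma>: "set \<sigma> \<subseteq> ball 0 1 - {0}" and p: "1 \<le> p"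
    and le: "\<And>f. f \<in> besov_space p \<Longrightarrow> f 0 = 1 \<Longrightarrow> vanishes_on_seq f \<sigma> \<Longrightarrow> C \<le> besov_norm p f"
  shows "C \<le> capacity (besov_space p) (besov_norm p) \<sigma>"
  unfolding capacity_def
proof (rule cInf_greatest)
  have "vanishes_on_seq (\<lambda>z. (\<Prod>a\<leftarrow>\<sigma>. z - a) * (1 / (\<Prod>a\<leftarrow>\<sigma>. 0 - a))) \<sigma>"
    by (rule vanishes_on_seq_prod[of _ UNIV]) auto
  moreover have "(\<lambda>z. (\<Prod>a\<leftarrow>\<sigma>. z - a)) holomorphic_on UNIV" for \<sigma>
    by (induction \<sigma>) (auto intro!: holomorphic_intros)
  then have "(\<lambda>z. (\<Prod>a\<leftarrow>\<sigma>. z - a) * (1 / (\<Prod>a\<leftarrow>\<sigma>. 0 - a))) \<in> besov_space p"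
    by (intro entire_in_besov_space p holomorphic_on_mult holomorphic_on_const)
  moreover have "(\<Prod>a\<leftarrow>\<sigma>. 0 - a) \<noteq> 0" using \<sigma> by (auto simp: prod_list_zero_iff)
  then have "(\<Prod>a\<leftarrow>\<sigma>. 0 - a) * (1 / (\<Prod>a\<leftarrow>\<sigma>. 0 - a)) = 1" by simp
  ultimately show "besov_norm p ` {f \<in> besov_space p. f 0 = 1 \<and> vanishes_on_seq f \<sigma>} \<noteq> {}" by blast
qed (use le in auto)

text \<open>With \<open>F\<close>, \<open>H\<close>, \<open>\<tau>\<close> and \<open>\<eta>\<close> from a late stage of the Riesz product, take \<open>\<theta> = exp (- 2 F)\<close> and
  \<open>w = G\<^bsup>-\<delta>\<^esup>\<close> for \<open>G = (H + \<eta>) / (2 \<eta>)\<close>, which has a real part of at least \<open>1 / 2\<close>. The Bloch bound for \<open>\<theta>\<close>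
  follows from \<open>(1 - \<bar>z\<bar>) \<bar>F'\<bar> \<le> 4 b Re F\<close>, because \<open>x exp (- x) \<le> 1\<close>. As the logarithm \<open>L\<close> of \<open>G\<close> has a
  bounded imaginary part, \<open>V = exp (\<i> L)\<close> is bounded above and below, and \<open>w' = - \<delta> w L'\<close> is
  dominated by a multiple of \<open>\<delta> \<bar>V'\<bar>\<close>.\<close>

lemma bloch_pair_exists:
  fixes \<epsilon> :: real
  assumes \<epsilon>: "0 < \<epsilon>" "\<epsilon> \<le> 1"
  obtains \<theta> w V :: "complex \<Rightarrow> complex" where
    "\<theta> holomorphic_on UNIV" "\<And>z. norm z \<le> 1 \<Longrightarrow> norm (\<theta> z) < 1" "norm (\<theta> 0) \<le> 1 / 4" "\<theta> 0 \<noteq> 0"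
    "\<And>z. norm z < 1 \<Longrightarrow> (1 - norm z) * norm (deriv \<theta> z) \<le> \<epsilon>"
    "w holomorphic_on ball 0 1" "continuous_on (cball 0 1) w" "w 0 = 1"
    "\<And>z. norm z \<le> 1 \<Longrightarrow> norm (w z) \<le> 2"
    "\<And>z. norm z < 1 \<Longrightarrow> norm (deriv w z) \<le> \<epsilon> * norm (deriv V z)"
    "V holomorphic_on ball 0 1" "\<And>z. norm z < 1 \<Longrightarrow> norm (V z) \<le> exp pi"
    "\<And>z. norm z = 1 \<Longrightarrow> norm (w z) * (1 - (norm (\<theta> z))\<^sup>2) \<le> \<epsilon>"
proof -
  define b where "b = min (\<epsilon> / 4) (1 / 24)"
  have b: "0 < b" "b \<le> 1 / 24" "4 * b \<le> \<epsilon>" using \<epsilon> by (auto simp: b_def)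
  define q where "q = 1 / sqrt (1 + b\<^sup>2 / 2)"
  have q: "0 < q" "q < 1"
  proof -
    have "1 < sqrt (1 + b\<^sup>2 / 2)" using b by simp
    moreover from this have "0 < sqrt (1 + b\<^sup>2 / 2)" by linarith
    ultimately show "0 < q" "q < 1" unfolding q_def by (simp_all only: zero_less_divide_1_iff divide_less_eq_1_pos)
  qed
  \<comment> \<open>The factor \<open>2\<close> pays for \<open>\<bar>w\<bar> \<le> 2\<close>, the factor \<open>exp pi\<close> for the lower bound of \<open>\<bar>V\<bar>\<close>.\<close>
  define \<delta> where "\<delta> = \<epsilon> / (2 * exp pi)"
  have \<delta>: "0 < \<delta>" "\<delta> \<le> 1"
  proof -
    show "0 < \<delta>" using \<epsilon> by (simp add: \<delta>_def)
    have "1 \<le> exp pi" by simp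
    then have "\<epsilon> \<le> 2 * exp pi" using \<epsilon> by linarith
    then show "\<delta> \<le> 1" by (simp add: \<delta>_def divide_le_eq)
  qed
  \<comment> \<open>Where \<open>\<tau> \<le> \<tau>0\<close> the factor \<open>1 - \<bar>\<theta>\<bar>\<^sup>2 \<le> 4 \<tau>\<^sup>2\<close> is small. Elsewhere \<open>w\<close> is, provided that \<open>\<eta>\<close> is so small
    that \<open>(\<tau>0 / (2 \<eta>))\<^sup>\<delta> \<ge> 1 / \<epsilon>\<close>.\<close>
  define \<tau>0 where "\<tau>0 = sqrt (\<epsilon> / 8)"
  have \<tau>0: "0 < \<tau>0" using \<epsilon> by (simp add: \<tau>0_def)
  obtain n where n: "q ^ n < \<tau>0 / (2 * exp (ln (1 / \<epsilon>) / \<delta>))"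
    using real_arch_pow_inv[of "\<tau>0 / (2 * exp (ln (1 / \<epsilon>) / \<delta>))" q] q \<tau>0 by auto
  define \<eta> where "\<eta> = q ^ n"
  have \<eta>: "0 < \<eta>" using q by (simp add: \<eta>_def)
  obtain F H E d \<tau> where st: "riesz_stage (4 * b) \<eta> F H E d \<tau>"
    using riesz_stage_exists[OF b(1,2), of n] unfolding \<eta>_def q_def by blast
  have hol: "F holomorphic_on UNIV" "H holomorphic_on UNIV"
    and at0: "F 0 = 1" "H 0 = of_real \<eta>"
    and circ: "\<And>z. norm z = 1 \<Longrightarrow> 0 < \<tau> z \<and> Re (F z) = (\<tau> z)\<^sup>2 \<and> Re (H z) = \<tau> z"
    and bl: "\<And>z. norm z \<le> 1 \<Longrightarrow> (1 - norm z) * norm (deriv F z) < 4 * b * Re (F z)"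
    using st unfolding riesz_stage_def by auto
  have Fpos: "0 < Re (F z)" if "norm z \<le> 1" for z
  proof -
    have "0 \<le> (1 - norm z) * norm (deriv F z)" using that by simp
    then have "0 < 4 * b * Re (F z)" using bl[OF that] by linarith
    then show ?thesis using b by (simp add: zero_less_mult_iff)
  qed
  have Hpos: "0 \<le> Re (H z)" if "norm z \<le> 1" for z
  proof -
    have "norm (exp (- H z)) \<le> 1"
    proof (rule maximum_modulus_frontier[of "\<lambda>z. exp (- H z)" "cball 0 1"])
      show "(\<lambda>z. exp (- H z)) holomorphic_on interior (cball 0 1)"
        using hol(2) by (intro holomorphic_intros) (auto intro: holomorphic_on_subset)
      show "continuous_on (closure (cball 0 1)) (\<lambda>z. exp (- H z))"
        by (intro continuous_intros continuous_on_subset[OF holomorphic_on_imp_continuous_on[OF hol(2)]]) auto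
      fix z :: complex assume "z \<in> frontier (cball 0 1)"
      then have "norm z = 1" by simp
      from circ[OF this] show "norm (exp (- H z)) \<le> 1" by simp
    qed (use that in auto)
    then show ?thesis by simp
  qed
  define G where "G = (\<lambda>z. (H z + of_real \<eta>) / of_real (2 * \<eta>))"
  have ReG: "Re (G z) = (Re (H z) + \<eta>) / (2 * \<eta>)" for z unfolding G_def by (subst Re_divide_of_real) simp
  have G2: "1 / 2 \<le> Re (G z)" if "norm z \<le> 1" for z
    unfolding ReG using Hpos[OF that] \<eta> by (simp add: field_simps)
  have Gn: "G z \<notin> \<real>\<^sub>\<le>\<^sub>0" if "norm z \<le> 1" for z
    using G2[OF that] by (auto simp: complex_nonpos_Reals_iff)
  have G0: "G 0 = 1" using \<eta> by (simp add: G_def at0)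
  have Gh: "G holomorphic_on UNIV" unfolding G_def using hol \<eta> by (intro holomorphic_intros) auto
  define L where "L = (\<lambda>z. Ln (G z))"
  have Lh: "L holomorphic_on ball 0 1"
    unfolding L_def using Gn by (intro holomorphic_intros holomorphic_on_subset[OF Gh]) auto
  have Lc: "continuous_on (cball 0 1) L"
    unfolding L_def using Gn
    by (intro continuous_intros continuous_on_subset[OF holomorphic_on_imp_continuous_on[OF Gh]]) auto
  have G_nz: "G z \<noteq> 0" if "norm z \<le> 1" for z using G2[OF that] by auto
  have ReL: "Re (L z) = ln (norm (G z))" if "norm z \<le> 1" for z
    unfolding L_def using G_nz[OF that] by (simp add: Re_Ln)
  have ImL: "\<bar>Im (L z)\<bar> \<le> pi" if "norm z \<le> 1" for z
    unfolding L_def using mpi_less_Im_Ln[OF G_nz[OF that]] Im_Ln_le_pi[OF G_nz[OF that]] by simp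
  define \<theta> where "\<theta> = (\<lambda>z. exp (- 2 * F z))"
  define w where "w = (\<lambda>z. exp (- of_real \<delta> * L z))"
  define V where "V = (\<lambda>z. exp (\<i> * L z))"
  have norm\<theta>: "norm (\<theta> z) = exp (- 2 * Re (F z))" for z by (simp add: \<theta>_def)
  have normw: "norm (w z) = exp (- \<delta> * ln (norm (G z)))" if "norm z \<le> 1" for z
    using ReL[OF that] by (simp add: w_def)
  have e2: "exp (-2 :: real) \<le> 1 / 4"
  proof -
    have "2 \<le> exp (1::real)" using exp_ge_add_one_self[of 1] by simp
    then have "2 * 2 \<le> exp (1::real) * exp 1" by (intro mult_mono) auto
    also have "\<dots> = exp 2" by (simp add: exp_add[symmetric])
    finally have "4 \<le> exp (2::real)" by simp
    then show ?thesis by (simp add: exp_minus field_simps)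
  qed
  show thesis
  proof (rule that[of \<theta> w V])
    show "\<theta> holomorphic_on UNIV" unfolding \<theta>_def by (intro holomorphic_intros hol)
    show "norm (\<theta> z) < 1" if "norm z \<le> 1" for z using Fpos[OF that] by (simp add: norm\<theta>)
    show "norm (\<theta> 0) \<le> 1 / 4" using e2 by (simp add: norm\<theta> at0)
    show "\<theta> 0 \<noteq> 0" by (simp add: \<theta>_def)
    show "(1 - norm z) * norm (deriv \<theta> z) \<le> \<epsilon>" if z: "norm z < 1" for z
    proof -
      have dF: "(F has_field_derivative deriv F z) (at z)" using hol(1) by (auto intro: holomorphic_derivI)
      have "(\<theta> has_field_derivative (\<theta> z * (- 2 * deriv F z))) (at z)"
        unfolding \<theta>_def by (auto intro!: derivative_eq_intros dF)
      then have "deriv \<theta> z = \<theta> z * (- 2 * deriv F z)" by (rule DERIV_imp_deriv)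
      then have "(1 - norm z) * norm (deriv \<theta> z) = 2 * exp (- 2 * Re (F z)) * ((1 - norm z) * norm (deriv F z))"
        by (simp add: norm_mult norm\<theta>)
      also have "\<dots> \<le> 2 * exp (- 2 * Re (F z)) * (4 * b * Re (F z))"
        using bl[of z] z by (intro mult_left_mono) auto
      also have "\<dots> = 4 * b * ((2 * Re (F z)) * exp (- (2 * Re (F z))))" by simp
      also have "\<dots> \<le> 4 * b * 1"
      proof (intro mult_left_mono)
        have "2 * Re (F z) \<le> exp (2 * Re (F z))" using exp_ge_add_one_self[of "2 * Re (F z)"] by linarith
        then show "2 * Re (F z) * exp (- (2 * Re (F z))) \<le> 1" by (simp add: exp_minus field_simps)
      qed (use b in auto)
      finally show ?thesis using b by simp
    qed
    show "w holomorphic_on ball 0 1" unfolding w_def by (intro holomorphic_intros Lh)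
    show "continuous_on (cball 0 1) w" unfolding w_def by (intro continuous_intros Lc)
    show "w 0 = 1" by (simp add: w_def L_def G0)
    show "norm (w z) \<le> 2" if "norm z \<le> 1" for z
    proof -
      have "1 / 2 \<le> norm (G z)" using G2[OF that] complex_Re_le_cmod[of "G z"] by linarith
      then have "ln (1 / 2) \<le> ln (norm (G z))" by (subst ln_le_cancel_iff) auto
      then have "\<delta> * ln (1 / 2) \<le> \<delta> * ln (norm (G z))" using \<delta> by (intro mult_left_mono) auto
      then have "- \<delta> * ln (norm (G z)) \<le> \<delta> * ln 2" by (simp add: ln_div)
      also have "\<dots> \<le> 1 * ln 2" using \<delta> by (intro mult_right_mono) auto
      finally have "- \<delta> * ln (norm (G z)) \<le> ln 2" by simp
      then have "exp (- \<delta> * ln (norm (G z))) \<le> exp (ln 2)" by (simp only: exp_le_cancel_iff)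
      then show ?thesis unfolding normw[OF that] by simp
    qed
    show "V holomorphic_on ball 0 1" unfolding V_def by (intro holomorphic_intros Lh)
    have normV: "norm (V z) = exp (- Im (L z))" for z by (simp add: V_def)
    show "norm (V z) \<le> exp pi" if "norm z < 1" for z
      using ImL[of z] that by (simp add: normV)
    show "norm (deriv w z) \<le> \<epsilon> * norm (deriv V z)" if z: "norm z < 1" for z
    proof -
      have dL: "(L has_field_derivative deriv L z) (at z)"
        using z by (intro holomorphic_derivI[OF Lh]) auto
      have "(w has_field_derivative (w z * (- of_real \<delta> * deriv L z))) (at z)"
        unfolding w_def by (auto intro!: derivative_eq_intros dL)
      then have dw: "deriv w z = w z * (- of_real \<delta> * deriv L z)" by (rule DERIV_imp_deriv)
      have "(V has_field_derivative (V z * (\<i> * deriv L z))) (at z)"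
        unfolding V_def by (auto intro!: derivative_eq_intros dL)
      then have dV: "deriv V z = V z * (\<i> * deriv L z)" by (rule DERIV_imp_deriv)
      have w2: "norm (w z) \<le> 2" by (rule \<open>\<And>z. norm z \<le> 1 \<Longrightarrow> norm (w z) \<le> 2\<close>) (use z in simp)
      have "exp (- pi) \<le> norm (V z)" using ImL[of z] z by (simp add: normV)
      then have "exp (- pi) * norm (deriv L z) \<le> norm (deriv V z)"
        unfolding dV norm_mult by (simp add: mult_right_mono)
      then have "exp pi * (exp (- pi) * norm (deriv L z)) \<le> exp pi * norm (deriv V z)"
        by (intro mult_left_mono) auto
      then have L_le: "norm (deriv L z) \<le> exp pi * norm (deriv V z)"
        by (simp add: mult.assoc[symmetric] exp_add[symmetric])
      have "norm (deriv w z) = norm (w z) * (\<delta> * norm (deriv L z))"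
        unfolding dw norm_mult using \<delta> by simp
      also have "\<dots> \<le> 2 * (\<delta> * (exp pi * norm (deriv V z)))"
        using w2 L_le \<delta> by (intro mult_mono mult_left_mono) auto
      also have "\<dots> = \<epsilon> * norm (deriv V z)" by (simp add: \<delta>_def)
      finally show ?thesis .
    qed
    show "norm (w z) * (1 - (norm (\<theta> z))\<^sup>2) \<le> \<epsilon>" if z: "norm z = 1" for z
    proof -
      have z1: "norm z \<le> 1" using z by simp
      have t: "0 < \<tau> z" "Re (F z) = (\<tau> z)\<^sup>2" "Re (H z) = \<tau> z" using circ[OF z] by auto
      have "(norm (\<theta> z))\<^sup>2 = exp (- 4 * (\<tau> z)\<^sup>2)"
        by (simp add: norm\<theta> t power2_eq_square exp_add[symmetric])
      then have \<theta>2: "1 - (norm (\<theta> z))\<^sup>2 \<le> 4 * (\<tau> z)\<^sup>2" "1 - (norm (\<theta> z))\<^sup>2 \<le> 1" "0 \<le> 1 - (norm (\<theta> z))\<^sup>2"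
        using exp_ge_add_one_self[of "- 4 * (\<tau> z)\<^sup>2"] by auto
      have w2: "norm (w z) \<le> 2" by (rule \<open>\<And>z. norm z \<le> 1 \<Longrightarrow> norm (w z) \<le> 2\<close>) (use z in simp)
      show ?thesis
      proof (cases "\<tau> z \<le> \<tau>0")
        case True
        have "(\<tau> z)\<^sup>2 \<le> \<tau>0\<^sup>2" using True t by (intro power_mono) auto
        also have "\<tau>0\<^sup>2 = \<epsilon> / 8" using \<epsilon> by (simp add: \<tau>0_def)
        finally have "4 * (\<tau> z)\<^sup>2 \<le> \<epsilon> / 2" by simp
        then have "norm (w z) * (1 - (norm (\<theta> z))\<^sup>2) \<le> 2 * (\<epsilon> / 2)"
          using w2 \<theta>2 by (intro mult_mono) auto
        then show ?thesis by simp
      next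
        case False
        let ?X = "exp (ln (1 / \<epsilon>) / \<delta>)"
        have "\<eta> * (2 * ?X) < \<tau>0" using n unfolding \<eta>_def by (simp add: pos_less_divide_eq)
        then have "?X \<le> \<tau>0 / (2 * \<eta>)" using \<eta> by (simp add: field_simps)
        also have "\<dots> \<le> Re (G z)" unfolding ReG t(3) using False \<eta> by (intro divide_right_mono) auto
        also have "\<dots> \<le> norm (G z)" by (rule complex_Re_le_cmod)
        finally have "ln ?X \<le> ln (norm (G z))" by (subst ln_le_cancel_iff) (auto intro: less_le_trans[OF exp_gt_zero])
        then have "\<delta> * (ln (1 / \<epsilon>) / \<delta>) \<le> \<delta> * ln (norm (G z))" using \<delta> by (intro mult_left_mono) auto
        then have "- \<delta> * ln (norm (G z)) \<le> ln \<epsilon>" using \<delta> \<epsilon> by (simp add: ln_div)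
        then have "norm (w z) \<le> exp (ln \<epsilon>)" unfolding normw[OF z1] by simp
        then have "norm (w z) \<le> \<epsilon>" using \<epsilon> by simp
        then have "norm (w z) * (1 - (norm (\<theta> z))\<^sup>2) \<le> \<epsilon> * 1"
          using \<theta>2 \<epsilon> by (intro mult_mono) auto
        then show ?thesis by simp
      qed
    qed
  qed
qed

text \<open>Pair \<open>f\<close> with a continuous substitute \<open>u\<close> for its sign; for this, the trivial Bloch bound
  \<open>\<beta> = 1\<close> is good enough.\<close>

lemma besov_mean_bound:
  assumes f: "f holomorphic_on ball 0 1" "besov_integral p f < \<infinity>" and r: "0 < r" "r < 1"
    and t: "0 \<le> t" and p: "1 \<le> p" "p < 2"
  shows "t * circle_mean (\<lambda>z. norm (f (of_real r * z)))
     \<le> t + t * norm (f 0) + 1 + 4 * t powr p * enn2real (besov_integral p f)"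
proof -
  define h where "h = (\<lambda>z. f (of_real r * z))"
  define u where "u = (\<lambda>z. h z / of_real (norm (h z) + 1))"
  define v where "v = (\<lambda>z. (norm (h z))\<^sup>2 / (norm (h z) + 1))"
  have ch: "continuous_on (sphere 0 1) h"
    unfolding h_def
    by (rule continuous_on_dilated_circle[OF holomorphic_on_imp_continuous_on[OF f(1)]]) (use r in auto)
  have pos: "0 < norm (h z) + 1" for z using norm_ge_zero[of "h z"] by linarith
  then have ne: "norm (h z) + 1 \<noteq> 0" for z using less_imp_neq by metis
  have cu: "continuous_on (sphere 0 1) u" and cv: "continuous_on (sphere 0 1) v"
    unfolding u_def v_def by (intro continuous_intros ch; simp only: of_real_eq_0_iff ne; simp)+
  have u1: "norm (u z) \<le> 1" for z
    unfolding u_def norm_divide norm_of_real using pos[of z] by (simp add: divide_le_eq)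
  have "t * norm (circle_mean (\<lambda>z. h z * cnj (u z)))
      \<le> t * norm (f 0) * 1 + 1 * 1\<^sup>2 + 4 * 1 powr (1 - p) * 1 powr (2 - p) * t powr p * enn2real (besov_integral p f)"
    unfolding h_def
    by (rule besov_pairing[OF f cu u1 norm_cauchy_transform_deriv_le[OF cu u1] r _ t p]) auto
  also have "\<dots> = t * norm (f 0) + 1 + 4 * t powr p * enn2real (besov_integral p f)" by simp
  also have "circle_mean (\<lambda>z. h z * cnj (u z)) = circle_mean (\<lambda>z. complex_of_real (v z))"
  proof (rule circle_mean_cong)
    fix z
    have "h z * cnj (u z) = h z * cnj (h z) / of_real (norm (h z) + 1)" by (simp add: u_def)
    then show "h z * cnj (u z) = complex_of_real (v z)"
      by (simp only: v_def complex_norm_square[symmetric] of_real_divide)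
  qed
  also have "\<dots> = of_real (circle_mean v)" by (rule circle_mean_of_real[OF cv])
  finally have A: "t * \<bar>circle_mean v\<bar> \<le> t * norm (f 0) + 1 + 4 * t powr p * enn2real (besov_integral p f)"
    unfolding norm_of_real .
  have "circle_mean (\<lambda>z. norm (h z)) \<le> circle_mean (\<lambda>z. v z + 1)"
  proof (rule circle_mean_mono)
    show "norm (h z) \<le> v z + 1" for z
      using pos[of z] by (simp add: v_def field_simps power2_eq_square)
  qed (intro continuous_intros ch cv)+
  also have "\<dots> = circle_mean v + 1" by (simp add: circle_mean_add cv)
  finally have "circle_mean (\<lambda>z. norm (h z)) \<le> \<bar>circle_mean v\<bar> + 1" by linarith
  from mult_left_mono[OF this t] A show ?thesis by (simp add: distrib_left h_def)
qed

text \<open>The \<open>\<kappa>\<close>-terms are those of \<open>besov_pairing\<close> for a function \<open>u\<close> bounded by \<open>2\<close> whose projection has the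
  Bloch bound of \<open>bloch_bound_product\<close> with \<open>\<delta> = \<epsilon>\<close> and \<open>C = exp pi\<close>. The last term bounds the mean
  of a function of modulus at most \<open>6 \<epsilon> \<bar>g\<bar>\<close>, where \<open>g\<close> is the quotient of \<open>f\<close> by the Blaschke product.\<close>

definition extremal_error :: "real \<Rightarrow> real \<Rightarrow> real \<Rightarrow> real \<Rightarrow> real" where
  "extremal_error \<epsilon> \<kappa> p X = 2 * \<epsilon> + 4 * \<kappa>
     + 4 * \<kappa> powr (1 - p) * ((18 + 2 * (exp pi)\<^sup>2) * \<epsilon>) powr (2 - p) * X + 12 * \<epsilon> * (3 + 4 * X)"

lemma extremal_error_mono:
  assumes "0 \<le> \<epsilon>" "X \<le> Y"
  shows "extremal_error \<epsilon> \<kappa> p X \<le> extremal_error \<epsilon> \<kappa> p Y"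
  unfolding extremal_error_def using assms by (intro add_mono mult_left_mono order_refl) auto

lemma extremal_error_tendsto:
  assumes "p < 2" and pos: "\<And>j. 0 \<le> \<epsilon> j" and lim: "\<epsilon> \<longlonglongrightarrow> 0"
  shows "(\<lambda>j. extremal_error (\<epsilon> j) \<kappa> p X) \<longlonglongrightarrow> 4 * \<kappa>"
proof -
  have "(\<lambda>j. ((18 + 2 * (exp pi)\<^sup>2) * \<epsilon> j) powr (2 - p)) \<longlonglongrightarrow> 0"
  proof (rule tendsto_zero_powrI)
    show "(\<lambda>j. (18 + 2 * (exp pi)\<^sup>2) * \<epsilon> j) \<longlonglongrightarrow> 0" using tendsto_mult_right_zero[OF lim] by simp
    show "eventually (\<lambda>j. 0 \<le> (18 + 2 * (exp pi)\<^sup>2) * \<epsilon> j) sequentially"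
      using pos by (intro always_eventually allI mult_nonneg_nonneg) (auto intro: add_nonneg_nonneg)
  qed (use assms(1) in auto)
  then have "(\<lambda>j. extremal_error (\<epsilon> j) \<kappa> p X) \<longlonglongrightarrow>
      2 * 0 + 4 * \<kappa> + 4 * \<kappa> powr (1 - p) * 0 * X + 12 * 0 * (3 + 4 * X)"
    unfolding extremal_error_def by (intro tendsto_intros lim)
  then show ?thesis by simp
qed

text \<open>The last argument of \<open>extremal_error\<close> is the Besov integral of the multiple of \<open>f\<close> whose quotient by the
  Blaschke product has modulus \<open>1\<close> at the origin. As long as this integral stays bounded, the error
  tends to \<open>4 \<kappa>\<close> with \<open>\<epsilon>\<close>, and the inequality fails for \<open>\<kappa> < 1 / 8\<close>.\<close>

definition extremal_bound :: "real \<Rightarrow> complex list \<Rightarrow> bool" where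
  "extremal_bound \<epsilon> \<sigma> \<longleftrightarrow> (\<forall>p f \<kappa>. 1 \<le> p \<longrightarrow> p < 2 \<longrightarrow> 0 < \<kappa> \<longrightarrow> f \<in> besov_space p \<longrightarrow> f 0 = 1 \<longrightarrow>
     vanishes_on_seq f \<sigma> \<longrightarrow>
     1 \<le> 1 / 2 + extremal_error \<epsilon> \<kappa> p ((\<Prod>z\<leftarrow>\<sigma>. norm z) powr p * enn2real (besov_integral p f)))"

text \<open>On a suitable circle \<open>\<bar>z\<bar> = r\<close> the function \<open>\<bar>w\<bar> (1 - \<bar>\<theta>\<bar>\<^sup>2)\<close> is still at most \<open>2 \<epsilon>\<close>, and for large
  \<open>N\<close> the Blaschke product \<open>A / Q\<close> with \<open>A = z\<^sup>N + P\<close> differs from \<open>\<theta>\<close> by at most \<open>2 \<epsilon>\<close> there. For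
  \<open>f = (A / Q) g\<close> this gives \<open>g w = f cnj u + g y\<close> with \<open>u = \<theta> cnj w\<close> and \<open>\<bar>y\<bar> \<le> 6 \<epsilon>\<close>. The mean of the
  left-hand side is \<open>g 0\<close>, the pairing with \<open>u\<close> is estimated by \<open>besov_pairing\<close>, and the mean of \<open>\<bar>g\<bar>\<close>
  is compared with that of \<open>\<bar>f\<bar>\<close> on a circle so close to the boundary that \<open>\<bar>Q\<bar> \<le> 2 \<bar>A\<bar>\<close>. The term
  \<open>1 / 2 + 2 \<epsilon>\<close> comes from \<open>f 0\<close>: the product of the \<open>\<bar>\<lambda>\<bar>\<close> is \<open>\<bar>P 0\<bar>\<close>, which is close to \<open>\<bar>\<theta> 0\<bar> \<le> 1 / 4\<close>.\<close>

lemma extremal_bound_exists: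
  fixes \<epsilon> :: real
  assumes \<epsilon>: "0 < \<epsilon>" "\<epsilon> \<le> 1 / 2"
  shows "\<exists>N0. \<forall>N\<ge>N0. \<exists>\<sigma>. length \<sigma> = N \<and> set \<sigma> \<subseteq> ball 0 1 - {0} \<and> extremal_bound \<epsilon> \<sigma>"
proof -
  have \<epsilon>1: "\<epsilon> \<le> 1" using \<epsilon> by simp
  obtain \<theta> w V :: "complex \<Rightarrow> complex" where
    \<theta>: "\<theta> holomorphic_on UNIV" "\<And>z. norm z \<le> 1 \<Longrightarrow> norm (\<theta> z) < 1" "norm (\<theta> 0) \<le> 1 / 4" "\<theta> 0 \<noteq> 0"
      "\<And>z. norm z < 1 \<Longrightarrow> (1 - norm z) * norm (deriv \<theta> z) \<le> \<epsilon>"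
    and w: "w holomorphic_on ball 0 1" "continuous_on (cball 0 1) w" "w 0 = 1"
      "\<And>z. norm z \<le> 1 \<Longrightarrow> norm (w z) \<le> 2"
      "\<And>z. norm z < 1 \<Longrightarrow> norm (deriv w z) \<le> \<epsilon> * norm (deriv V z)"
    and V: "V holomorphic_on ball 0 1" "\<And>z. norm z < 1 \<Longrightarrow> norm (V z) \<le> exp pi"
    and w\<theta>: "\<And>z. norm z = 1 \<Longrightarrow> norm (w z) * (1 - (norm (\<theta> z))\<^sup>2) \<le> \<epsilon>"
    by (rule bloch_pair_exists[OF \<epsilon>(1) \<epsilon>1]) blast
  have \<theta>c: "continuous_on S \<theta>" for S
    using \<theta>(1) by (intro continuous_on_subset[OF holomorphic_on_imp_continuous_on, of _ UNIV]) auto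
  have \<theta>b: "\<theta> holomorphic_on ball 0 1" using \<theta>(1) by (rule holomorphic_on_subset) auto
  obtain \<rho>1 where \<rho>1: "0 \<le> \<rho>1" "\<rho>1 < 1"
    "\<And>z. \<rho>1 < norm z \<Longrightarrow> norm z \<le> 1 \<Longrightarrow> 0 < 2 * \<epsilon> - norm (w z) * (1 - (norm (\<theta> z))\<^sup>2)"
  proof (rule positive_near_circle[of "\<lambda>z. 2 * \<epsilon> - norm (w z) * (1 - (norm (\<theta> z))\<^sup>2)"])
    show "continuous_on (cball 0 1) (\<lambda>z. 2 * \<epsilon> - norm (w z) * (1 - (norm (\<theta> z))\<^sup>2))"
      by (intro continuous_intros w \<theta>c)
    show "0 < 2 * \<epsilon> - norm (w z) * (1 - (norm (\<theta> z))\<^sup>2)" if "norm z = 1" for z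
      using w\<theta>[OF that] \<epsilon> by simp
  qed blast
  define r where "r = (1 + \<rho>1) / 2"
  have r: "0 < r" "r < 1" "\<rho>1 < r" using \<rho>1 by (auto simp: r_def)
  obtain z1 :: complex where z1: "norm z1 = 1" "\<And>z. norm z = 1 \<Longrightarrow> norm (\<theta> z) \<le> norm (\<theta> z1)"
    using continuous_attains_sup[of "sphere (0::complex) 1" "\<lambda>z. norm (\<theta> z)"] \<theta>c
    by (auto simp: continuous_intros Ball_def)
  \<comment> \<open>This precision keeps \<open>\<bar>P\<bar> < 1\<close> on the circle and \<open>P 0 \<noteq> 0\<close>, so that no zero is at the origin.\<close>
  define e where "e = min \<epsilon> (min (1 - norm (\<theta> z1)) (norm (\<theta> 0)))"
  have e: "0 < e" "e \<le> \<epsilon>" "e \<le> 1 - norm (\<theta> z1)" "e \<le> norm (\<theta> 0)"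
    using \<epsilon> \<theta>(2)[of z1] z1(1) \<theta>(4) by (auto simp: e_def)
  obtain P :: "complex poly" where P: "\<And>z. norm z \<le> 1 \<Longrightarrow> norm (poly P z - \<theta> z) < e"
    using entire_polynomial_approximation[OF \<theta>(1) e(1)] by blast
  have P1: "norm (poly P z) < 1" if "norm z = 1" for z
    using P[of z] z1(2)[OF that] e(3) norm_triangle_sub[of "poly P z" "\<theta> z"] that by simp
  have P0: "poly P 0 \<noteq> 0" using P[of 0] e(4) by auto
  define S where "S = (\<Sum>k\<le>degree P. norm (coeff P k))"
  have S: "0 \<le> S" by (simp add: S_def sum_nonneg)
  obtain K where K: "r ^ K < \<epsilon> / (2 * (1 + S))"
    using real_arch_pow_inv[of "\<epsilon> / (2 * (1 + S))" r] \<epsilon> S r by auto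
  show ?thesis
  proof (intro exI[of _ "K + degree P + 1"] allI impI)
    fix N assume N: "K + degree P + 1 \<le> N"
    define q where "q = (\<lambda>z. \<Sum>k\<le>degree P. cnj (coeff P k) * z ^ (N - k))"
    have "degree P < N" using N by simp
    from blaschke_type_factorization[OF this P1 P0] obtain \<sigma> where
      \<sigma>: "length \<sigma> = N" "set \<sigma> \<subseteq> ball 0 1 - {0}"
        "\<And>z. z ^ N + poly P z = (\<Prod>a\<leftarrow>\<sigma>. z - a)"
        "\<And>z. norm z \<le> 1 \<Longrightarrow> norm (q z) < 1"
        "\<And>z. norm z = 1 \<Longrightarrow> z ^ N + poly P z = z ^ N * cnj (1 + q z)"
      unfolding q_def by blast
    define A where "A = (\<lambda>z. z ^ N + poly P z)"
    define Q where "Q = (\<lambda>z. 1 + q z)"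
    define t where "t = (\<Prod>z\<leftarrow>\<sigma>. norm z)"
    have Ah: "A holomorphic_on UNIV" and Qh: "Q holomorphic_on UNIV"
      unfolding A_def Q_def q_def by (intro holomorphic_intros)+
    have Ac: "continuous_on X A" "continuous_on X Q" for X
      using Ah Qh by (auto intro!: continuous_on_subset[OF holomorphic_on_imp_continuous_on, of _ UNIV])
    have Qnz: "Q z \<noteq> 0" if "norm z \<le> 1" for z
      using \<sigma>(4)[OF that] unfolding Q_def by (metis add.right_neutral add_eq_0_iff norm_minus_cancel norm_one order_less_irrefl)
    have N0: "N > 0" using N by simp
    have tA: "t = norm (A 0)"
    proof -
      have "norm (\<Prod>a\<leftarrow>\<sigma>. 0 - a) = (\<Prod>a\<leftarrow>\<sigma>. norm a)" by (induction \<sigma>) (auto simp: norm_mult)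
      then show ?thesis using \<sigma>(3)[of 0] by (simp add: t_def A_def)
    qed
    have A0: "A 0 = poly P 0" using N0 by (simp add: A_def zero_power)
    have t0: "0 < t" using P0 A0 tA by simp
    have t1: "t \<le> 1 / 4 + \<epsilon>"
      using P[of 0] e(2) \<theta>(3) norm_triangle_sub[of "poly P 0" "\<theta> 0"] unfolding tA A0 by simp
    have Q0: "Q 0 = 1"
    proof -
      have "q 0 = (\<Sum>k\<le>degree P. 0)" unfolding q_def using N by (intro sum.cong) auto
      then show ?thesis by (simp add: Q_def)
    qed
    have near: "norm (A z / Q z - poly P z) \<le> \<epsilon>" if z: "norm z = r" for z
    proof -
      define x where "x = r ^ K"
      have "0 < 2 * (1 + S)" using S by simp
      then have "x * (2 * (1 + S)) < \<epsilon>" using K unfolding x_def by (simp only: pos_less_divide_eq)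
      moreover have "x * (2 * (1 + S)) = 2 * (x * (1 + S))" by simp
      ultimately have x: "0 \<le> x" "x * (1 + S) \<le> \<epsilon> / 2" using r by (simp add: x_def, linarith)
      have xm: "r ^ j \<le> x" if "K \<le> j" for j unfolding x_def using r that by (intro power_decreasing) auto
      have "norm (q z) \<le> (\<Sum>k\<le>degree P. norm (coeff P k) * x)"
        unfolding q_def
      proof (intro order_trans[OF norm_sum] sum_mono)
        fix k assume "k \<in> {..degree P}"
        then have "r ^ (N - k) \<le> x" using N by (intro xm) auto
        then show "norm (cnj (coeff P k) * z ^ (N - k)) \<le> norm (coeff P k) * x"
          unfolding norm_mult norm_power z complex_mod_cnj by (rule mult_left_mono) simp
      qed
      then have q: "norm (q z) \<le> S * x" by (simp add: S_def sum_distrib_right)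
      have "S * x \<le> x * (1 + S)" using x(1) by (simp add: algebra_simps)
      then have q2: "norm (q z) \<le> 1 / 2" using q x(2) \<epsilon> by linarith
      have z1: "norm z \<le> 1" using z r by simp
      have "norm (poly P z) \<le> 1"
        using P[OF z1] \<theta>(2)[OF z1] 
        by (rule_tac maximum_modulus_frontier[of "poly P" "cball 0 1"])
          (use P1 z1 in \<open>auto intro!: holomorphic_intros continuous_intros less_imp_le\<close>)
      have "A z / Q z - poly P z = (z ^ N - poly P z * q z) / Q z"
        using Qnz[OF z1] by (simp add: A_def Q_def field_simps)
      also have "norm \<dots> \<le> (x * (1 + S)) / (1 / 2)"
        unfolding norm_divide
      proof (rule frac_le)
        have "norm (z ^ N - poly P z * q z) \<le> norm (z ^ N) + norm (poly P z) * norm (q z)"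
          by (metis norm_triangle_ineq4 norm_mult)
        also have "\<dots> \<le> x + 1 * (S * x)"
        proof (intro add_mono mult_mono)
          show "norm (z ^ N) \<le> x" unfolding norm_power z using N by (intro xm) simp
        qed (use q \<open>norm (poly P z) \<le> 1\<close> in auto)
        finally show "norm (z ^ N - poly P z * q z) \<le> x * (1 + S)" by (simp add: algebra_simps)
        show "1 / 2 \<le> norm (Q z)"
          using q2 norm_triangle_ineq2[of 1 "- q z"] by (simp add: Q_def)
      qed (use x S in auto)
      finally show ?thesis using x by simp
    qed
    have AQ: "norm (A z) = norm (Q z)" if "norm z = 1" for z
      using \<sigma>(5)[OF that] that unfolding A_def Q_def by (metis complex_mod_cnj mult_1 norm_mult norm_power power_one)
    obtain \<rho>2 where \<rho>2: "0 \<le> \<rho>2" "\<rho>2 < 1"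
      "\<And>z. \<rho>2 < norm z \<Longrightarrow> norm z \<le> 1 \<Longrightarrow> 0 < 2 * norm (A z) - norm (Q z)"
    proof (rule positive_near_circle[of "\<lambda>z. 2 * norm (A z) - norm (Q z)"])
      show "continuous_on (cball 0 1) (\<lambda>z. 2 * norm (A z) - norm (Q z))" by (intro continuous_intros Ac)
      show "0 < 2 * norm (A z) - norm (Q z)" if "norm z = 1" for z
        using AQ[OF that] Qnz[of z] that by simp
    qed blast
    define R where "R = (1 + max r \<rho>2) / 2"
    have R: "r < R" "\<rho>2 < R" "R < 1" "0 < R" using r \<rho>2 by (auto simp: R_def)
    define u where "u = (\<lambda>z. \<theta> (of_real r * z) * cnj (w (of_real r * z)))"
    have dil: "continuous_on (sphere 0 1) (\<lambda>z. h (of_real s * z))"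
      if "continuous_on (ball 0 1) h" "0 < s" "s < 1" for h :: "complex \<Rightarrow> complex" and s
      by (rule continuous_on_dilated_circle[OF that(1)]) (use that in auto)
    have cw: "continuous_on (sphere 0 1) (\<lambda>z. w (of_real r * z))"
      and c\<theta>: "continuous_on (sphere 0 1) (\<lambda>z. \<theta> (of_real r * z))"
      using r by (intro dil holomorphic_on_imp_continuous_on w \<theta>b; simp)+
    have cu: "continuous_on (sphere 0 1) u" unfolding u_def by (intro continuous_intros cw c\<theta>)
    have nr: "norm (of_real r * z) = r" if "norm z = 1" for z :: complex using that r by (simp add: norm_mult)
    have u2: "norm (u z) \<le> 2" if "norm z = 1" for z
    proof -
      have "norm (\<theta> (of_real r * z)) * norm (w (of_real r * z)) \<le> 1 * 2"
        using \<theta>(2)[of "of_real r * z"] w(4)[of "of_real r * z"] nr[OF that] r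
        by (intro mult_mono) auto
      then show ?thesis by (simp add: u_def norm_mult)
    qed
    have \<beta>: "(1 - norm z) * norm (cauchy_transform_deriv u z) \<le> (18 + 2 * (exp pi)\<^sup>2) * \<epsilon>" if "norm z < 1" for z
    proof -
      have "(1 - norm z) * norm (cauchy_transform_deriv u z) \<le> 16 * \<epsilon> + 2 * \<epsilon> * ((exp pi)\<^sup>2 + 1)"
        unfolding u_def
        by (rule bloch_bound_product[OF \<theta>b _ \<theta>(5) w(1) _ w(5) V(1,2) r(1,2) that])
          (use \<theta>(2) w(4) \<epsilon> in \<open>auto intro: less_imp_le\<close>)
      then show ?thesis by (simp add: algebra_simps)
    qed
    have "extremal_bound \<epsilon> \<sigma>"
      unfolding extremal_bound_def
    proof (intro allI impI)
      fix p f \<kappa>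
      assume p: "1 \<le> p" "p < 2" and \<kappa>: "0 < (\<kappa>::real)" and f: "f \<in> besov_space p" "f 0 = 1" and van: "vanishes_on_seq f \<sigma>"
      have fh: "f holomorphic_on ball 0 1" "besov_integral p f < \<infinity>" using f by (auto simp: besov_space_def)
      define I where "I = t powr p * enn2real (besov_integral p f)"
      obtain k where k: "k holomorphic_on ball 0 1" "\<And>z. z \<in> ball 0 1 \<Longrightarrow> f z = (\<Prod>a\<leftarrow>\<sigma>. z - a) * k z"
        by (rule vanishes_on_seq_factor[OF fh(1) _ _ van]) (use \<sigma>(2) in auto)
      have fk: "f z = A z * k z" if "norm z < 1" for z
        using k(2)[of z] that unfolding A_def \<sigma>(3) by simp
      define g where "g = (\<lambda>z. Q z * k z)"
      have g: "g holomorphic_on ball 0 1"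
        unfolding g_def by (intro holomorphic_on_mult k holomorphic_on_subset[OF Qh]) auto
      have tg: "t * norm (g 0) = 1"
        using fk[of 0] f(2) unfolding g_def Q0 tA by (metis mult_1 norm_mult norm_one norm_zero zero_less_one)
      have cg: "continuous_on (sphere 0 1) (\<lambda>z. g (of_real r * z))"
        and cf: "continuous_on (sphere 0 1) (\<lambda>z. f (of_real r * z))"
        using r by (intro dil holomorphic_on_imp_continuous_on g fh; simp)+
      have meanf: "t * circle_mean (\<lambda>z. norm (f (of_real R * z))) \<le> 3 + 4 * I"
      proof -
        have "t * circle_mean (\<lambda>z. norm (f (of_real R * z))) \<le> t + t * norm (f 0) + 1 + 4 * t powr p * enn2real (besov_integral p f)"
          using besov_mean_bound[OF fh R(4,3) _ p] t0 by simp
        then show ?thesis using t1 \<epsilon> f(2) by (simp add: I_def)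
      qed
      have meang: "t * circle_mean (\<lambda>z. norm (g (of_real r * z))) \<le> 2 * (3 + 4 * I)"
      proof -
        have "circle_mean (\<lambda>z. norm (g (of_real r * z))) \<le> circle_mean (\<lambda>z. norm (g (of_real R * z)))"
          using R r by (intro circle_mean_norm_mono g) auto
        also have "\<dots> \<le> circle_mean (\<lambda>z. 2 * norm (f (of_real R * z)))"
        proof (rule circle_mean_mono)
          show "continuous_on (sphere 0 1) (\<lambda>z. norm (g (of_real R * z)))"
            "continuous_on (sphere 0 1) (\<lambda>z. 2 * norm (f (of_real R * z)))"
            using R by (intro continuous_intros dil holomorphic_on_imp_continuous_on g fh; simp)+
          fix z :: complex assume "norm z = 1"
          then have n: "norm (of_real R * z) = R" using R by (simp add: norm_mult)
          have "norm (Q (of_real R * z)) \<le> 2 * norm (A (of_real R * z))"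
            using \<rho>2(3)[of "of_real R * z"] R unfolding n by simp
          then have "norm (Q (of_real R * z)) * norm (k (of_real R * z)) \<le> 2 * norm (A (of_real R * z)) * norm (k (of_real R * z))"
            by (intro mult_right_mono) auto
          then show "norm (g (of_real R * z)) \<le> 2 * norm (f (of_real R * z))"
            using fk[of "of_real R * z"] R unfolding g_def n by (simp add: norm_mult mult.assoc)
        qed
        also have "\<dots> = 2 * circle_mean (\<lambda>z. norm (f (of_real R * z)))" by (rule circle_mean_cmult)
        finally have "t * circle_mean (\<lambda>z. norm (g (of_real r * z))) \<le> t * (2 * circle_mean (\<lambda>z. norm (f (of_real R * z))))"
          using t0 by (intro mult_left_mono) auto
        then show ?thesis using meanf by simp
      qed
      define y where "y = (\<lambda>z. w (of_real r * z) * (1 - A (of_real r * z) / Q (of_real r * z) * cnj (\<theta> (of_real r * z))))"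
      have cQ: "continuous_on (sphere 0 1) (\<lambda>z. A (of_real r * z))" "continuous_on (sphere 0 1) (\<lambda>z. Q (of_real r * z))"
        using r by (intro dil Ac; simp)+
      have cy: "continuous_on (sphere 0 1) y"
        unfolding y_def using Qnz nr r by (intro continuous_intros cw cQ c\<theta>) auto
      have y: "norm (y z) \<le> 6 * \<epsilon>" if z: "norm z = 1" for z
      proof -
        let ?z = "of_real r * z"
        let ?B = "A ?z / Q ?z"
        have n: "norm ?z \<le> 1" using nr[OF z] r by simp
        have "y z = w ?z * (of_real (1 - (norm (\<theta> ?z))\<^sup>2) + (\<theta> ?z - ?B) * cnj (\<theta> ?z))"
          unfolding y_def of_real_diff complex_norm_square by (simp add: algebra_simps)
        then have "norm (y z) \<le> norm (w ?z) * (norm (complex_of_real (1 - (norm (\<theta> ?z))\<^sup>2)) + norm ((\<theta> ?z - ?B) * cnj (\<theta> ?z)))"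
          by (simp only: norm_mult[of "w ?z"]) (intro mult_left_mono norm_triangle_ineq; simp)
        also have "norm (complex_of_real (1 - (norm (\<theta> ?z))\<^sup>2)) = 1 - (norm (\<theta> ?z))\<^sup>2"
          unfolding norm_of_real using \<theta>(2)[OF n] by (simp add: abs_square_le_1 less_imp_le)
        also have "norm ((\<theta> ?z - ?B) * cnj (\<theta> ?z)) \<le> (2 * \<epsilon>) * 1"
          unfolding norm_mult
        proof (rule mult_mono)
          have "norm (\<theta> ?z - ?B) \<le> norm (poly P ?z - \<theta> ?z) + norm (?B - poly P ?z)"
            using norm_triangle_ineq[of "poly P ?z - \<theta> ?z" "?B - poly P ?z"] by (simp add: norm_minus_commute)
          then show "norm (\<theta> ?z - ?B) \<le> 2 * \<epsilon>"
            using P[OF n] e(2) near[OF nr[OF z]] by simp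
        qed (use \<theta>(2)[OF n] \<epsilon> in auto)
        finally have "norm (y z) \<le> norm (w ?z) * (1 - (norm (\<theta> ?z))\<^sup>2) + norm (w ?z) * (2 * \<epsilon>)"
          by (simp add: distrib_left mult_left_mono)
        also have "norm (w ?z) * (1 - (norm (\<theta> ?z))\<^sup>2) \<le> 2 * \<epsilon>"
          using \<rho>1(3)[of ?z] nr[OF z] r by simp
        also have "norm (w ?z) * (2 * \<epsilon>) \<le> 2 * (2 * \<epsilon>)"
          using w(4)[OF n] \<epsilon> by (intro mult_right_mono) auto
        finally show ?thesis by simp
      qed
      have "g 0 = circle_mean (\<lambda>z. g (of_real r * z) * w (of_real r * z))"
      proof -
        have h: "(\<lambda>z. g z * w z) holomorphic_on ball 0 1" by (intro holomorphic_intros g w)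
        have "1 < 1 / r" using r by simp
        from circle_mean_Cauchy[OF holomorphic_dilation[OF h r(1)] this, of 0] show ?thesis
          using w(3) by simp
      qed
      also have "\<dots> = circle_mean (\<lambda>z. f (of_real r * z) * cnj (u z) + g (of_real r * z) * y z)"
      proof (rule circle_mean_cong)
        fix z :: complex assume z: "norm z = 1"
        have n: "norm (of_real r * z) \<le> 1" "norm (of_real r * z) < 1" using nr[OF z] r by auto
        have "g (of_real r * z) * (A (of_real r * z) / Q (of_real r * z)) = f (of_real r * z)"
          using Qnz[OF n(1)] fk[OF n(2)] by (simp add: g_def)
        moreover have "a * b = a * c * (d * b) + a * (b * (1 - c * d))" for a b c d :: complex
          by (simp add: algebra_simps)
        ultimately show "g (of_real r * z) * w (of_real r * z) = f (of_real r * z) * cnj (u z) + g (of_real r * z) * y z"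
          unfolding u_def y_def complex_cnj_mult complex_cnj_cnj by metis
      qed
      also have "\<dots> = circle_mean (\<lambda>z. f (of_real r * z) * cnj (u z)) + circle_mean (\<lambda>z. g (of_real r * z) * y z)"
        by (intro circle_mean_add continuous_intros cf cu cg cy)
      finally have "norm (g 0) \<le> norm (circle_mean (\<lambda>z. f (of_real r * z) * cnj (u z))) + norm (circle_mean (\<lambda>z. g (of_real r * z) * y z))"
        using norm_triangle_ineq by simp
      then have "t * norm (g 0) \<le> t * (norm (circle_mean (\<lambda>z. f (of_real r * z) * cnj (u z))) + norm (circle_mean (\<lambda>z. g (of_real r * z) * y z)))"
        using t0 by (intro mult_left_mono) auto
      then have main: "1 \<le> t * norm (circle_mean (\<lambda>z. f (of_real r * z) * cnj (u z))) + t * norm (circle_mean (\<lambda>z. g (of_real r * z) * y z))"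
        unfolding tg by (simp add: distrib_left)
      have one: "t * norm (circle_mean (\<lambda>z. f (of_real r * z) * cnj (u z)))
          \<le> t * norm (f 0) * 2 + \<kappa> * 2\<^sup>2 + 4 * \<kappa> powr (1 - p) * ((18 + 2 * (exp pi)\<^sup>2) * \<epsilon>) powr (2 - p) * t powr p * enn2real (besov_integral p f)"
        by (rule besov_pairing[OF fh cu u2 \<beta> r(1,2) \<kappa> _ p]) (use t0 in auto)
      have two: "t * norm (circle_mean (\<lambda>z. g (of_real r * z) * y z)) \<le> 12 * \<epsilon> * (3 + 4 * I)"
      proof -
        have "norm (circle_mean (\<lambda>z. g (of_real r * z) * y z)) \<le> circle_mean (\<lambda>z. norm (g (of_real r * z) * y z))"
          by (intro norm_circle_mean_le continuous_intros cg cy)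
        also have "\<dots> \<le> circle_mean (\<lambda>z. 6 * \<epsilon> * norm (g (of_real r * z)))"
        proof (rule circle_mean_mono)
          show "norm (g (of_real r * z) * y z) \<le> 6 * \<epsilon> * norm (g (of_real r * z))" if "norm z = 1" for z
            using mult_left_mono[OF y[OF that], of "norm (g (of_real r * z))"] by (simp add: norm_mult mult.commute)
        qed (intro continuous_intros cg cy)+
        also have "\<dots> = 6 * \<epsilon> * circle_mean (\<lambda>z. norm (g (of_real r * z)))" by (rule circle_mean_cmult)
        finally have "t * norm (circle_mean (\<lambda>z. g (of_real r * z) * y z)) \<le> 6 * \<epsilon> * (t * circle_mean (\<lambda>z. norm (g (of_real r * z))))"
          using mult_left_mono[of _ _ t] t0 by (simp add: mult.left_commute)
        also have "\<dots> \<le> 6 * \<epsilon> * (2 * (3 + 4 * I))" using meang \<epsilon> by (intro mult_left_mono) auto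
        also have "\<dots> = 12 * \<epsilon> * (3 + 4 * I)" by (simp add: algebra_simps)
        finally show ?thesis .
      qed
      have "t * norm (f 0) * 2 \<le> 1 / 2 + 2 * \<epsilon>" using t1 f(2) by simp
      then show "1 \<le> 1 / 2 + extremal_error \<epsilon> \<kappa> p ((\<Prod>z\<leftarrow>\<sigma>. norm z) powr p * enn2real (besov_integral p f))"
        using main one two unfolding extremal_error_def t_def[symmetric] I_def by (simp add: mult.assoc)
    qed
    with \<sigma> show "\<exists>\<sigma>. length \<sigma> = N \<and> set \<sigma> \<subseteq> ball 0 1 - {0} \<and> extremal_bound \<epsilon> \<sigma>" by blast
  qed
qed

lemma extremal_bound_capacity:
  assumes \<sigma>: "set \<sigma> \<subseteq> ball 0 1 - {0}" and b: "extremal_bound \<epsilon> \<sigma>" and \<epsilon>: "0 < \<epsilon>"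
    and p: "1 \<le> p" "p < 2" and M: "0 \<le> M"
    and small: "extremal_error \<epsilon> \<kappa> p (M powr p) < 1 / 2" and \<kappa>: "0 < \<kappa>"
  shows "M \<le> (\<Prod>z\<leftarrow>\<sigma>. norm z) * capacity (besov_space p) (besov_norm p) \<sigma>"
proof -
  define t where "t = (\<Prod>z\<leftarrow>\<sigma>. norm z)"
  have t: "0 < t" using \<sigma> unfolding t_def by (induction \<sigma>) auto
  have "M / t \<le> capacity (besov_space p) (besov_norm p) \<sigma>"
  proof (rule capacity_geI[OF \<sigma> p(1)])
    fix f assume f: "f \<in> besov_space p" "f 0 = 1" "vanishes_on_seq f \<sigma>"
    define I where "I = enn2real (besov_integral p f)"
    have I: "0 \<le> I" by (simp add: I_def)
    show "M / t \<le> besov_norm p f"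
    proof (rule ccontr)
      assume "\<not> ?thesis"
      then have "1 + I powr (1 / p) < M / t" using f(2) by (simp add: besov_norm_def I_def)
      then have "t * (1 + I powr (1 / p)) < M" using t by (simp add: pos_less_divide_eq mult.commute)
      then have "t * (I powr (1 / p)) \<le> M" using t by (simp add: distrib_left)
      then have "(t * (I powr (1 / p))) powr p \<le> M powr p" using t p by (intro powr_mono2) auto
      moreover have "(t * (I powr (1 / p))) powr p = t powr p * I"
        using t p I by (simp add: powr_mult powr_powr)
      ultimately have X: "t powr p * I \<le> M powr p" by simp
      have "1 \<le> 1 / 2 + extremal_error \<epsilon> \<kappa> p (t powr p * I)"
        using b p f \<kappa> unfolding extremal_bound_def t_def I_def by blast
      also have "\<dots> \<le> 1 / 2 + extremal_error \<epsilon> \<kappa> p (M powr p)"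
        using X \<epsilon> by (intro add_left_mono extremal_error_mono) auto
      finally show False using small by simp
    qed
  qed
  then show ?thesis using t by (simp add: t_def[symmetric] pos_divide_le_eq mult.commute)
qed

theorem theorem5:
  "\<exists>\<sigma> :: nat \<Rightarrow> complex list.
     (\<forall>N\<ge>1. length (\<sigma> N) = N \<and> set (\<sigma> N) \<subseteq> ball 0 1 - {0}) \<and>
     (\<forall>p::real. 1 \<le> p \<and> p < 2 \<longrightarrow>
        filterlim (\<lambda>N. (\<Prod>z\<leftarrow>\<sigma> N. norm z) * capacity (besov_space p) (besov_norm p) (\<sigma> N))
          at_top sequentially)"
proof -
  define \<epsilon> :: "nat \<Rightarrow> real" where "\<epsilon> = (\<lambda>j. 1 / (real j + 2))"
  have \<epsilon>: "0 < \<epsilon> j" "\<epsilon> j \<le> 1 / 2" for j by (auto simp: \<epsilon>_def divide_simps)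
  define good where "good = (\<lambda>j N \<sigma>. length \<sigma> = N \<and> set \<sigma> \<subseteq> ball 0 1 - {0} \<and> extremal_bound (\<epsilon> j) \<sigma>)"
  \<comment> \<open>For each \<open>N\<close> use the best precision \<open>\<epsilon> j\<close> with \<open>j \<le> N\<close> that is attained by a sequence of length
    \<open>N\<close>; every precision is attained for all large \<open>N\<close>.\<close>
  define J where "J = (\<lambda>N. {j. j \<le> N \<and> (\<exists>\<sigma>. good j N \<sigma>)})"
  have fin: "finite (J N)" for N by (auto simp: J_def)
  define \<sigma> where "\<sigma> = (\<lambda>N. if J N = {} then replicate N (1 / 2) else SOME \<sigma>. good (Max (J N)) N \<sigma>)"
  have good: "good (Max (J N)) N (\<sigma> N)" if "J N \<noteq> {}" for N
  proof -
    have "Max (J N) \<in> J N" by (rule Max_in[OF fin that])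
    then have "\<exists>\<sigma>. good (Max (J N)) N \<sigma>" by (simp add: J_def)
    then show ?thesis using that by (simp add: \<sigma>_def someI_ex)
  qed
  have basic: "length (\<sigma> N) = N \<and> set (\<sigma> N) \<subseteq> ball 0 1 - {0}" for N
  proof (cases "J N = {}")
    case True
    moreover have "(1 / 2 :: complex) \<in> ball 0 1 - {0}" by (simp add: norm_divide)
    ultimately show ?thesis by (simp add: \<sigma>_def set_replicate_conv_if)
  next
    case False
    then show ?thesis using good[OF False] by (simp add: good_def)
  qed
  have large: "eventually (\<lambda>N. J N \<noteq> {} \<and> j \<le> Max (J N)) sequentially" for j
  proof -
    obtain N0 where N0: "\<And>N. N0 \<le> N \<Longrightarrow> \<exists>\<sigma>. good j N \<sigma>"
      using extremal_bound_exists[OF \<epsilon>, of j] unfolding good_def by blast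
    have "J N \<noteq> {} \<and> j \<le> Max (J N)" if "max j N0 \<le> N" for N
    proof -
      have "j \<in> J N" using N0[of N] that by (simp add: J_def)
      then show ?thesis using Max_ge[OF fin] by blast
    qed
    then show ?thesis unfolding eventually_sequentially by blast
  qed
  have "filterlim (\<lambda>N. (\<Prod>z\<leftarrow>\<sigma> N. norm z) * capacity (besov_space p) (besov_norm p) (\<sigma> N)) at_top sequentially"
    if p: "1 \<le> p" "p < 2" for p :: real
    unfolding filterlim_at_top_ge[where c = 0]
  proof (intro allI impI)
    fix M :: real assume M: "0 \<le> M"
    have e0: "\<epsilon> \<longlonglongrightarrow> 0" unfolding \<epsilon>_def by real_asymp
    have "(\<lambda>j. extremal_error (\<epsilon> j) (1 / 32) p (M powr p)) \<longlonglongrightarrow> 4 * (1 / 32)"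
      using p \<epsilon>(1) by (intro extremal_error_tendsto e0) (auto intro: less_imp_le)
    then have "eventually (\<lambda>j. extremal_error (\<epsilon> j) (1 / 32) p (M powr p) < 1 / 2) sequentially"
      by (rule order_tendstoD(2)) simp
    then obtain j0 where j0: "\<And>j. j0 \<le> j \<Longrightarrow> extremal_error (\<epsilon> j) (1 / 32) p (M powr p) < 1 / 2"
      unfolding eventually_sequentially by blast
    from large[of j0]
    show "eventually (\<lambda>N. M \<le> (\<Prod>z\<leftarrow>\<sigma> N. norm z) * capacity (besov_space p) (besov_norm p) (\<sigma> N)) sequentially"
    proof eventually_elim
      case (elim N)
      then have "good (Max (J N)) N (\<sigma> N)" using good by blast
      then show ?case
        using elim j0[of "Max (J N)"] by (intro extremal_bound_capacity[OF _ _ \<epsilon>(1) p M, of _ _ "1 / 32"]) (auto simp: good_def)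
    qed
  qed
  then show ?thesis using basic by blast
qed

end
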